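(* Satisfiability of $\mathcal L_{\mathrm{CL\text{-}P}^*}$-formulas is decidable in NP.
   Context: $\mathit{Agt}$ is a finite set of agents. Formulas of $\mathcal L_{\mathrm{CL\text{-}P}^*}$ (compass logic of positions) are given by $\varphi ::= \mathsf h_i \mid \neg\varphi \mid \varphi\wedge\psi \mid [\alpha]\varphi$ with $i\in\mathit{Agt}$ and $\alpha\in\{\Uparrow,\Downarrow,\Rightarrow,\Leftarrow,\Uparrow^*,\Downarrow^*,\Rightarrow^*,\Leftarrow^*\}$ (there are no other atomic propositions). A position model is a function $\mathcal P:\mathit{Agt}\to\mathbb Z\times\mathbb Z$. Relations on $\mathbb Z\times\mathbb Z$: $(x,y)R_\Uparrow(x,y+1)$, $(x,y)R_\Downarrow(x,y-1)$, $(x,y)R_\Rightarrow(x+1,y)$, $(x,y)R_\Leftarrow(x-1,y)$ (and no other pairs), and $R_{\alpha^*}$ is the reflexive transitive closure of $R_\alpha$. Truth: $\mathcal P,(x,y)\models \mathsf h_i$ iff $\mathcal P(i)=(x,y)$; Boolean connectives as usual; $\mathcal P,(x,y)\models[\alpha]\varphi$ iff $\mathcal P,(x',y')\models\varphi$ for all $(x',y')$ with $(x,y)R_\alpha(x',y')$. A formula is satisfiable if it is true in some position model at some position. *)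

theory Defs
  imports "HOL-Library.FuncSet" "HOL-Computational_Algebra.Polynomial"
begin

section \<open>Compass logic of positions\<close>

datatype direction = North | South | East | West

datatype modality = Step direction | Star direction

datatype (agents: 'i) fm =
    Here 'i
  | Neg "'i fm"
  | Conj "'i fm" "'i fm"
  | Box modality "'i fm"

definition formulas :: "'i set \<Rightarrow> 'i fm set" where
  "formulas Agt = {\<phi>. agents \<phi> \<subseteq> Agt}"

fun step_rel :: "direction \<Rightarrow> ((int \<times> int) \<times> (int \<times> int)) set" where
  "step_rel North = {((x, y), (x, y + 1)) | x y. True}"
| "step_rel South = {((x, y), (x, y - 1)) | x y. True}"
| "step_rel East = {((x, y), (x + 1, y)) | x y. True}"
| "step_rel West = {((x, y), (x - 1, y)) | x y. True}"

fun rel :: "modality \<Rightarrow> ((int \<times> int) \<times> (int \<times> int)) set" where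
  "rel (Step d) = step_rel d"
| "rel (Star d) = (step_rel d)\<^sup>*"

primrec truth :: "('i \<Rightarrow> int \<times> int) \<Rightarrow> int \<times> int \<Rightarrow> 'i fm \<Rightarrow> bool" where
  "truth P p (Here i) \<longleftrightarrow> P i = p"
| "truth P p (Neg \<phi>) \<longleftrightarrow> \<not> truth P p \<phi>"
| "truth P p (Conj \<phi> \<psi>) \<longleftrightarrow> truth P p \<phi> \<and> truth P p \<psi>"
| "truth P p (Box \<alpha> \<phi>) \<longleftrightarrow> (\<forall>p'. (p, p') \<in> rel \<alpha> \<longrightarrow> truth P p' \<phi>)"

definition position_models :: "'i set \<Rightarrow> ('i \<Rightarrow> int \<times> int) set" where
  "position_models Agt = Agt \<rightarrow>\<^sub>E UNIV"

definition satisfiable :: "'i set \<Rightarrow> 'i fm \<Rightarrow> bool" where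
  "satisfiable Agt \<phi> \<longleftrightarrow> (\<exists>P \<in> position_models Agt. \<exists>p. truth P p \<phi>)"


section \<open>Nondeterministic Turing machines and the class NP\<close>

text \<open>
  Machines have several two-way infinite tapes. A transition \<open>(q, as, q')\<close> lists for each tape
  the symbol read, the symbol written and the head move. States and working symbols are drawn from
  \<open>nat\<close>; since the set of transitions is finite, each machine uses only finitely many of them.
\<close>

datatype 'a symbol = Blank | Letter 'a | Work nat

datatype move = MoveL | Stay | MoveR

type_synonym 'a tape = "(int \<Rightarrow> 'a symbol) \<times> int"

type_synonym 'a action = "'a symbol \<times> 'a symbol \<times> move"

type_synonym 'a config = "nat \<times> 'a tape list"

record 'a ntm =
  num_tapes :: nat
  start_state :: nat
  accept_state :: nat
  transitions :: "(nat \<times> 'a action list \<times> nat) set"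

definition wf_ntm :: "'a ntm \<Rightarrow> bool" where
  "wf_ntm M \<longleftrightarrow> num_tapes M \<ge> 1 \<and> finite (transitions M) \<and>
     (\<forall>(q, as, q') \<in> transitions M. length as = num_tapes M \<and> q \<noteq> accept_state M)"

fun head_shift :: "move \<Rightarrow> int" where
  "head_shift MoveL = - 1"
| "head_shift Stay = 0"
| "head_shift MoveR = 1"

fun applicable :: "'a tape \<Rightarrow> 'a action \<Rightarrow> bool" where
  "applicable (f, h) (r, w, m) \<longleftrightarrow> f h = r"

fun act :: "'a tape \<Rightarrow> 'a action \<Rightarrow> 'a tape" where
  "act (f, h) (r, w, m) = (f(h := w), h + head_shift m)"

definition ntm_step :: "'a ntm \<Rightarrow> ('a config \<times> 'a config) set" where
  "ntm_step M = {((q, ts), (q', map2 act ts as)) | q ts as q'.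
     (q, as, q') \<in> transitions M \<and> list_all2 applicable ts as}"

definition input_tape :: "'a list \<Rightarrow> 'a tape" where
  "input_tape w =
     ((\<lambda>i. if 0 \<le> i \<and> i < int (length w) then Letter (w ! nat i) else Blank), 0)"

definition initial :: "'a ntm \<Rightarrow> 'a list \<Rightarrow> 'a config" where
  "initial M w = (start_state M, input_tape w # replicate (num_tapes M - 1) (input_tape []))"

definition accepts :: "'a ntm \<Rightarrow> 'a list \<Rightarrow> bool" where
  "accepts M w \<longleftrightarrow> (\<exists>ts. (initial M w, (accept_state M, ts)) \<in> (ntm_step M)\<^sup>*)"

text \<open>The time bound applies to all computation paths, so the machine halts on every branch.\<close>

definition runs_in_time :: "'a ntm \<Rightarrow> (nat \<Rightarrow> nat) \<Rightarrow> bool" where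
  "runs_in_time M T \<longleftrightarrow>
     (\<forall>w n c. (initial M w, c) \<in> ntm_step M ^^ n \<longrightarrow> n \<le> T (length w))"

definition NP :: "'a::finite list set set" where
  "NP = {L. \<exists>M (p :: nat poly).
     wf_ntm M \<and> runs_in_time M (poly p) \<and> (\<forall>w. w \<in> L \<longleftrightarrow> accepts M w)}"


section \<open>The satisfiability problem as a language\<close>

text \<open>
  Agents are named by natural numbers. Formulas are written in prefix notation over a fixed finite
  alphabet; the name of an agent is written in binary, least significant bit first (so zero is the
  empty bit string).
\<close>

datatype letter = L_Here | L_Bit bool | L_Neg | L_Conj | L_Box modality

instance direction :: finite
proof
  have "(UNIV :: direction set) = {North, South, East, West}"
    using direction.exhaust by auto
  then show "finite (UNIV :: direction set)"
    by (metis finite.simps)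
qed

instance modality :: finite
proof
  have "(UNIV :: modality set) = range Step \<union> range Star"
    by (auto simp: image_iff) (metis modality.exhaust)
  then show "finite (UNIV :: modality set)"
    by (metis finite_UnI finite_imageI finite)
qed

instance letter :: finite
proof
  have "(UNIV :: letter set) = {L_Here, L_Neg, L_Conj} \<union> range L_Bit \<union> range L_Box"
    by (auto simp: image_iff) (metis letter.exhaust)
  moreover have "finite ({L_Here, L_Neg, L_Conj} \<union> range L_Bit \<union> range L_Box)"
    by simp
  ultimately show "finite (UNIV :: letter set)"
    by metis
qed

fun binary :: "nat \<Rightarrow> bool list" where
  "binary n = (if n = 0 then [] else odd n # binary (n div 2))"

declare binary.simps [simp del]

primrec encode :: "nat fm \<Rightarrow> letter list" where
  "encode (Here i) = L_Here # map L_Bit (binary i)"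
| "encode (Neg \<phi>) = L_Neg # encode \<phi>"
| "encode (Conj \<phi> \<psi>) = L_Conj # encode \<phi> @ encode \<psi>"
| "encode (Box \<alpha> \<phi>) = L_Box \<alpha> # encode \<phi>"

definition SAT :: "nat set \<Rightarrow> letter list set" where
  "SAT Agt = {encode \<phi> | \<phi>. \<phi> \<in> formulas Agt \<and> satisfiable Agt \<phi>}"

text \<open>The encoding is unambiguous, so membership of \<open>encode \<phi>\<close> in \<^const>\<open>SAT\<close> depends on \<open>\<phi>\<close> only.\<close>

lemma binary_inject: "binary m = binary n \<Longrightarrow> m = n"
proof (induction m arbitrary: n rule: less_induct)
  case (less m)
  show ?case
  proof (cases "m = 0 \<or> n = 0")
    case True
    then show ?thesis
      using less.prems by (auto simp: binary.simps[of m] binary.simps[of n] split: if_splits)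
  next
    case False
    then have "odd m = odd n" and "binary (m div 2) = binary (n div 2)"
      using less.prems by (simp_all add: binary.simps[of m] binary.simps[of n])
    moreover from this have "m div 2 = n div 2"
      using False by (intro less.IH) auto
    ultimately show ?thesis
      by (metis bit_eq_rec)
  qed
qed

definition no_bit :: "letter list \<Rightarrow> bool" where
  "no_bit u \<longleftrightarrow> (\<forall>b v. u \<noteq> L_Bit b # v)"

lemma bits_append_inject:
  "map L_Bit bs @ u = map L_Bit cs @ v \<Longrightarrow> no_bit u \<Longrightarrow> no_bit v \<Longrightarrow> bs = cs \<and> u = v"
proof (induction bs arbitrary: cs)
  case Nil
  then show ?case
    by (cases cs) (auto simp: no_bit_def)
next
  case (Cons b bs)
  then show ?case
    by (cases cs) (auto simp: no_bit_def)
qed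

lemma no_bit_encode: "no_bit (encode \<phi> @ u)"
  by (cases \<phi>) (auto simp: no_bit_def)

lemma encode_append_inject:
  "encode \<phi> @ u = encode \<psi> @ v \<Longrightarrow> no_bit u \<Longrightarrow> no_bit v \<Longrightarrow> \<phi> = \<psi> \<and> u = v"
proof (induction \<phi> arbitrary: \<psi> u v)
  case (Here i)
  then show ?case
    by (cases \<psi>) (auto dest: bits_append_inject binary_inject)
next
  case (Neg \<phi>)
  then show ?case
    by (cases \<psi>) auto
next
  case (Conj \<phi>1 \<phi>2)
  show ?case
  proof (cases \<psi>)
    case (Conj \<psi>1 \<psi>2)
    then have "encode \<phi>1 @ (encode \<phi>2 @ u) = encode \<psi>1 @ (encode \<psi>2 @ v)"
      using Conj.prems(1) by simp
    then have "\<phi>1 = \<psi>1 \<and> encode \<phi>2 @ u = encode \<psi>2 @ v"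
      by (rule Conj.IH(1)) (rule no_bit_encode)+
    then show ?thesis
      using Conj.IH(2) Conj.prems Conj by blast
  qed (use Conj.prems in auto)
next
  case (Box \<alpha> \<phi>)
  then show ?case
    by (cases \<psi>) auto
qed

lemma inj_encode: "inj encode"
  by (rule injI) (use encode_append_inject[where u = "[]" and v = "[]"] in \<open>auto simp: no_bit_def\<close>)

lemma encode_in_SAT_iff:
  "encode \<phi> \<in> SAT Agt \<longleftrightarrow> \<phi> \<in> formulas Agt \<and> satisfiable Agt \<phi>"
  using inj_encode by (auto simp: SAT_def dest: injD)

end

theory Submission imports Defs "HOL-Library.Countable" begin

text \<open>
  A formula of depth \<open>d\<close> cannot distinguish two points whose offsets from all agents agree up to a
  threshold linear in \<open>d\<close>; this is a back-and-forth argument on each axis separately. Therefore long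
  gaps between the coordinates of agents can be contracted: a satisfiable formula of length \<open>n\<close> is
      true
  in a model whose agents lie in a grid of side \<open>M\<close> polynomial in \<open>n\<close>,
      and beyond the border of the grid
  truth values are constant.

  Consequently, a word encodes a satisfiable formula iff there are relations over \<open>{0..M}\<close>, namely
      a parse of
  the word and a truth table of the subformulas on the grid, that satisfy a fixed first-order
  sentence: the star modalities unfold step by step, which makes all conditions local.

  A nondeterministic machine guesses \<open>M\<close> and the relations
      and evaluates the sentence. It is obtained from
  a program in which every loop is executed at most \<open>n + 2\<close> times (longer loops are nested loops).
  Hence its running time is bounded on all branches
      by a polynomial that depends only on the shape of
  the program, not on what the program computes.
\<close>

section \<open>Nondeterministic programs over stacks\<close>

text \<open>The time bound must hold on every branch, also where the guesses are wrong, so no loop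
  may depend on a good guess in order to stop. Each loop is therefore paid for from a finite supply
  of symbols, counted out from the input before the program proper starts. The bound is n + 2 rather
  than n because a base of at least 2 is needed: its powers then exceed every constant, even on the
  empty word. Each modality moves along one axis, and an agent is at a point iff both coordinates
  match; this is why the axes can be treated separately. One unit of the threshold is lost per
  modality and each agent needs room linear in the depth, so M can be quadratic in n. The collapse
  of the plane outside the grid has two consequences. Agents must keep a distance from the border
  that exceeds the depth, otherwise the border would not represent the outside. And the unfolding of
  a star is a fixed-point equation that has several solutions where a step returns to the same cell;
  a separate condition at the border selects the right one. Names of agents have no fixed length, so
  their equality is one of the guessed relations.\<close>

datatype (regs: 'r, syms: 'b) cmd =
    Push 'r 'b
  | Pop 'r 'b
  | Empty 'r
  | Seq "('r, 'b) cmd" "('r, 'b) cmd"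
  | Choice "('r, 'b) cmd" "('r, 'b) cmd"
  | Loop "('r, 'b) cmd"

type_synonym ('r, 'b) store = "'r \<Rightarrow> 'b list"

inductive step :: "('r, 'b) cmd list \<times> ('r, 'b) store \<Rightarrow> ('r, 'b) cmd list \<times> ('r, 'b) store \<Rightarrow> bool"
where
  Push: "step (Push r b # K, s) (K, s(r := b # s r))"
| Pop: "s r = b # l \<Longrightarrow> step (Pop r b # K, s) (K, s(r := l))"
| Empty: "s r = [] \<Longrightarrow> step (Empty r # K, s) (K, s)"
| Seq: "step (Seq c d # K, s) (c # d # K, s)"
| Choice1: "step (Choice c d # K, s) (c # K, s)"
| Choice2: "step (Choice c d # K, s) (d # K, s)"
| Exit: "step (Loop c # K, s) (K, s)"
| Enter: "step (Loop c # K, s) (c # Loop c # K, s)"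

inductive_simps step_iff:
  "step ([], s) x"
  "step (Push r b # K, s) x"
  "step (Pop r b # K, s) x"
  "step (Empty r # K, s) x"
  "step (Seq c d # K, s) x"
  "step (Choice c d # K, s) x"
  "step (Loop c # K, s) x"

lemma step_append: "step (K, s) (K', s') \<Longrightarrow> step (K @ L, s) (K' @ L, s')"
  by (induction "(K, s)" "(K', s')" rule: step.induct) (auto intro: step.intros)

lemma steps_append: "(step ^^ n) (K, s) (K', s') \<Longrightarrow> (step ^^ n) (K @ L, s) (K' @ L, s')"
proof (induction n arbitrary: K' s')
  case (Suc n)
  then obtain Q t where "(step ^^ n) (K, s) (Q, t)" "step (Q, t) (K', s')"
    by auto
  then show ?case
    using Suc.IH step_append by (metis relpowp_Suc_I)
qed simp

lemma step_local:
  "step (c # K, s) (Q, t) \<Longrightarrow> \<exists>K'. Q = K' @ K \<and> step ([c], s) (K', t)"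
proof (induction "(c # K, s)" "(Q, t)" rule: step.induct)
  case Seq then show ?case by (metis append_Cons append_Nil step.Seq)
next
  case Enter then show ?case by (metis append_Cons append_Nil step.Enter)
next
  case (Choice1 c d) then show ?case by (metis append_Cons append_Nil step.Choice1)
next
  case (Choice2 c d) then show ?case by (metis append_Cons append_Nil step.Choice2)
qed (auto intro: step.intros)

text \<open>A step touches only the head of the continuation, so a run of \<open>K @ L\<close> is a
  run of \<open>K\<close> until \<open>K\<close> is used up. All compositional rules for
  \<open>exec\<close> and \<open>bounded\<close> rest on this.\<close>

lemma steps_append_cases:
  assumes "(step ^^ n) (K @ L, s) (Q, t)"
  obtains K' where "Q = K' @ L" "(step ^^ n) (K, s) (K', t)"
  | m s' where "m \<le> n" "(step ^^ m) (K, s) ([], s')" "(step ^^ (n - m)) (L, s') (Q, t)"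
  using assms
proof (induction n arbitrary: K s thesis)
  case 0
  then show ?case by simp
next
  case (Suc n)
  show ?case
  proof (cases K)
    case Nil
    show ?thesis
      by (rule Suc.prems(2)[of 0]) (use Suc.prems(3) Nil in auto)
  next
    case (Cons c K1)
    obtain Q1 s1 where 1: "step (c # (K1 @ L), s) (Q1, s1)" "(step ^^ n) (Q1, s1) (Q, t)"
      using relpowp_Suc_D2[OF Suc.prems(3)] Cons by auto
    from step_local[OF 1(1)] obtain K2 where K2: "Q1 = (K2 @ K1) @ L" "step ([c], s) (K2, s1)"
      by auto
    have *: "step (K, s) (K2 @ K1, s1)"
      using step_append[OF K2(2), of K1] Cons by simp
    show ?thesis
    proof (rule Suc.IH[of "K2 @ K1" s1])
      show "(step ^^ n) ((K2 @ K1) @ L, s1) (Q, t)"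
        using 1(2) K2(1) by simp
      show thesis if "Q = K' @ L" "(step ^^ n) (K2 @ K1, s1) (K', t)" for K'
        using Suc.prems(1)[of K'] that relpowp_Suc_I2[OF * that(2)] by blast
      show thesis if "m \<le> n" "(step ^^ m) (K2 @ K1, s1) ([], s')"
        "(step ^^ (n - m)) (L, s') (Q, t)" for m s'
        using Suc.prems(2)[of "Suc m" s'] that relpowp_Suc_I2[OF * that(2)] by simp
    qed
  qed
qed

section \<open>Terminating runs, and step bounds for all partial runs\<close>

definition exec :: "('r, 'b) cmd \<Rightarrow> ('r, 'b) store \<Rightarrow> ('r, 'b) store \<Rightarrow> bool" where
  "exec c s s' \<longleftrightarrow> (\<exists>n. (step ^^ n) ([c], s) ([], s'))"

text \<open>Partial runs count as well, including those that get stuck, because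
  \<open>runs_in_time\<close> also covers branches that never accept.\<close>

definition bounded :: "('r, 'b) cmd \<Rightarrow> ('r, 'b) store \<Rightarrow> nat \<Rightarrow> bool" where
  "bounded c s n \<longleftrightarrow> (\<forall>m x. (step ^^ m) ([c], s) x \<longrightarrow> m \<le> n)"

lemma steps_Nil_iff [simp]: "(step ^^ n) ([], s) x \<longleftrightarrow> n = 0 \<and> x = ([], s)"
  by (cases n) (auto simp: step_iff dest!: relpowp_Suc_D2 simp del: relpowp.simps(2))

lemma steps_first:
  assumes "(step ^^ n) x y" "n = 0 \<Longrightarrow> x = y \<Longrightarrow> P"
    "\<And>m z. n = Suc m \<Longrightarrow> step x z \<Longrightarrow> (step ^^ m) z y \<Longrightarrow> P"
  shows P
  using assms by (cases n) (simp, metis relpowp_Suc_D2)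

lemma exec_first:
  "(\<exists>n. (step ^^ n) (c # K, s) ([], t)) \<longleftrightarrow> (\<exists>z n. step (c # K, s) z \<and> (step ^^ n) z ([], t))"
  (is "?L \<longleftrightarrow> ?R")
proof
  assume ?L
  then obtain n where n: "(step ^^ n) (c # K, s) ([], t)" ..
  then have "n \<noteq> 0" by (cases n) auto
  then obtain m where "n = Suc m" by (cases n) auto
  then show ?R using relpowp_Suc_D2[of m step "(c # K, s)"] n by blast
next
  assume ?R
  then show ?L using relpowp_Suc_I2[of step "(c # K, s)"] by blast
qed

lemma exec_Push [simp]: "exec (Push r b) s s' \<longleftrightarrow> s' = s(r := b # s r)"
  unfolding exec_def exec_first by (simp add: step_iff)

lemma exec_Pop [simp]: "exec (Pop r b) s s' \<longleftrightarrow> (\<exists>l. s r = b # l \<and> s' = s(r := l))"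
  unfolding exec_def exec_first by (auto simp: step_iff)

lemma exec_Empty [simp]: "exec (Empty r) s s' \<longleftrightarrow> s r = [] \<and> s' = s"
  unfolding exec_def exec_first by (auto simp: step_iff)

lemma exec_append:
  "(\<exists>n. (step ^^ n) (c # L, s) ([], t)) \<longleftrightarrow> (\<exists>s' n. exec c s s' \<and> (step ^^ n) (L, s') ([], t))"
proof safe
  fix n assume "(step ^^ n) (c # L, s) ([], t)"
  then have "(step ^^ n) ([c] @ L, s) ([], t)" by simp
  then show "\<exists>s' n. exec c s s' \<and> (step ^^ n) (L, s') ([], t)"
    by (rule steps_append_cases) (auto simp: exec_def)
next
  fix s' n assume "exec c s s'" and 2: "(step ^^ n) (L, s') ([], t)"
  then obtain m where "(step ^^ m) ([c], s) ([], s')" by (auto simp: exec_def)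
  from relpowp_trans[OF steps_append[OF this, of L, simplified] 2]
  show "\<exists>n. (step ^^ n) (c # L, s) ([], t)" by blast
qed

lemma exec_Seq [simp]: "exec (Seq c d) s t \<longleftrightarrow> (\<exists>s'. exec c s s' \<and> exec d s' t)"
proof -
  have "exec (Seq c d) s t \<longleftrightarrow> (\<exists>n. (step ^^ n) (c # [d], s) ([], t))"
    unfolding exec_def exec_first[of "Seq c d"] by (simp add: step_iff)
  then show ?thesis
    unfolding exec_append by (auto simp: exec_def)
qed

lemma exec_Choice [simp]: "exec (Choice c d) s t \<longleftrightarrow> exec c s t \<or> exec d s t"
  unfolding exec_def exec_first[of "Choice c d"]
  by (simp add: step_iff conj_disj_distribR ex_disj_distrib)

lemma exec_Loop [simp]: "exec (Loop c) s t \<longleftrightarrow> (exec c)\<^sup>*\<^sup>* s t"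
proof
  have "(step ^^ n) ([Loop c], s) ([], t) \<Longrightarrow> (exec c)\<^sup>*\<^sup>* s t" for n
  proof (induction n arbitrary: s rule: less_induct)
    case (less n)
    from less.prems show ?case
    proof (rule steps_first)
      fix m z assume n: "n = Suc m" and z: "step ([Loop c], s) z" "(step ^^ m) z ([], t)"
      from z(1) consider "z = ([], s)" | "z = ([c, Loop c], s)" by (auto simp: step_iff)
      then show ?thesis
      proof cases
        assume "z = ([], s)"
        then show ?thesis using z(2) by simp
      next
        assume "z = ([c, Loop c], s)"
        then have "(step ^^ m) ([c] @ [Loop c], s) ([], t)" using z(2) by simp
        then show ?thesis
        proof (rule steps_append_cases)
          fix k s' assume "k \<le> m" "(step ^^ k) ([c], s) ([], s')"
            "(step ^^ (m - k)) ([Loop c], s') ([], t)"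
          then have "exec c s s'" "(exec c)\<^sup>*\<^sup>* s' t"
            using less.IH[of "m - k" s'] n unfolding exec_def[of c s] by auto
          then show ?thesis by (rule converse_rtranclp_into_rtranclp)
        qed simp
      qed
    qed simp
  qed
  then show "exec (Loop c) s t \<Longrightarrow> (exec c)\<^sup>*\<^sup>* s t" by (auto simp: exec_def)
next
  show "(exec c)\<^sup>*\<^sup>* s t \<Longrightarrow> exec (Loop c) s t"
  proof (induction rule: converse_rtranclp_induct)
    case base
    show ?case unfolding exec_def exec_first[of "Loop c"]
      by (simp add: step_iff conj_disj_distribR ex_disj_distrib)
  next
    case (step s s')
    then have "\<exists>n. (step ^^ n) (c # [Loop c], s) ([], t)"
      unfolding exec_append by (auto simp: exec_def)
    then show ?case unfolding exec_def exec_first[of "Loop c"]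
      by (simp add: step_iff conj_disj_distribR ex_disj_distrib)
  qed
qed

lemma bounded_mono: "bounded c s m \<Longrightarrow> m \<le> n \<Longrightarrow> bounded c s n"
  by (auto simp: bounded_def intro: order_trans)

lemma bounded_first:
  assumes "\<And>m y z. step ([c], s) z \<Longrightarrow> (step ^^ m) z y \<Longrightarrow> m \<le> n"
  shows "bounded c s (Suc n)"
  unfolding bounded_def using assms by (auto elim: steps_first)

lemma bounded_Push: "bounded (Push r b) s 1"
  and bounded_Pop: "bounded (Pop r b) s 1"
  and bounded_Empty: "bounded (Empty r) s 1"
  unfolding One_nat_def by (rule bounded_first; auto simp: step_iff)+

lemma bounded_append:
  assumes "(step ^^ k) (c # L, s) x" and "bounded c s m"
    and "\<And>s' k. exec c s s' \<Longrightarrow> (step ^^ k) (L, s') x \<Longrightarrow> k \<le> n"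
  shows "k \<le> m + n"
proof -
  obtain Q t where x: "x = (Q, t)" by (cases x)
  have "(step ^^ k) ([c] @ L, s) (Q, t)" using assms(1) x by simp
  then show ?thesis
  proof (rule steps_append_cases)
    fix K' assume "(step ^^ k) ([c], s) (K', t)"
    then have "k \<le> m" using assms(2) unfolding bounded_def by blast
    then show ?thesis by simp
  next
    fix j s' assume j: "j \<le> k" "(step ^^ j) ([c], s) ([], s')" "(step ^^ (k - j)) (L, s') (Q, t)"
    then have "j \<le> m" "k - j \<le> n"
      using assms(2,3) x unfolding bounded_def exec_def by blast+
    then show ?thesis by simp
  qed
qed

lemma bounded_Seq:
  assumes "bounded c s m" "\<And>s'. exec c s s' \<Longrightarrow> bounded d s' n"
  shows "bounded (Seq c d) s (Suc (m + n))"
  unfolding bounded_def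
proof safe
  fix k Q t assume "(step ^^ k) ([Seq c d], s) (Q, t)"
  then show "k \<le> Suc (m + n)"
  proof (rule steps_first)
    fix j z assume "k = Suc j" "step ([Seq c d], s) z" "(step ^^ j) z (Q, t)"
    then have "k = Suc j" "(step ^^ j) (c # [d], s) (Q, t)" by (auto simp: step_iff)
    moreover have "j \<le> m + n"
      by (rule bounded_append[OF calculation(2) assms(1)]) (use assms(2) in \<open>auto simp:
          bounded_def\<close>)
    ultimately show ?thesis by simp
  qed simp
qed

lemma bounded_Choice:
  assumes "bounded c s m" "bounded d s n"
  shows "bounded (Choice c d) s (Suc (m + n))"
proof (rule bounded_first)
  fix k y z assume "step ([Choice c d], s) z" "(step ^^ k) z y"
  then show "k \<le> m + n"
    using assms unfolding bounded_def
    unfolding step_iff by (elim disjE) (metis trans_le_add1, metis trans_le_add2)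
qed

text \<open>The ranking function \<open>\<mu>\<close> need only decrease over completed rounds. Even
  at measure 0 the body can be entered and get stuck, so \<open>\<mu> s + 1\<close> rounds are
  counted, each with one step for entering it.\<close>

lemma bounded_Loop:
  assumes "I s"
    and "\<And>s. I s \<Longrightarrow> bounded c s b"
    and "\<And>s s'. I s \<Longrightarrow> exec c s s' \<Longrightarrow> I s' \<and> \<mu> s' < \<mu> s"
  shows "bounded (Loop c) s (Suc (\<mu> s) * (b + 1))"
  using assms(1)
proof (induction "\<mu> s" arbitrary: s rule: less_induct)
  case less
  show ?case unfolding bounded_def
  proof safe
    fix k Q t assume "(step ^^ k) ([Loop c], s) (Q, t)"
    then show "k \<le> Suc (\<mu> s) * (b + 1)"
    proof (rule steps_first)
      fix j z assume k: "k = Suc j" and z: "step ([Loop c], s) z" "(step ^^ j) z (Q, t)"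
      from z(1) consider "z = ([], s)" | "z = ([c, Loop c], s)" by (auto simp: step_iff)
      then show ?thesis
      proof cases
        assume "z = ([], s)"
        then show ?thesis using z(2) k by simp
      next
        assume "z = ([c, Loop c], s)"
        then have *: "(step ^^ j) (c # [Loop c], s) (Q, t)" using z(2) by simp
        have "j \<le> b + \<mu> s * (b + 1)"
        proof (rule bounded_append[OF * assms(2)[OF less.prems]])
          fix s' i assume s': "exec c s s'" and i: "(step ^^ i) ([Loop c], s') (Q, t)"
          have "i \<le> Suc (\<mu> s') * (b + 1)"
            using less.hyps[of s'] assms(3)[OF less.prems s'] i by (auto simp: bounded_def)
          also have "\<dots> \<le> \<mu> s * (b + 1)"
            by (rule mult_right_mono) (use assms(3)[OF less.prems s'] in auto)
          finally show "i \<le> \<mu> s * (b + 1)" .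
        qed
        then show ?thesis using k by simp
      qed
    qed simp
  qed
qed

section \<open>Programs with bounded loops\<close>

text \<open>The specification of the compiled programs: every single execution of a loop is capped
  at \<open>N\<close> rounds, whereas \<open>exec\<close> leaves the number of rounds open.\<close>

primrec sem :: "nat \<Rightarrow> ('r, 'b) cmd \<Rightarrow> ('r, 'b) store \<Rightarrow> ('r, 'b) store \<Rightarrow> bool" where
  "sem N (Push r b) s s' \<longleftrightarrow> s' = s(r := b # s r)"
| "sem N (Pop r b) s s' \<longleftrightarrow> (\<exists>l. s r = b # l \<and> s' = s(r := l))"
| "sem N (Empty r) s s' \<longleftrightarrow> s r = [] \<and> s' = s"
| "sem N (Seq c d) s s' \<longleftrightarrow> (\<exists>t. sem N c s t \<and> sem N d t s')"
| "sem N (Choice c d) s s' \<longleftrightarrow> sem N c s s' \<or> sem N d s s'"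
| "sem N (Loop c) s s' \<longleftrightarrow> (\<exists>m\<le>N. (sem N c ^^ m) s s')"

primrec height :: "('r, 'b) cmd \<Rightarrow> nat" where
  "height (Push r b) = 0"
| "height (Pop r b) = 0"
| "height (Empty r) = 0"
| "height (Seq c d) = max (height c) (height d)"
| "height (Choice c d) = max (height c) (height d)"
| "height (Loop c) = Suc (height c)"

abbreviation fuel :: "nat \<Rightarrow> 'r + nat \<times> bool" where
  "fuel l \<equiv> Inr (l, False)"

abbreviation used :: "nat \<Rightarrow> 'r + nat \<times> bool" where
  "used l \<equiv> Inr (l, True)"

definition spend :: "'b \<Rightarrow> nat \<Rightarrow> ('r + nat \<times> bool, 'b) cmd \<Rightarrow> ('r + nat \<times> bool, 'b) cmd" where
  "spend u l c = Seq (Pop (fuel l) u) (Seq (Push (used l) u) c)"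

definition refill :: "'b \<Rightarrow> nat \<Rightarrow> ('r + nat \<times> bool, 'b) cmd" where
  "refill u l = Seq (Pop (used l) u) (Push (fuel l) u)"

text \<open>Every iteration of a loop moves one symbol from the fuel stack of the loop to its used stack.
  Loops nested in each other have different heights, so all loops of the same height can share their
  two stacks.\<close>

primrec comp :: "'b \<Rightarrow> ('r, 'b) cmd \<Rightarrow> ('r + nat \<times> bool, 'b) cmd" where
  "comp u (Push r b) = Push (Inl r) b"
| "comp u (Pop r b) = Pop (Inl r) b"
| "comp u (Empty r) = Empty (Inl r)"
| "comp u (Seq c d) = Seq (comp u c) (comp u d)"
| "comp u (Choice c d) = Choice (comp u c) (comp u d)"
| "comp u (Loop c) = Seq (Loop (spend u (height c) (comp u c)))
     (Seq (Loop (refill u (height c))) (Empty (used (height c))))"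

definition full :: "'b \<Rightarrow> nat \<Rightarrow> nat \<Rightarrow> (nat \<times> bool, 'b) store \<Rightarrow> bool" where
  "full u N h r \<longleftrightarrow> (\<forall>l<h. r (l, False) = replicate N u \<and> r (l, True) = [])"

definition ruler :: "'b \<Rightarrow> nat \<Rightarrow> nat \<Rightarrow> nat \<Rightarrow> (nat \<times> bool, 'b) store \<Rightarrow> (nat \<times> bool, 'b) store" where
  "ruler u l i j r = r((l, False) := replicate i u, (l, True) := replicate j u)"

lemma full_mono: "full u N h r \<Longrightarrow> h' \<le> h \<Longrightarrow> full u N h' r"
  by (auto simp: full_def)

lemma full_ruler [simp]: "full u N l (ruler u l i j r) \<longleftrightarrow> full u N l r"
  by (auto simp: full_def ruler_def)

lemma ruler_full: "full u N h r \<Longrightarrow> l < h \<Longrightarrow> ruler u l N 0 r = r"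
  by (auto simp: full_def ruler_def fun_eq_iff)

definition join :: "('r, 'b) store \<Rightarrow> ('q, 'b) store \<Rightarrow> ('r + 'q, 'b) store" where
  "join s r = case_sum s r"

lemma join_simps [simp]:
  "join s r (Inl x) = s x"
  "join s r (Inr y) = r y"
  "(join s r)(Inl x := v) = join (s(x := v)) r"
  "(join s r)(Inr y := v) = join s (r(y := v))"
  by (auto simp: join_def fun_eq_iff split: sum.splits)

lemma join_inject [simp]: "join s r = join s' r' \<longleftrightarrow> s = s' \<and> r = r'"
  by (metis ext join_simps(1,2))

lemma spend_exec:
  assumes "\<And>s t. exec c (join s (ruler u l i (Suc j) r)) t \<longleftrightarrow>
      (\<exists>s'. R s s' \<and> t = join s' (ruler u l i (Suc j) r))"
  shows "exec (spend u l c) (join s (ruler u l (Suc i) j r)) t \<longleftrightarrow>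
      (\<exists>s'. R s s' \<and> t = join s' (ruler u l i (Suc j) r))"
proof -
  have "((ruler u l (Suc i) j r)((l, False) := replicate i u))((l, True) := u # replicate j u)
      = ruler u l i (Suc j) r"
    by (auto simp: ruler_def)
  moreover have "ruler u l (Suc i) j r (l, False) = u # replicate i u"
    "ruler u l (Suc i) j r (l, True) = replicate j u"
    by (simp_all add: ruler_def)
  ultimately show ?thesis
    using assms[of s t] by (simp add: spend_def)
qed

lemma spend_exec_0 [simp]: "\<not> exec (spend u l c) (join s (ruler u l 0 j r)) t"
  by (simp add: spend_def ruler_def)

lemma refill_exec:
  "exec (refill u l) (join s (ruler u l i j r)) t \<longleftrightarrow>
     (\<exists>j'. j = Suc j' \<and> t = join s (ruler u l (Suc i) j' r))"
proof (cases j)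
  case (Suc j')
  have "((ruler u l i (Suc j') r)((l, True) := replicate j' u))((l, False) := u # replicate i u)
      = ruler u l (Suc i) j' r"
    by (auto simp: ruler_def fun_upd_twist)
  moreover have "ruler u l i (Suc j') r (l, True) = u # replicate j' u"
    "ruler u l i (Suc j') r (l, False) = replicate i u"
    by (simp_all add: ruler_def)
  ultimately show ?thesis
    using Suc by (simp add: refill_def)
qed (simp add: refill_def ruler_def)

lemma refill_power:
  "(exec (refill u l) ^^ m) (join s (ruler u l i j r)) t \<longleftrightarrow>
     m \<le> j \<and> t = join s (ruler u l (i + m) (j - m) r)"
proof (induction m arbitrary: t)
  case (Suc m)
  have "(exec (refill u l) ^^ Suc m) (join s (ruler u l i j r)) t \<longleftrightarrow>
      m \<le> j \<and> exec (refill u l) (join s (ruler u l (i + m) (j - m) r)) t"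
    unfolding relpowp.simps(2) relcompp_apply Suc by blast
  also have "\<dots> \<longleftrightarrow> Suc m \<le> j \<and> t = join s (ruler u l (i + Suc m) (j - Suc m) r)"
  proof (cases "Suc m \<le> j")
    case True
    then have "j - m = Suc (j - Suc m)" by simp
    then show ?thesis using True by (simp add: refill_exec)
  next
    case False
    then show ?thesis by (simp add: refill_exec)
  qed
  finally show ?case .
qed auto

lemma spend_power:
  assumes "\<And>s t i j. exec c (join s (ruler u l i j r)) t \<longleftrightarrow>
      (\<exists>s'. R s s' \<and> t = join s' (ruler u l i j r))"
  shows "(exec (spend u l c) ^^ m) (join s (ruler u l i j r)) t \<longleftrightarrow>
     m \<le> i \<and> (\<exists>s'. (R ^^ m) s s' \<and> t = join s' (ruler u l (i - m) (j + m) r))"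
proof (induction m arbitrary: t)
  case (Suc m)
  have *: "exec (spend u l c) (join s' (ruler u l (i - m) (j + m) r)) t \<longleftrightarrow>
      Suc m \<le> i \<and> (\<exists>s''. R s' s'' \<and> t = join s'' (ruler u l (i - Suc m) (j + Suc m) r))"
    if "m \<le> i" for s'
  proof (cases "m = i")
    case False
    then have "i - m = Suc (i - Suc m)" using that by simp
    with that False show ?thesis
      by (simp add: spend_exec[where R = R, OF assms])
  qed simp
  have "(exec (spend u l c) ^^ Suc m) (join s (ruler u l i j r)) t \<longleftrightarrow>
      m \<le> i \<and> (\<exists>s'. (R ^^ m) s s' \<and>
        exec (spend u l c) (join s' (ruler u l (i - m) (j + m) r)) t)"
    unfolding relpowp.simps(2) relcompp_apply Suc by blast
  also have "\<dots> \<longleftrightarrow> Suc m \<le> i \<and>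
      (\<exists>s'. (R ^^ Suc m) s s' \<and> t = join s' (ruler u l (i - Suc m) (j + Suc m) r))"
    using * Suc_leD[of m i] unfolding relpowp.simps(2) relcompp_apply by blast
  finally show ?case .
qed auto

text \<open>The fuel store \<open>r\<close> comes back unchanged. This is what allows loops of equal
  height, run one after another, to share the same two stacks.\<close>

lemma exec_comp:
  "full u N (height c) r \<Longrightarrow>
   exec (comp u c) (join s r) t \<longleftrightarrow> (\<exists>s'. sem N c s s' \<and> t = join s' r)"
proof (induction c arbitrary: s r t)
  case (Seq c d)
  from Seq.prems have *: "full u N (height c) r" "full u N (height d) r"
    by (auto elim: full_mono)
  show ?case
    unfolding comp.simps exec_Seq Seq.IH(1)[OF *(1)] sem.simps
    using Seq.IH(2)[OF *(2)] by blast
next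
  case (Choice c d)
  from Choice.prems have *: "full u N (height c) r" "full u N (height d) r"
    by (auto elim: full_mono)
  show ?case
    by (auto simp: Choice.IH(1)[OF *(1)] Choice.IH(2)[OF *(2)])
next
  case (Loop c)
  let ?l = "height c"
  have r: "r = ruler u ?l N 0 r"
    using Loop.prems by (simp add: ruler_full)
  \<comment> \<open>All loops in the body have smaller height, so the induction hypothesis applies
    whatever the two stacks of level \<open>?l\<close> contain in the middle of the loop.\<close>
  have c: "full u N ?l (ruler u ?l i j r)" for i j
    using Loop.prems by (simp add: full_mono)
  have 1: "exec (Loop (spend u ?l (comp u c))) (join s r) t \<longleftrightarrow>
      (\<exists>m\<le>N. \<exists>s'. (sem N c ^^ m) s s' \<and> t = join s' (ruler u ?l (N - m) m r))" for t
    using spend_power[where R = "sem N c", OF Loop.IH[OF c], of _ s N 0 t] r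
    by (auto simp: rtranclp_power)
  have 2: "exec (Loop (refill u ?l)) (join s (ruler u ?l i j r)) t \<longleftrightarrow>
      (\<exists>m\<le>j. t = join s (ruler u ?l (i + m) (j - m) r))" for s t i j
    by (auto simp: rtranclp_power refill_power)
  \<comment> \<open>The emptiness test discards every outcome of the refill loop except the complete
    one.\<close>
  have 3: "exec (Seq (Loop (refill u ?l)) (Empty (used ?l))) (join s (ruler u ?l i j r)) t
      \<longleftrightarrow> t = join s (ruler u ?l (i + j) 0 r)" for s t i j
    unfolding exec_Seq 2 by (auto simp: ruler_def)
  have "exec (comp u (Loop c)) (join s r) t \<longleftrightarrow>
      (\<exists>m\<le>N. \<exists>s'. (sem N c ^^ m) s s' \<and> t = join s' (ruler u ?l (N - m + m) 0 r))"
    unfolding comp.simps exec_Seq[of "Loop (spend u ?l (comp u c))"] 1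
    using 3 by blast
  then show ?case using r by auto
qed auto

text \<open>With T for the time of the body, the clause for loops counts N + 1 rounds of T + 4 steps
  (the body and the four steps of \<open>spend\<close>) plus one for entering, N + 1 rounds of
  refilling with 3 steps plus one for entering, and 3 steps for the two \<open>Seq\<close> and the
  \<open>Empty\<close>.\<close>

primrec time :: "('r, 'b) cmd \<Rightarrow> nat poly" where
  "time (Push r b) = 1"
| "time (Pop r b) = 1"
| "time (Empty r) = 1"
| "time (Seq c d) = time c + time d + 1"
| "time (Choice c d) = time c + time d + 1"
| "time (Loop c) = [:1, 1:] * (time c + 5) + [:1, 1:] * 4 + 3"

lemma bounded_comp:
  fixes c :: "('r, 'b) cmd"
  shows "full u N (height c) r \<Longrightarrow> bounded (comp u c) (join s r) (poly (time c) N)"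
proof (induction c arbitrary: s r)
  case (Seq c d)
  from Seq.prems have *: "full u N (height c) r" "full u N (height d) r"
    by (auto elim: full_mono)
  show ?case
    using bounded_Seq[OF Seq.IH(1)[OF *(1), of s] ] Seq.IH(2)[OF *(2)]
    by (auto simp: exec_comp[OF *(1)])
next
  case (Choice c d)
  from Choice.prems have *: "full u N (height c) r" "full u N (height d) r"
    by (auto elim: full_mono)
  show ?case
    using bounded_Choice[OF Choice.IH(1)[OF *(1), of s] Choice.IH(2)[OF *(2), of s]] by auto
next
  case (Loop c)
  let ?l = "height c" and ?T = "poly (time c) N"
  have r: "r = ruler u ?l N 0 r"
    using Loop.prems by (simp add: ruler_full)
  have c: "full u N ?l (ruler u ?l i j r)" for i j
    using Loop.prems by (simp add: full_mono)
  note ex = exec_comp[OF c]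
  have sp: "bounded (spend u ?l (comp u c)) (join s (ruler u ?l i j r)) (?T + 4)"
    for s :: "('r, 'b) store" and i j
  proof -
    have "\<exists>s' i' j'. s2 = join s' (ruler u ?l i' j' r)"
      if 1: "exec (Pop (fuel ?l) u) (join s (ruler u ?l i j r)) s1"
        and 2: "exec (Push (used ?l) u) s1 s2" for s1 s2
    proof -
      from 1 obtain i' where i: "i = Suc i'"
        by (cases i) (auto simp: ruler_def)
      have "((ruler u ?l (Suc i') j r)((?l, False) := replicate i' u))((?l, True) :=
          u # replicate j u)
        = ruler u ?l i' (Suc j) r"
        by (auto simp: ruler_def)
      moreover have "ruler u ?l (Suc i') j r (?l, False) = u # replicate i' u"
        "ruler u ?l (Suc i') j r (?l, True) = replicate j u"
        by (simp_all add: ruler_def)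
      ultimately show ?thesis using 1 2 i by auto
    qed
    then have "bounded (comp u c) s2 ?T" if "exec (Push (used ?l) u) s1 s2"
      "exec (Pop (fuel ?l) u) (join s (ruler u ?l i j r)) s1" for s1 s2
      using that Loop.IH[OF c] by metis
    then have "bounded (spend u ?l (comp u c)) (join s (ruler u ?l i j r)) (Suc (1 + Suc (1 + ?T)))"
      unfolding spend_def by (intro bounded_Seq bounded_Pop bounded_Push) blast
    then show ?thesis by (rule bounded_mono) simp
  qed
  have rf: "bounded (refill u ?l) s 3" for s :: "('r + nat \<times> bool, 'b) store"
    unfolding refill_def using bounded_Seq[OF bounded_Pop bounded_Push]
    by (rule bounded_mono) simp
  \<comment> \<open>The remaining fuel is the ranking function: a completed round costs one symbol
    whatever the body computes. The invariant records that the body leaves the fuel store in the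
    shape of a ruler.\<close>
  have L1: "bounded (Loop (spend u ?l (comp u c))) (join s r) (Suc N * (?T + 4 + 1))"
  proof -
    define I where "I x = (\<exists>s i j. x = join s (ruler u ?l i j r) \<and> i \<le> N)"
        for x :: "('r + nat \<times> bool, 'b) store"
    define \<mu> where "\<mu> x = length (x (fuel ?l))" for x :: "('r + nat \<times> bool, 'b) store"
    have "bounded (Loop (spend u ?l (comp u c))) (join s r) (Suc (\<mu> (join s r)) * (?T + 4 + 1))"
    proof (rule bounded_Loop[where I = I and \<mu> = \<mu> and b = "?T + 4"])
      show "I (join s r)" unfolding I_def using r by (metis order_refl)
      show "bounded (spend u ?l (comp u c)) x (?T + 4)" if "I x" for x
        using that sp by (auto simp: I_def)
      fix x y assume "I x" "exec (spend u ?l (comp u c)) x y"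
      then obtain s i j where x: "x = join s (ruler u ?l i j r)" "i \<le> N" by (auto simp: I_def)
      then obtain i' where i: "i = Suc i'"
        using \<open>exec _ x y\<close> by (cases i) auto
      from \<open>exec _ x y\<close> obtain s' where "y = join s' (ruler u ?l i' (Suc j) r)"
        unfolding x i spend_exec[where R = "sem N c", OF ex] by auto
      with x i show "I y \<and> \<mu> y < \<mu> x"
        by (auto simp: I_def \<mu>_def) (auto simp: ruler_def)
    qed
    moreover have "\<mu> (join s r) = N" using Loop.prems by (simp add: \<mu>_def full_def)
    ultimately show ?thesis by simp
  qed
  have L2: "bounded (Loop (refill u ?l)) (join s (ruler u ?l i j r)) (Suc N * 4)" if "j \<le> N"
    for s :: "('r, 'b) store" and i j
  proof -
    have "bounded (Loop (refill u ?l)) (join s (ruler u ?l i j r))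
        (Suc (length (join s (ruler u ?l i j r) (used ?l))) * (3 + 1))"
      by (rule bounded_Loop[where I = "\<lambda>_. True" and \<mu> = "\<lambda>x. length (x (used ?l))" and b = 3])
        (simp, rule rf, auto simp: refill_def)
    then show ?thesis by (rule bounded_mono) (use that in \<open>auto simp: ruler_def\<close>)
  qed
  have ex1: "exec (Loop (spend u ?l (comp u c))) (join s r) t \<Longrightarrow>
      \<exists>s' m. m \<le> N \<and> t = join s' (ruler u ?l (N - m) m r)" for t
    using spend_power[where R = "sem N c", OF ex, of _ s N 0 t] r
    by (auto simp: rtranclp_power)
  have "bounded (comp u (Loop c)) (join s r)
      (Suc (Suc N * (?T + 4 + 1) + Suc (Suc N * 4 + 1)))"
    unfolding comp.simps
    by (intro bounded_Seq L1 bounded_Empty) (use ex1 L2 in blast)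
  then show ?case by (rule bounded_mono) (simp add: algebra_simps)
qed (auto intro: bounded_Push bounded_Pop bounded_Empty simp: One_nat_def[symmetric] simp del:
    One_nat_def)

section \<open>Turing machines for stack programs\<close>

instance symbol :: (countable) countable
  by countable_datatype

instance cmd :: (countable, countable) countable
  by countable_datatype

section \<open>Stacks on tapes\<close>

definition idle :: "'a action" where
  "idle = (Blank, Blank, Stay)"

definition on :: "nat \<Rightarrow> nat \<Rightarrow> 'a action \<Rightarrow> 'a action list" where
  "on k i a = (replicate k idle)[i := a]"

lemma length_on [simp]: "length (on k i a) = k"
  by (simp add: on_def)

lemma nth_on: "j < k \<Longrightarrow> on k i a ! j = (if j = i then a else idle)"
  by (simp add: on_def)

text \<open>The head rests on the blank cell just left of the top, and the stack grows to the left.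
  A transition that works on one stack can then prescribe \<open>Blank\<close> on all other tapes,
  whatever they contain.\<close>

definition tape_of :: "int \<Rightarrow> 'a symbol list \<Rightarrow> 'a tape" where
  "tape_of h l = ((\<lambda>z. if h < z \<and> z \<le> h + int (length l) then l ! nat (z - h - 1) else Blank), h)"

definition stack_tape :: "'a symbol list \<Rightarrow> 'a tape \<Rightarrow> bool" where
  "stack_tape l t \<longleftrightarrow> Blank \<notin> set l \<and> (\<exists>h. t = tape_of h l)"

abbreviation down :: "'a tape \<Rightarrow> 'a tape" where
  "down t \<equiv> act t (Blank, Blank, MoveR)"

lemma applicable_stack_tape: "stack_tape l t \<Longrightarrow> applicable t (r, w, m) \<longleftrightarrow> r = Blank"
  by (auto simp: stack_tape_def tape_of_def)

lemma act_idle: "stack_tape l t \<Longrightarrow> act t idle = t"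
  by (auto simp: stack_tape_def tape_of_def idle_def fun_eq_iff)

lemma stack_tape_Push:
  assumes "stack_tape l t" "b \<noteq> Blank"
  shows "stack_tape (b # l) (act t (Blank, b, MoveL))"
proof -
  obtain h where t: "t = tape_of h l" using assms by (auto simp: stack_tape_def)
  have "act t (Blank, b, MoveL) = tape_of (h - 1) (b # l)"
    by (auto simp: t tape_of_def fun_eq_iff nth_Cons split: nat.splits intro: arg_cong[of _ _
        "(!) l"])
  then show ?thesis using assms by (auto simp: stack_tape_def)
qed

lemma down_tape_of:
  "down (tape_of h l) = (fst (tape_of h l), h + 1)"
  by (auto simp: tape_of_def)

lemma applicable_down:
  assumes "stack_tape l t"
  shows "applicable (down t) (r, w, m) \<longleftrightarrow> r = (case l of [] \<Rightarrow> Blank | b # _ \<Rightarrow> b)"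
  using assms by (auto simp: stack_tape_def down_tape_of) (auto simp: tape_of_def split:
      list.splits)

lemma stack_tape_Pop:
  assumes "stack_tape (b # l) t"
  shows "stack_tape l (act (down t) (b, Blank, Stay))"
proof -
  obtain h where t: "t = tape_of h (b # l)" using assms by (auto simp: stack_tape_def)
  have "act (down t) (b, Blank, Stay) = tape_of (h + 1) l"
    by (auto simp: t down_tape_of) (auto simp: tape_of_def fun_eq_iff nth_Cons split: nat.splits
        intro: arg_cong[of _ _ "(!) l"])
  then show ?thesis using assms by (auto simp: stack_tape_def)
qed

lemma act_Empty:
  assumes "stack_tape [] t"
  shows "act (down t) (Blank, Blank, MoveL) = t"
  using assms by (auto simp: stack_tape_def tape_of_def fun_eq_iff)

text \<open>The continuations that can arise while \<open>c\<close> runs in front of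
  \<open>K\<close>. A loop puts itself back only once, so there are finitely many of them and they
  can serve as control states of a machine.\<close>

primrec conts :: "('r, 'b) cmd \<Rightarrow> ('r, 'b) cmd list \<Rightarrow> ('r, 'b) cmd list set" where
  "conts (Push r b) K = {Push r b # K}"
| "conts (Pop r b) K = {Pop r b # K}"
| "conts (Empty r) K = {Empty r # K}"
| "conts (Seq c d) K = insert (Seq c d # K) (conts c (d # K) \<union> conts d K)"
| "conts (Choice c d) K = insert (Choice c d # K) (conts c K \<union> conts d K)"
| "conts (Loop c) K = insert (Loop c # K) (conts c (Loop c # K))"

lemma finite_conts [simp]: "finite (conts c K)"
  by (induction c arbitrary: K) auto

lemma conts_refl [simp]: "c # K \<in> conts c K"
  by (cases c) auto

lemma conts_step: "Q \<in> conts c K \<Longrightarrow> step (Q, s) (Q', s') \<Longrightarrow> Q' \<in> insert K (conts c K)"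
proof (induction c arbitrary: K)
  case (Seq c d)
  have "Q' \<in> insert (d # K) (conts c (d # K))" if "Q \<in> conts c (d # K)"
    using Seq.IH(1)[OF that Seq.prems(2)] .
  moreover have "Q' \<in> insert K (conts d K)" if "Q \<in> conts d K"
    using Seq.IH(2)[OF that Seq.prems(2)] .
  ultimately show ?case
    using Seq.prems conts_refl[of d K] conts_refl[of c "d # K"] by (auto simp: step_iff)
next
  case (Loop c)
  then show ?case by (auto simp: step_iff)
qed (auto simp: step_iff)

lemma conts_regs: "Q \<in> conts c K \<Longrightarrow> d \<in> set Q \<Longrightarrow> regs d \<subseteq> regs c \<union> (\<Union>d\<in>set K. regs d)"
proof (induction c arbitrary: K)
  case (Seq c1 c2)
  then show ?case using Seq.IH(1)[of "c2 # K"] Seq.IH(2)[of K] by auto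
next
  case (Loop c)
  then show ?case using Loop.IH[of "Loop c # K"] by auto
qed auto

lemma conts_syms: "Q \<in> conts c K \<Longrightarrow> d \<in> set Q \<Longrightarrow> syms d \<subseteq> syms c \<union> (\<Union>d\<in>set K. syms d)"
proof (induction c arbitrary: K)
  case (Seq c1 c2)
  then show ?case using Seq.IH(1)[of "c2 # K"] Seq.IH(2)[of K] by auto
next
  case (Loop c)
  then show ?case using Loop.IH[of "Loop c # K"] by auto
qed auto

section \<open>The machine of a program and its simulation\<close>

locale stack_machine =
  fixes prog :: "('r :: countable, 'a :: finite symbol) cmd" and rs :: "'r list"
  assumes distinct: "distinct rs" and nonempty: "rs \<noteq> []"
    and regs: "regs prog \<subseteq> set rs" and no_Blank: "Blank \<notin> syms prog"
begin

definition index :: "'r \<Rightarrow> nat" where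
  "index r = (SOME j. j < length rs \<and> rs ! j = r)"

lemma index: "r \<in> set rs \<Longrightarrow> index r < length rs \<and> rs ! index r = r"
  unfolding index_def by (rule someI_ex) (simp add: in_set_conv_nth)

abbreviation acts :: "'r \<Rightarrow> 'a action \<Rightarrow> 'a action list" where
  "acts r \<equiv> on (length rs) (index r)"

abbreviation skip :: "'a action list" where
  "skip \<equiv> on (length rs) 0 idle"

text \<open>Popping and testing for emptiness take two steps of the machine; the flag marks the
  configurations in between, in which one head has moved onto the top of its stack.\<close>

fun delta :: "('r, 'a symbol) cmd list \<times> bool
    \<Rightarrow> ('a action list \<times> ('r, 'a symbol) cmd list \<times> bool) set" where
  "delta (Push r b # K, False) = {(acts r (Blank, b, MoveL), (K, False))}"
| "delta (Pop r b # K, False) = {(acts r (Blank, Blank, MoveR), (Pop r b # K, True))}"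
| "delta (Pop r b # K, True) = {(acts r (b, Blank, Stay), (K, False))}"
| "delta (Empty r # K, False) = {(acts r (Blank, Blank, MoveR), (Empty r # K, True))}"
| "delta (Empty r # K, True) = {(acts r (Blank, Blank, MoveL), (K, False))}"
| "delta (Seq c d # K, False) = {(skip, (c # d # K, False))}"
| "delta (Choice c d # K, False) = {(skip, (c # K, False)), (skip, (d # K, False))}"
| "delta (Loop c # K, False) = {(skip, (K, False)), (skip, (c # Loop c # K, False))}"
| "delta _ = {}"

lemma finite_delta: "finite (delta \<kappa>)"
  by (induction \<kappa> rule: delta.induct) auto

lemma length_delta: "(as, \<kappa>') \<in> delta \<kappa> \<Longrightarrow> length as = length rs"
  by (induction \<kappa> rule: delta.induct) auto

definition enc :: "(('r, 'a symbol) cmd list \<times> bool) option \<Rightarrow> nat" where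
  "enc = to_nat"

lemma enc_eq [simp]: "enc x = enc y \<longleftrightarrow> x = y"
  by (simp add: enc_def)

text \<open>A machine starts with its head on the first letter, while a stack wants it one cell to
  the left. The state \<open>enc None\<close> makes this one move, restoring whichever symbol it
  reads. The accepting state is the empty continuation, which does not occur in
  \<open>conts\<close>.\<close>

definition machine :: "'a ntm" where
  "machine = \<lparr>num_tapes = length rs, start_state = enc None,
     accept_state = enc (Some ([], False)),
     transitions =
       (\<lambda>r. (enc None, on (length rs) 0 (r, r, MoveL), enc (Some ([prog], False))))
         ` insert Blank (range Letter) \<union>
       (\<Union>\<kappa>\<in>conts prog [] \<times> UNIV. (\<lambda>(as, \<kappa>'). (enc (Some \<kappa>), as, enc (Some \<kappa>'))) ` delta \<kappa>)\<rparr>"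

lemma machine_simps [simp]:
  "num_tapes machine = length rs"
  "start_state machine = enc None"
  "accept_state machine = enc (Some ([], False))"
  by (simp_all add: machine_def)

lemma transitions_None:
  "(enc None, as, q) \<in> transitions machine \<longleftrightarrow>
     (\<exists>r \<in> insert Blank (range Letter). as = on (length rs) 0 (r, r, MoveL)) \<and>
     q = enc (Some ([prog], False))"
  by (auto simp: machine_def)

lemma transitions_Some:
  "(enc (Some \<kappa>), as, q) \<in> transitions machine \<longleftrightarrow>
     fst \<kappa> \<in> conts prog [] \<and> (\<exists>\<kappa>'. (as, \<kappa>') \<in> delta \<kappa> \<and> q = enc (Some \<kappa>'))"
  by (cases \<kappa>) (force simp: machine_def)

lemma Nil_conts: "[] \<notin> conts d K"
  by (induction d arbitrary: K) auto

lemma wf_machine: "wf_ntm machine"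
  unfolding wf_ntm_def
proof (intro conjI)
  show "finite (transitions machine)"
    by (auto simp: machine_def finite_delta)
  show "1 \<le> num_tapes machine" using nonempty by (simp add: Suc_le_eq)
  show "\<forall>(q, as, q')\<in>transitions machine. length as = num_tapes machine \<and> q \<noteq> accept_state machine"
    by (auto simp: machine_def length_delta Nil_conts)
qed

definition represents :: "('r, 'a symbol) store \<Rightarrow> 'a tape list \<Rightarrow> bool" where
  "represents s ts \<longleftrightarrow> length ts = length rs \<and> (\<forall>j<length rs. stack_tape (s (rs ! j)) (ts ! j))"

lemma list_all2_on:
  assumes "length ts = length rs" "i < length rs"
    "\<And>j. j < length rs \<Longrightarrow> j \<noteq> i \<Longrightarrow> \<exists>l. stack_tape l (ts ! j)"
  shows "list_all2 applicable ts (on (length rs) i a) \<longleftrightarrow> applicable (ts ! i) a"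
proof -
  have "applicable (ts ! j) idle" if "j < length rs" "j \<noteq> i" for j
    using assms(3)[OF that] by (auto simp: idle_def applicable_stack_tape)
  then show ?thesis
    using assms(1,2) by (auto simp: list_all2_conv_all_nth nth_on)
qed

lemma map2_on:
  assumes "length ts = length rs" "i < length rs"
    "\<And>j. j < length rs \<Longrightarrow> j \<noteq> i \<Longrightarrow> \<exists>l. stack_tape l (ts ! j)"
  shows "map2 act ts (on (length rs) i a) = ts[i := act (ts ! i) a]"
proof -
  have "act (ts ! j) idle = ts ! j" if "j < length rs" "j \<noteq> i" for j
    using assms(3)[OF that] act_idle by blast
  then show ?thesis
    using assms(1,2) by (auto intro!: nth_equalityI simp: nth_on nth_list_update)
qed

lemma represents_others:
  assumes "represents s ts"
  shows "j < length rs \<Longrightarrow> \<exists>l. stack_tape l (ts ! j)"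
    "j < length rs \<Longrightarrow> j \<noteq> i \<Longrightarrow> \<exists>l. stack_tape l (ts[i := t] ! j)"
    "length ts = length rs"
  using assms by (auto simp: represents_def)

lemma represents_skip:
  assumes "represents s ts"
  shows "map2 act ts skip = ts" "list_all2 applicable ts skip"
proof -
  note o = represents_others[OF assms]
  obtain l where "stack_tape l (ts ! 0)" using o(1)[of 0] nonempty by auto
  then show "map2 act ts skip = ts" "list_all2 applicable ts skip"
    using o(1,3) nonempty
    by (simp_all add: map2_on list_all2_on act_idle) (simp add: idle_def applicable_stack_tape)
qed

lemma represents_update:
  assumes "represents s ts" "r \<in> set rs" "stack_tape l t"
  shows "represents (s(r := l)) (ts[index r := t])"
  using assms index[OF assms(2)] distinct
  by (auto simp: represents_def nth_list_update nth_eq_iff_index_eq)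

definition sim :: "('r, 'a symbol) cmd list \<times> bool \<Rightarrow> ('r, 'a symbol) store \<Rightarrow> 'a tape list \<Rightarrow> bool"
  where
  "sim \<kappa> s ts \<longleftrightarrow>
     (if snd \<kappa> then \<exists>r b K ts'. fst \<kappa> \<in> {Pop r b # K, Empty r # K} \<and> represents s ts' \<and>
        ts = ts'[index r := down (ts' ! index r)]
      else represents s ts)"

text \<open>The flag separates two kinds of machine steps: the first half of a \<open>Pop\<close> or
  \<open>Empty\<close> leaves the program where it is, and every other step completes exactly one
  program step.\<close>

lemma sound_step:
  assumes "K \<in> conts prog []" "sim (K, f) s ts" "(as, \<kappa>') \<in> delta (K, f)" "list_all2 applicable ts
      as"
  shows "sim \<kappa>' s (map2 act ts as) \<and> \<not> f \<and> \<kappa>' = (K, True) \<or>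
    (\<exists>K' s'. \<kappa>' = (K', False) \<and> step (K, s) (K', s') \<and> sim \<kappa>' s' (map2 act ts as))"
proof -
  have hd: "r \<in> set rs" if "K = d # K'" "r \<in> regs d" for r d K'
    using conts_regs[OF assms(1), of d] regs that by auto
  have sy: "b \<noteq> Blank" if "K = Push r b # K'" for r b K'
    using conts_syms[OF assms(1), of "Push r b"] no_Blank that by auto
  show ?thesis
  proof (cases f)
    case False
    then have rep: "represents s ts" using assms(2) by (simp add: sim_def)
    note o = represents_others[OF rep]
    have st: "stack_tape (s r) (ts ! index r)" if "r \<in> set rs" for r
      using rep index[OF that] by (metis represents_def)
    note skip = represents_skip(1)[OF rep]
    show ?thesis
    proof (cases K)
      case Nil then show ?thesis using assms(3) False by simp
    next
      case (Cons d K')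
      show ?thesis
      proof (cases d)
        case (Push r b)
        with hd[OF Cons] have r: "r \<in> set rs" by simp
        then have "map2 act ts as = ts[index r := act (ts ! index r) (Blank, b, MoveL)]"
          using assms(3) False Cons Push o index by (simp add: map2_on)
        with represents_update[OF rep r stack_tape_Push[OF st[OF r]]] sy assms(3) False Cons Push
        show ?thesis by (auto simp: step_iff sim_def)
      next
        case (Pop r b)
        with hd[OF Cons] have r: "r \<in> set rs" by simp
        then have "map2 act ts as = ts[index r := down (ts ! index r)]"
          using assms(3) False Cons Pop o index by (simp add: map2_on)
        with rep assms(3) False Cons Pop show ?thesis by (auto simp: sim_def)
      next
        case (Empty r)
        with hd[OF Cons] have r: "r \<in> set rs" by simp
        then have "map2 act ts as = ts[index r := down (ts ! index r)]"
          using assms(3) False Cons Empty o index by (simp add: map2_on)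
        with rep assms(3) False Cons Empty show ?thesis by (auto simp: sim_def)
      qed (use assms(3) False Cons rep skip in \<open>auto simp: step_iff sim_def\<close>)
    qed
  next
    case True
    then obtain r b K' ts' where K: "K \<in> {Pop r b # K', Empty r # K'}" and rep: "represents s ts'"
      and ts: "ts = ts'[index r := down (ts' ! index r)]"
      using assms(2) unfolding sim_def by auto
    note o = represents_others[OF rep]
    from K hd have r: "r \<in> set rs" by auto
    have st: "stack_tape (s r) (ts' ! index r)"
      using rep index[OF r] by (metis represents_def)
    have tsr: "ts ! index r = down (ts' ! index r)"
      using ts o(3) index[OF r] by simp
    have upd: "map2 act ts (acts r a) = ts'[index r := act (down (ts' ! index r)) a]"
      "list_all2 applicable ts (acts r a) \<longleftrightarrow> applicable (down (ts' ! index r)) a" for a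
      using o index[OF r] tsr by (simp_all add: ts map2_on list_all2_on)
    from K consider "K = Pop r b # K'" | "K = Empty r # K'" by auto
    then show ?thesis
    proof cases
      assume K: "K = Pop r b # K'"
      then have as: "as = acts r (b, Blank, Stay)" "\<kappa>' = (K', False)"
        using assms(3) True by auto
      have "b = (case s r of [] \<Rightarrow> Blank | b # _ \<Rightarrow> b)"
        using assms(4) unfolding as upd applicable_down[OF st] .
      moreover have "b \<noteq> Blank"
        using conts_syms[OF assms(1), of "Pop r b"] no_Blank K by auto
      ultimately obtain l where l: "s r = b # l" by (cases "s r") auto
      have "represents (s(r := l)) (map2 act ts as)"
        unfolding as upd using st l by (intro represents_update[OF rep r] stack_tape_Pop) simp
      then show ?thesis using K l as by (auto simp: step_iff sim_def)
    next
      assume K: "K = Empty r # K'"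
      then have as: "as = acts r (Blank, Blank, MoveL)" "\<kappa>' = (K', False)"
        using assms(3) True by auto
      have "Blank = (case s r of [] \<Rightarrow> Blank | b # _ \<Rightarrow> b)"
        using assms(4) unfolding as upd applicable_down[OF st] .
      then have l: "s r = []"
        using st by (auto simp: stack_tape_def split: list.splits)
      have "map2 act ts as = ts'"
        unfolding as upd using st l by (simp add: act_Empty)
      then show ?thesis using K l as rep by (auto simp: step_iff sim_def)
    qed
  qed
qed

lemma machine_stepI:
  assumes "K \<in> conts prog []" "(as, \<kappa>') \<in> delta (K, f)" "list_all2 applicable ts as"
  shows "((enc (Some (K, f)), ts), (enc (Some \<kappa>'), map2 act ts as)) \<in> ntm_step machine"
proof -
  have "(enc (Some (K, f)), as, enc (Some \<kappa>')) \<in> transitions machine"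
    unfolding transitions_Some using assms(1,2) by (metis fst_conv)
  with assms(3) show ?thesis
    unfolding ntm_step_def mem_Collect_eq by (intro exI conjI) simp_all
qed

lemma complete_step:
  assumes "K \<in> conts prog []" "represents s ts" "step (K, s) (K', s')"
  shows "\<exists>ts'. represents s' ts' \<and>
    ((enc (Some (K, False)), ts), (enc (Some (K', False)), ts')) \<in> (ntm_step machine)\<^sup>*"
proof -
  note rep = assms(2)
  note o = represents_others[OF rep]
  obtain d K0 where K: "K = d # K0" using assms(3) by (cases K) (auto simp: step_iff)
  have hd: "r \<in> set rs" if "r \<in> regs d" for r
    using conts_regs[OF assms(1), of d] regs that K by auto
  have st: "stack_tape (s r) (ts ! index r)" if "r \<in> set rs" for r
    using rep index[OF that] by (metis represents_def)
  note skip = represents_skip[OF rep]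
  have idle_step: ?thesis if "(skip, (K', False)) \<in> delta (K, False)" "s' = s"
    using machine_stepI[OF assms(1) that(1) skip(2)] skip(1) rep that(2) by auto
  have down: "((enc (Some (K, False)), ts), (enc (Some (K, True)), ts[index r :=
      down (ts ! index r)]))
      \<in> ntm_step machine" if "d = Pop r b \<or> d = Empty r" for r b
  proof -
    have r: "r \<in> set rs" using hd that by auto
    have "list_all2 applicable ts (acts r (Blank, Blank, MoveR))"
      using o index[OF r] st[OF r] by (simp add: list_all2_on applicable_stack_tape)
    then show ?thesis
      using machine_stepI[OF assms(1), of "acts r (Blank, Blank, MoveR)" "(K, True)" False ts]
        that K o index[OF r] by (auto simp: map2_on)
  qed
  have up: "map2 act (ts[index r := down (ts ! index r)]) (acts r a)
        = ts[index r := act (down (ts ! index r)) a]"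
      "list_all2 applicable (ts[index r := down (ts ! index r)]) (acts r a)
        \<longleftrightarrow> applicable (down (ts ! index r)) a" if "r \<in> set rs" for r a
    using o index[OF that] by (simp_all add: map2_on list_all2_on)
  show ?thesis
  proof (cases d)
    case (Push r b)
    then have r: "r \<in> set rs" using hd by simp
    have b: "b \<noteq> Blank"
      using conts_syms[OF assms(1), of "Push r b"] no_Blank K Push by auto
    have "((enc (Some (K, False)), ts), (enc (Some (K0, False)), ts[index r :=
        act (ts ! index r) (Blank, b, MoveL)]))
      \<in> ntm_step machine"
      using machine_stepI[OF assms(1), of "acts r (Blank, b, MoveL)" "(K0, False)" False ts]
        K Push o index[OF r] st[OF r] by (auto simp: map2_on list_all2_on applicable_stack_tape)
    moreover have "represents s' (ts[index r := act (ts ! index r) (Blank, b, MoveL)])"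
      using represents_update[OF rep r stack_tape_Push[OF st[OF r] b]] assms(3) K Push
      by (simp add: step_iff)
    moreover have "K' = K0" using assms(3) K Push by (simp add: step_iff)
    ultimately show ?thesis by blast
  next
    case (Pop r b)
    then have r: "r \<in> set rs" using hd by simp
    obtain l where l: "s r = b # l" "s' = s(r := l)" "K' = K0"
      using assms(3) K Pop by (auto simp: step_iff)
    have "((enc (Some (K, True)), ts[index r := down (ts ! index r)]),
        (enc (Some (K', False)), ts[index r := act (down (ts ! index r)) (b, Blank, Stay)]))
      \<in> ntm_step machine"
      using machine_stepI[OF assms(1), of "acts r (b, Blank, Stay)" "(K0, False)" True
          "ts[index r := down (ts ! index r)]"] K Pop l
      by (simp add: up[OF r] applicable_down[OF st[OF r]])
    with down[of r b] Pop have "((enc (Some (K, False)), ts),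
        (enc (Some (K', False)), ts[index r := act (down (ts ! index r)) (b, Blank, Stay)]))
      \<in> (ntm_step machine)\<^sup>*" by (meson converse_rtrancl_into_rtrancl r_into_rtrancl)
    moreover have "represents s' (ts[index r := act (down (ts ! index r)) (b, Blank, Stay)])"
      unfolding l using st[OF r] l by (intro represents_update[OF rep r] stack_tape_Pop) simp
    ultimately show ?thesis by blast
  next
    case (Empty r)
    then have r: "r \<in> set rs" using hd by simp
    have l: "s r = []" "s' = s" "K' = K0"
      using assms(3) K Empty by (auto simp: step_iff)
    have "((enc (Some (K, True)), ts[index r := down (ts ! index r)]), (enc (Some (K', False)), ts))
      \<in> ntm_step machine"
      using machine_stepI[OF assms(1), of "acts r (Blank, Blank, MoveL)" "(K0, False)" True
          "ts[index r := down (ts ! index r)]"] K Empty l st[OF r]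
      by (simp add: up[OF r] applicable_down[OF st[OF r]] act_Empty)
    with down[of r] Empty have "((enc (Some (K, False)), ts), (enc (Some (K', False)), ts))
      \<in> (ntm_step machine)\<^sup>*" by (meson converse_rtrancl_into_rtrancl r_into_rtrancl)
    then show ?thesis using rep l by blast
  qed (use assms(3) K idle_step in \<open>auto simp: step_iff\<close>)
qed

definition input_store :: "'a list \<Rightarrow> ('r, 'a symbol) store" where
  "input_store w = (\<lambda>_. [])(hd rs := map Letter w)"

text \<open>Several transitions leave the start state, one for each possible symbol, but only one of
  them reads the symbol under the head.\<close>

lemma initial_step:
  "(initial machine w, x) \<in> ntm_step machine \<longleftrightarrow>
     (\<exists>ts. x = (enc (Some ([prog], False)), ts) \<and>
       ts = tape_of (- 1) (map Letter w) # replicate (length rs - 1) (tape_of 0 []))"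
proof -
  let ?ts = "input_tape w # replicate (length rs - 1) (input_tape [])"
  have e: "input_tape [] = tape_of 0 []" by (auto simp: input_tape_def tape_of_def fun_eq_iff)
  have len: "length ?ts = length rs" using nonempty by (cases rs) auto
  have st: "\<exists>l. stack_tape l (?ts ! j)" if "j < length rs" "j \<noteq> 0" for j
    using that by (auto simp: nth_Cons e stack_tape_def split: nat.splits) (metis empty_iff
        empty_set)
  have la: "list_all2 applicable ?ts (on (length rs) 0 a) \<longleftrightarrow> applicable (input_tape w) a"
    "map2 act ?ts (on (length rs) 0 a) = act (input_tape w) a # replicate (length rs - 1) (tape_of
        0 [])"
    for a
    using list_all2_on[OF len _ st, where i = 0] map2_on[OF len _ st, where i = 0] nonempty
    by (auto simp: e)
  have mv: "act (input_tape w) (r, r, MoveL) = tape_of (- 1) (map Letter w)"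
    if "applicable (input_tape w) (r, r, MoveL)" for r
    using that by (auto simp: input_tape_def tape_of_def fun_eq_iff)
  have ex: "\<exists>r \<in> insert Blank (range Letter). applicable (input_tape w) (r, r, MoveL)"
    by (auto simp: input_tape_def)
  have "(initial machine w, x) \<in> ntm_step machine \<longleftrightarrow>
    (\<exists>as q. (enc None, as, q) \<in> transitions machine \<and> list_all2 applicable ?ts as \<and>
       x = (q, map2 act ?ts as))"
    by (auto simp: ntm_step_def initial_def)
  also have "\<dots> \<longleftrightarrow> (\<exists>r \<in> insert Blank (range Letter). applicable (input_tape w) (r, r, MoveL) \<and>
      x = (enc (Some ([prog], False)), act (input_tape w) (r, r, MoveL) # replicate (length rs -
          1) (tape_of 0 [])))"
    unfolding transitions_None by (auto simp: la simp del: One_nat_def applicable.simps act.simps)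
  also have "\<dots> \<longleftrightarrow> x = (enc (Some ([prog], False)), tape_of (- 1) (map Letter w) # replicate (length
      rs - 1) (tape_of 0 []))"
    using ex mv by (metis (no_types, lifting))
  finally show ?thesis by auto
qed

lemma represents_input:
  "represents (input_store w) (tape_of (- 1) (map Letter w) # replicate (length rs - 1) (tape_of 0
      []))"
  using nonempty distinct unfolding represents_def input_store_def
  by (cases rs) (auto simp: stack_tape_def nth_Cons split: nat.splits)

text \<open>One machine step enters the program, each program step takes at most two, and a raised
  flag accounts for a pending half step. This is the estimate behind the polynomial
  \<open>smult 2 p + 2\<close>.\<close>

lemma sound:
  assumes "(initial machine w, x) \<in> ntm_step machine ^^ n" "n > 0"
  shows "\<exists>m K f s. (step ^^ m) ([prog], input_store w) (K, s) \<and> fst x = enc (Some (K, f)) \<and>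
    K \<in> insert [] (conts prog []) \<and> sim (K, f) s (snd x) \<and> n \<le> 2 * m + (if f then 2 else 1)"
  using assms
proof (induction n arbitrary: x)
  case (Suc n)
  show ?case
  proof (cases "n = 0")
    case True
    then have "(initial machine w, x) \<in> ntm_step machine" using Suc.prems by simp
    then show ?thesis unfolding initial_step using represents_input[of w] True
      by (intro exI[of _ 0] exI[of _ "[prog]"] exI[of _ False] exI[of _ "input_store w"])
        (auto simp: sim_def)
  next
    case False
    obtain y where y: "(initial machine w, y) \<in> ntm_step machine ^^ n" "(y, x) \<in> ntm_step machine"
      using Suc.prems by auto
    from Suc.IH[OF y(1)] False obtain m K f s where IH: "(step ^^ m) ([prog], input_store w) (K, s)"
      "fst y = enc (Some (K, f))" "K \<in> insert [] (conts prog [])" "sim (K, f) s (snd y)"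
      "n \<le> 2 * m + (if f then 2 else 1)" by auto
    from y(2) obtain as q' where tr: "(fst y, as, q') \<in> transitions machine"
      "list_all2 applicable (snd y) as" "x = (q', map2 act (snd y) as)"
      by (auto simp: ntm_step_def)
    from tr(1)[unfolded IH(2) transitions_Some] obtain \<kappa>' where k: "K \<in> conts prog []"
      "(as, \<kappa>') \<in> delta (K, f)" "q' = enc (Some \<kappa>')" by auto
    from sound_step[OF k(1) IH(4) k(2) tr(2)] show ?thesis
    proof (elim disjE exE conjE)
      assume "sim \<kappa>' s (map2 act (snd y) as)" "\<not> f" "\<kappa>' = (K, True)"
      then show ?thesis using IH k tr
        by (intro exI[of _ m] exI[of _ K] exI[of _ True] exI[of _ s]) auto
    next
      fix K' s' assume "\<kappa>' = (K', False)" "step (K, s) (K', s')" "sim \<kappa>' s' (map2 act (snd y) as)"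
      then show ?thesis using IH k tr conts_step[OF k(1)]
        by (intro exI[of _ "Suc m"] exI[of _ K'] exI[of _ False] exI[of _ s'])
          (auto split: if_splits)
    qed
  qed
qed simp

lemma complete:
  assumes "(step ^^ m) ([prog], input_store w) (K, s)"
  shows "K \<in> insert [] (conts prog []) \<and> (\<exists>ts. represents s ts \<and>
    (initial machine w, (enc (Some (K, False)), ts)) \<in> (ntm_step machine)\<^sup>*)"
  using assms
proof (induction m arbitrary: K s)
  case 0
  then show ?case using represents_input[of w] initial_step[of w] by auto
next
  case (Suc m)
  then obtain K1 s1 where 1: "(step ^^ m) ([prog], input_store w) (K1, s1)" "step (K1, s1) (K, s)"
    by auto
  then have "K1 \<noteq> []" by (auto simp: step_iff)
  with Suc.IH[OF 1(1)] obtain ts where ts: "K1 \<in> conts prog []" "represents s1 ts"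
    "(initial machine w, (enc (Some (K1, False)), ts)) \<in> (ntm_step machine)\<^sup>*" by auto
  from complete_step[OF ts(1,2) 1(2)] ts(3) conts_step[OF ts(1) 1(2)] show ?case
    by (meson rtrancl_trans)
qed

lemma accepts_machine: "accepts machine w \<longleftrightarrow> (\<exists>s. exec prog (input_store w) s)"
proof
  assume "accepts machine w"
  then obtain ts where "(initial machine w, (enc (Some ([], False)), ts)) \<in> (ntm_step machine)\<^sup>*"
    by (auto simp: accepts_def)
  then obtain n where n: "(initial machine w, (enc (Some ([], False)), ts)) \<in> ntm_step machine ^^ n"
    by (auto simp: rtrancl_power)
  then have "n > 0" by (cases n) (auto simp: initial_def)
  from sound[OF n this] show "\<exists>s. exec prog (input_store w) s" by (auto simp: exec_def)
next
  assume "\<exists>s. exec prog (input_store w) s"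
  then show "accepts machine w" unfolding accepts_def exec_def using complete by fastforce
qed

lemma machine_in_NP:
  assumes "\<And>w. bounded prog (input_store w) (poly p (length w))"
  shows "{w. \<exists>s. exec prog (input_store w) s} \<in> NP"
proof -
  have "n \<le> poly (smult 2 p + 2) (length w)"
    if run: "(initial machine w, x) \<in> ntm_step machine ^^ n" for w n x
  proof (cases "n = 0")
    case False
    then obtain m K f s where "(step ^^ m) ([prog], input_store w) (K, s)"
      "n \<le> 2 * m + (if f then 2 else 1)"
      using sound[OF run] by auto
    moreover from this have "m \<le> poly p (length w)"
      using assms[of w] unfolding bounded_def by blast
    ultimately show ?thesis by (auto split: if_splits)
  qed simp
  then have "runs_in_time machine (poly (smult 2 p + 2))"
    unfolding runs_in_time_def by blast
  then show ?thesis
    unfolding NP_def using wf_machine accepts_machine by blast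
qed

end

section \<open>Installing the fuel\<close>

text \<open>For loops whose body is deterministic and fails at a known point: the stores that the
  loop can reach form a finite chain, from which a test after the loop selects the end.\<close>

lemma chain_relpowp:
  assumes "\<And>i x. i < m \<Longrightarrow> R (t i) x \<longleftrightarrow> x = t (Suc i)" "\<And>x. \<not> R (t m) x"
  shows "(R ^^ k) (t 0) x \<longleftrightarrow> k \<le> m \<and> x = t k"
proof (induction k arbitrary: x)
  case (Suc k)
  have "(R ^^ Suc k) (t 0) x \<longleftrightarrow> k \<le> m \<and> R (t k) x"
    unfolding relpowp.simps(2) relcompp_apply Suc by blast
  also have "\<dots> \<longleftrightarrow> Suc k \<le> m \<and> x = t (Suc k)"
    using assms by (cases "k = m") auto
  finally show ?case .
qed auto

lemma chain_rtranclp: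
  assumes "\<And>i x. i < m \<Longrightarrow> R (t i) x \<longleftrightarrow> x = t (Suc i)" "\<And>x. \<not> R (t m) x"
  shows "R\<^sup>*\<^sup>* (t 0) x \<longleftrightarrow> (\<exists>i\<le>m. x = t i)"
  unfolding rtranclp_power using chain_relpowp[of m R t, OF assms] by auto

section \<open>Finite choices and programs with a constant step bound\<close>

fun pick :: "'x list \<Rightarrow> ('x \<Rightarrow> ('r, 'b) cmd) \<Rightarrow> ('r, 'b) cmd" where
  "pick [] f = undefined"
| "pick [x] f = f x"
| "pick (x # y # xs) f = Choice (f x) (pick (y # xs) f)"

lemma exec_pick [simp]: "xs \<noteq> [] \<Longrightarrow> exec (pick xs f) s t \<longleftrightarrow> (\<exists>x\<in>set xs. exec (f x) s t)"
  by (induction xs f rule: pick.induct) auto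

lemma sem_pick [simp]: "xs \<noteq> [] \<Longrightarrow> sem N (pick xs f) s t \<longleftrightarrow> (\<exists>x\<in>set xs. sem N (f x) s t)"
  by (induction xs f rule: pick.induct) auto

lemma syms_pick: "xs \<noteq> [] \<Longrightarrow> syms (pick xs f) = (\<Union>x\<in>set xs. syms (f x))"
  by (induction xs f rule: pick.induct) auto

definition uniform :: "('r, 'b) cmd \<Rightarrow> bool" where
  "uniform c \<longleftrightarrow> (\<exists>n. \<forall>s. bounded c s n)"

lemma uniform_simps [simp]:
  "uniform (Push r b)" "uniform (Pop r b)" "uniform (Empty r)"
  "uniform c \<Longrightarrow> uniform d \<Longrightarrow> uniform (Seq c d)"
  "uniform c \<Longrightarrow> uniform d \<Longrightarrow> uniform (Choice c d)"
  unfolding uniform_def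
  using bounded_Push bounded_Pop bounded_Empty bounded_Seq bounded_Choice by meson+

lemma uniform_pick: "xs \<noteq> [] \<Longrightarrow> (\<And>x. uniform (f x)) \<Longrightarrow> uniform (pick xs f)"
  by (induction xs f rule: pick.induct) auto

lemma finite_regs [simp]: "finite (regs c)"
  by (induction c) auto

definition letters :: "'a :: finite symbol list" where
  "letters = map Letter (SOME xs. set xs = UNIV)"

lemma set_letters [simp]: "set (letters :: 'a :: finite symbol list) = range Letter"
proof -
  have "set (SOME xs. set xs = (UNIV :: 'a set)) = UNIV"
    by (rule someI_ex) (rule finite_list, simp)
  then show ?thesis by (simp add: letters_def)
qed

lemma letters_Nil [simp]: "letters \<noteq> []"
  using set_letters by (metis empty_iff empty_set rangeI)

text \<open>There is no skip command. The test of \<open>used 0\<close>, a stack that is empty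
  during the preparation, takes its place.\<close>

primrec fill :: "'b \<Rightarrow> nat \<Rightarrow> ('r + nat \<times> bool, 'b) cmd" where
  "fill u 0 = Empty (used 0)"
| "fill u (Suc h) = Seq (Push (fuel h) u) (fill u h)"

definition raise :: "'b \<Rightarrow> nat \<Rightarrow> (nat \<times> bool, 'b) store \<Rightarrow> (nat \<times> bool, 'b) store" where
  "raise u h r = (\<lambda>(l, b). if \<not> b \<and> l < h then u # r (l, b) else r (l, b))"

lemma exec_fill:
  "exec (fill u h) (join s r) t \<longleftrightarrow> r (0, True) = [] \<and> t = join s (raise u h r)"
proof (induction h arbitrary: r)
  case 0
  then show ?case by (auto simp: raise_def)
next
  case (Suc h)
  have *: "raise u h (r((h, False) := u # r (h, False))) = raise u (Suc h) r"
    by (auto simp: raise_def fun_eq_iff less_Suc_eq)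
  have "exec (fill u (Suc h)) (join s r) t \<longleftrightarrow>
      exec (fill u h) (join s (r((h, False) := u # r (h, False)))) t"
    by simp
  then show ?case unfolding Suc * by simp
qed

lemma exec_fill_Inl: "exec (fill u h) s t \<Longrightarrow> t (Inl x) = s (Inl x)"
  by (induction h arbitrary: s) auto

lemma uniform_fill: "uniform (fill u h)"
  by (induction h) auto

lemma syms_fill: "syms (fill u h) \<subseteq> {u}"
  by (induction h) auto

text \<open>A program of height \<open>h\<close> uses the fuel stacks of the levels below
  \<open>h\<close> only, so the one of level \<open>h\<close> is free as scratch space.\<close>

definition stash :: "nat \<Rightarrow> 'r + nat \<times> bool" where
  "stash h = Inr (h, False)"

definition unload :: "'r \<Rightarrow> nat \<Rightarrow> ('r + nat \<times> bool, 'a :: finite symbol) cmd" where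
  "unload x h = pick letters
     (\<lambda>a. Seq (Pop (Inl x) a) (Seq (Push (stash h) a) (fill (Work 0) h)))"

definition reload :: "'r \<Rightarrow> nat \<Rightarrow> ('r + nat \<times> bool, 'a :: finite symbol) cmd" where
  "reload x h = pick letters (\<lambda>a. Seq (Pop (stash h) a) (Push (Inl x) a))"

definition finish :: "nat \<Rightarrow> ('r + nat \<times> bool, 'a symbol) cmd" where
  "finish h = Seq (Empty (stash h)) (Seq (fill (Work 0) h) (fill (Work 0) h))"

text \<open>The input is counted by moving it to the scratch stack, each letter adding one unit to
  all fuel stacks at once, and then moved back. The two emptiness tests force both loops to run to
  the end; \<open>finish\<close> adds the last two units.\<close>

definition init_rulers :: "'r \<Rightarrow> nat \<Rightarrow> ('r + nat \<times> bool, 'a :: finite symbol) cmd" where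
  "init_rulers x h = Seq (Loop (unload x h)) (Seq (Empty (Inl x))
     (Seq (Loop (reload x h)) (finish h)))"

definition input :: "'r \<Rightarrow> 'a list \<Rightarrow> ('r, 'a symbol) store" where
  "input x w = (\<lambda>_. [])(x := map Letter w)"

definition level :: "nat \<Rightarrow> nat \<Rightarrow> 'a symbol list \<Rightarrow> (nat \<times> bool, 'a symbol) store" where
  "level h i l = (\<lambda>(j, b). if b then [] else if j < h then replicate i (Work 0)
     else if j = h then l else [])"

lemma level_simps [simp]:
  "level h i l (j, True) = []" "level h i l (h, False) = l"
  "(level h i l)((h, False) := l') = level h i l'"
  "raise (Work 0) h (level h i l) = level h (Suc i) l"
  by (auto simp: level_def raise_def fun_eq_iff)

lemma full_level: "full (Work 0) i h (level h i l)"
  by (auto simp: full_def level_def)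

lemma exec_unload:
  "exec (unload x h) (join ((\<lambda>_. [])(x := v)) (level h i l)) t \<longleftrightarrow>
     (\<exists>a v'. v = Letter a # v' \<and> t = join ((\<lambda>_. [])(x := v')) (level h (Suc i) (Letter a # l)))"
  by (auto simp: unload_def stash_def exec_fill)

lemma exec_reload:
  "exec (reload x h) (join ((\<lambda>_. [])(x := v)) (level h i l)) t \<longleftrightarrow>
     (\<exists>a l'. l = Letter a # l' \<and> t = join ((\<lambda>_. [])(x := Letter a # v)) (level h i l'))"
  by (auto simp: reload_def stash_def)

lemma exec_Loop_unload:
  "exec (Loop (unload x h)) (join (input x w) (level h 0 [])) t \<longleftrightarrow>
    (\<exists>i\<le>length w. t = join (input x (drop i w)) (level h i (rev (map Letter (take i w)))))"
proof -
  let ?t = "\<lambda>i. join (input x (drop i w)) (level h i (rev (map Letter (take i w))))"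
  have "(exec (unload x h))\<^sup>*\<^sup>* (?t 0) t \<longleftrightarrow> (\<exists>i\<le>length w. t = ?t i)"
  proof (rule chain_rtranclp)
    fix i t assume "i < length w"
    then show "exec (unload x h) (?t i) t \<longleftrightarrow> t = ?t (Suc i)"
      by (auto simp: input_def exec_unload take_Suc_conv_app_nth simp flip: Cons_nth_drop_Suc)
  qed (auto simp: input_def exec_unload)
  then show ?thesis by simp
qed

lemma exec_Loop_reload:
  "exec (Loop (reload x h)) (join (input x []) (level h j (rev (map Letter w)))) t \<longleftrightarrow>
    (\<exists>i\<le>length w. t = join (input x (drop (length w - i) w))
      (level h j (rev (map Letter (take (length w - i) w)))))"
proof -
  let ?t = "\<lambda>i. join (input x (drop (length w - i) w))
      (level h j (rev (map Letter (take (length w - i) w))))"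
  have "(exec (reload x h))\<^sup>*\<^sup>* (?t 0) t \<longleftrightarrow> (\<exists>i\<le>length w. t = ?t i)"
  proof (rule chain_rtranclp)
    fix i t assume "i < length w"
    then have "length w - i = Suc (length w - Suc i)" "length w - Suc i < length w" by simp_all
    then show "exec (reload x h) (?t i) t \<longleftrightarrow> t = ?t (Suc i)"
      by (auto simp: input_def exec_reload take_Suc_conv_app_nth Cons_nth_drop_Suc)
        (auto simp flip: Cons_nth_drop_Suc)
  qed (auto simp: input_def exec_reload)
  then show ?thesis by simp
qed

lemma exec_init_rulers:
  "exec (init_rulers x h) (join (input x w) (level h 0 [])) t \<longleftrightarrow>
    t = join (input x w) (level h (length w + 2) [])"
proof -
  have 1: "input x v x = [] \<longleftrightarrow> v = []" for v by (simp add: input_def)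
  have 2: "exec (finish h)
      (join s (level h i l)) t \<longleftrightarrow> l = [] \<and> t = join s (level h (i + 2) [])" for s i l t
    by (auto simp: finish_def exec_fill stash_def)
  have 3: "exec (Seq (Loop (reload x h)) (finish h))
      (join (input x []) (level h i (rev (map Letter w)))) t \<longleftrightarrow> t =
          join (input x w) (level h (i + 2) [])" for i t
    unfolding exec_Seq[of "Loop (reload x h)"] exec_Loop_reload
  proof safe
    fix j assume "j \<le> length w" "exec (finish h)
      (join (input x (drop (length w - j) w)) (level h i (rev (map Letter (take (length w - j)
          w))))) t"
    then show "t = join (input x w) (level h (i + 2) [])" unfolding 2 by auto
  next
    have *: "exec (finish h)
        (join (input x w) (level h i [])) (join (input x w) (level h (i + 2) []))"
      unfolding 2 by simp
    show "\<exists>s'. (\<exists>ia\<le>length w. s' = join (input x (drop (length w - ia) w))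
        (level h i (rev (map Letter (take (length w - ia) w))))) \<and>
      exec (finish h) s'
        (join (input x w) (level h (i + 2) []))"
      by (rule exI[of _ "join (input x w) (level h i [])"], rule conjI[OF _ *],
          rule exI[of _ "length w"]) simp
  qed
  show ?thesis unfolding init_rulers_def exec_Seq[of "Loop (unload x h)"] exec_Loop_unload
  proof safe
    fix i assume i: "i \<le> length w"
        and "exec (Seq (Empty (Inl x)) (Seq (Loop (reload x h)) (finish h)))
      (join (input x (drop i w)) (level h i (rev (map Letter (take i w))))) t"
    then have *: "drop i w = []" "exec (Seq (Loop (reload x h)) (finish h))
      (join (input x (drop i w)) (level h i (rev (map Letter (take i w))))) t"
      unfolding exec_Seq[of "Empty (Inl x)"] by (auto simp: 1)
    then have "i = length w" using i by simp
    with *(2) show "t = join (input x w) (level h (length w + 2) [])"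
      using 3 by simp
  next
    have *: "exec (Seq (Empty (Inl x)) (Seq (Loop (reload x h)) (finish h)))
      (join (input x []) (level h (length w) (rev (map Letter w)))) (join (input x w) (level h
          (length w + 2) []))"
      unfolding exec_Seq[of "Empty (Inl x)"] using 3[of "length w"] by (auto simp: input_def)
    show "\<exists>s'. (\<exists>i\<le>length w. s' = join (input x (drop i w)) (level h i (rev (map Letter (take i
        w))))) \<and>
      exec (Seq (Empty (Inl x)) (Seq (Loop (reload x h)) (finish h))) s'
      (join (input x w) (level h (length w + 2) []))"
      using * by (intro exI[of _ "join (input x []) (level h (length w) (rev (map Letter w)))"]
          conjI
          exI[of _ "length w"]) simp_all
  qed
qed

lemma bounded_init_rulers:
  fixes x :: 'r
  shows "\<exists>p :: nat poly. \<forall>w :: 'a :: finite list.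
    bounded (init_rulers x h) (join (input x w) (level h 0 [])) (poly p (length w))"
proof -
  have "uniform (unload x h :: ('r + nat \<times> bool, 'a symbol) cmd)"
    "uniform (reload x h :: ('r + nat \<times> bool, 'a symbol) cmd)"
    "uniform (finish h :: ('r + nat \<times> bool, 'a symbol) cmd)"
    unfolding unload_def reload_def finish_def by (auto intro!: uniform_pick simp: uniform_fill)
  then obtain b1 b2 b3 where
    b1: "\<And>s. bounded (unload x h :: ('r + nat \<times> bool, 'a symbol) cmd) s b1" and
    b2: "\<And>s. bounded (reload x h :: ('r + nat \<times> bool, 'a symbol) cmd) s b2" and
    b3: "\<And>s. bounded (finish h
      :: ('r + nat \<times> bool, 'a symbol) cmd) s b3"
    unfolding uniform_def by blast
  let ?p = "[:1, 1:] * [:b1 + 1:] + [:1, 1:] * [:b2 + 1:] + [:b3 + 4:]"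
  show ?thesis
  proof (intro exI[of _ ?p] allI)
    fix w :: "'a list"
    have "bounded (Loop (unload x h)) (join (input x w) (level h 0 []))
        (Suc (length (join (input x w) (level h 0 []) (Inl x))) * (b1 + 1))"
      by (rule bounded_Loop[where I = "\<lambda>_. True" and \<mu> = "\<lambda>s. length (s (Inl x))" and b = b1])
        (auto simp: b1, auto simp: unload_def stash_def dest!: exec_fill_Inl[where x = x])
    then have A: "bounded (Loop (unload x h)) (join (input x w) (level h 0 [])) (Suc (length w) *
        (b1 + 1))"
      by (simp add: input_def)
    have "bounded (Loop (reload x h)) s (Suc (length (s (stash h))) * (b2 + 1))"
      for s :: "('r + nat \<times> bool, 'a symbol) store"
      by (rule bounded_Loop[where I = "\<lambda>_. True" and \<mu> = "\<lambda>s. length (s (stash h))" and b = b2])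
        (auto simp: b2, auto simp: reload_def stash_def)
    then have B: "bounded (Loop (reload x h)) s (Suc (length w) * (b2 + 1))"
      if "length (s (stash h)) \<le> length w" for s :: "('r + nat \<times> bool, 'a symbol) store"
      by (rule bounded_mono, intro mult_right_mono) (use that in simp_all)
    have st: "length (s (stash h)) \<le> length w"
      if "exec (Loop (unload x h)) (join (input x w) (level h 0 [])) s" for s
      using that unfolding exec_Loop_unload by (auto simp: stash_def)
    have "bounded (init_rulers x h) (join (input x w) (level h 0 []))
      (Suc (Suc (length w) * (b1 + 1) + Suc (1 + Suc (Suc (length w) * (b2 + 1) + b3))))"
      unfolding init_rulers_def
      by (intro bounded_Seq A B b3 bounded_Empty) (auto dest: st simp del: exec_Loop)
    then show "bounded (init_rulers x h) (join (input x w) (level h 0 [])) (poly ?p (length w))"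
      by (rule bounded_mono) (simp add: algebra_simps)
  qed
qed

lemma syms_init_rulers: "Blank \<notin> syms (init_rulers x h)"
  using syms_fill[of "Work 0" h]
  by (auto simp: init_rulers_def unload_def reload_def finish_def syms_pick)

lemma syms_comp: "syms (comp u c) \<subseteq> insert u (syms c)"
  by (induction c) (auto simp: spend_def refill_def)

theorem program_in_NP:
  fixes c :: "('r :: countable, 'a :: finite symbol) cmd"
  assumes "Blank \<notin> syms c"
  shows "{w. \<exists>s. sem (length w + 2) c (input x w) s} \<in> NP"
proof -
  define h where "h = height c"
  define d where "d = Seq (init_rulers x h) (comp (Work 0) c)"
  \<comment> \<open>The input register is put in front of the others because the machine finds its
    input on the first tape.\<close>
  obtain xs where xs: "set xs = regs d - {Inl x}" "distinct xs"
    using finite_distinct_list[of "regs d - {Inl x}"] by auto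
  interpret stack_machine d "Inl x # xs"
    using xs assms syms_init_rulers[of x h] syms_comp[of "Work 0" c]
    by unfold_locales (auto simp: d_def)
  have start: "input_store w = join (input x w) (level h 0 [])" for w
    by (auto simp: input_store_def input_def level_def join_def fun_eq_iff split: sum.splits)
  have full: "full (Work 0) (length w + 2) (height c) (level h (length w + 2) [])"
      for w :: "'a list"
    unfolding h_def by (rule full_level)
  have "exec d (input_store w) t \<longleftrightarrow>
      (\<exists>s'. sem (length w + 2) c (input x w) s' \<and> t = join s' (level h (length w + 2) []))" for w t
    unfolding d_def exec_Seq start exec_init_rulers using exec_comp[OF full] by blast
  then have eq: "(\<exists>t. exec d (input_store w) t) \<longleftrightarrow> (\<exists>s. sem (length w + 2) c (input x w) s)" for w
    by blast
  obtain p :: "nat poly" where p: "\<And>w :: 'a list.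
      bounded (init_rulers x h) (join (input x w) (level h 0 [])) (poly p (length w))"
    using bounded_init_rulers[where ?'a = 'a and x = x and h = h] by metis
  let ?q = "p + pcompose (time c) [:2, 1:] + 1"
  have "bounded d (input_store w) (poly ?q (length w))" for w
  proof -
    have "bounded d (input_store w) (Suc (poly p (length w) + poly (time c) (length w + 2)))"
      unfolding d_def start
    proof (rule bounded_Seq[OF p])
      fix s assume "exec (init_rulers x h) (join (input x w) (level h 0 [])) s"
      then show "bounded (comp (Work 0) c) s (poly (time c) (length w + 2))"
        unfolding exec_init_rulers using bounded_comp[OF full] by blast
    qed
    then show ?thesis by (simp add: poly_pcompose add.commute)
  qed
  from machine_in_NP[of ?q, OF this] show ?thesis unfolding eq .
qed

section \<open>Programs over unary registers\<close>

text \<open>Nesting turns the cap of \<open>N\<close> rounds into the cap \<open>N ^ Suc e\<close>,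
  which is how loops of polynomial length are obtained.\<close>

primrec loops :: "nat \<Rightarrow> ('r, 'b) cmd \<Rightarrow> ('r, 'b) cmd" where
  "loops 0 c = Loop c"
| "loops (Suc e) c = Loop (loops e c)"

lemma relpowp_at_most:
  fixes R :: "'s \<Rightarrow> 's \<Rightarrow> bool"
  shows "((\<lambda>s t. \<exists>m\<le>B. (R ^^ m) s t) ^^ k) s t \<longleftrightarrow> (\<exists>m\<le>k * B. (R ^^ m) s t)"
proof (induction k arbitrary: t)
  case (Suc k)
  have "((\<lambda>s t. \<exists>m\<le>B. (R ^^ m) s t) ^^ Suc k) s t \<longleftrightarrow>
      (\<exists>m\<le>k * B. \<exists>m'\<le>B. (R ^^ (m + m')) s t)"
    unfolding relpowp.simps(2) relcompp_apply Suc relpowp_add by blast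
  also have "\<dots> \<longleftrightarrow> (\<exists>m\<le>Suc k * B. (R ^^ m) s t)"
  proof safe
    fix m m' assume "m \<le> k * B" "m' \<le> B" "(R ^^ (m + m')) s t"
    then show "\<exists>m\<le>Suc k * B. (R ^^ m) s t" by (intro exI[of _ "m + m'"]) simp
  next
    fix m assume m: "m \<le> Suc k * B" "(R ^^ m) s t"
    define m1 m2 where "m1 = min m (k * B)" and "m2 = m - m1"
    then have "m = m1 + m2" "m1 \<le> k * B" "m2 \<le> B" using m(1) by auto
    then show "\<exists>m\<le>k * B. \<exists>m'\<le>B. (R ^^ (m + m')) s t" using m(2) by blast
  qed
  finally show ?case .
qed auto

lemma sem_loops: "sem N (loops e c) s t \<longleftrightarrow> (\<exists>m\<le>N ^ Suc e. (sem N c ^^ m) s t)"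
proof (induction e arbitrary: s t)
  case (Suc e)
  then have *: "sem N (loops e c) = (\<lambda>s t. \<exists>m\<le>N ^ Suc e. (sem N c ^^ m) s t)"
    by (intro ext) simp
  have "sem N (loops (Suc e) c) s t \<longleftrightarrow> (\<exists>k\<le>N. \<exists>m\<le>k * N ^ Suc e. (sem N c ^^ m) s t)"
    by (simp add: * relpowp_at_most del: power_Suc)
  also have "\<dots> \<longleftrightarrow> (\<exists>m\<le>N ^ Suc (Suc e). (sem N c ^^ m) s t)"
  proof safe
    fix k m assume "k \<le> N" "m \<le> k * N ^ Suc e" "(sem N c ^^ m) s t"
    moreover from this have "m \<le> N ^ Suc (Suc e)"
      using mult_le_mono1[of k N "N ^ Suc e"] le_trans unfolding power_Suc[of N "Suc e"] by blast
    ultimately show "\<exists>m\<le>N ^ Suc (Suc e). (sem N c ^^ m) s t" by blast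
  next
    fix m assume "m \<le> N ^ Suc (Suc e)" "(sem N c ^^ m) s t"
    \<comment> \<open>All \<open>N\<close> outer rounds may be used, since an inner loop is free to
      run for fewer rounds or none.\<close>
    then show "\<exists>k\<le>N. \<exists>m\<le>k * N ^ Suc e. (sem N c ^^ m) s t"
      by (intro exI[of _ N]) auto
  qed
  finally show ?case .
qed simp

lemma sem_loops_chain:
  assumes "\<And>i x. i < m \<Longrightarrow> sem N c (t i) x \<longleftrightarrow> x = t (Suc i)" "\<And>x. \<not> sem N c (t m) x"
    and "m \<le> N ^ Suc e" "t 0 = s"
  shows "sem N (loops e c) s x \<longleftrightarrow> (\<exists>i\<le>m. x = t i)"
proof -
  have "sem N (loops e c) s x \<longleftrightarrow> (\<exists>k\<le>N ^ Suc e. k \<le> m \<and> x = t k)"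
    unfolding sem_loops assms(4)[symmetric]
    by (simp only: chain_relpowp[of m "sem N c" t, OF assms(1,2)])
  then show ?thesis using assms(3) le_trans by blast
qed

section \<open>Arithmetic on unary counters\<close>

definition unary :: "nat \<Rightarrow> 'a symbol list" where
  "unary n = replicate n (Work 0)"

lemma unary_simps [simp]:
  "unary 0 = []" "unary (Suc n) = Work 0 # unary n"
  "unary n = [] \<longleftrightarrow> n = 0" "[] = unary n \<longleftrightarrow> n = 0"
  "length (unary n) = n"
  by (auto simp: unary_def)

lemma unary_eq_Cons [simp]: "unary n = b # l \<longleftrightarrow> (\<exists>k. n = Suc k \<and> b = Work 0 \<and> l = unary k)"
  by (cases n) auto

abbreviation one :: "'a symbol" where
  "one \<equiv> Work 0"

text \<open>A while loop: the loop may stop early, but the test at the end rejects all runs in which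
  \<open>X\<close> has not been used up. The cap must be at least the value of
  \<open>X\<close>.\<close>

definition drain :: "nat \<Rightarrow> 'r \<Rightarrow> ('r, 'a symbol) cmd \<Rightarrow> ('r, 'a symbol) cmd" where
  "drain e X c = Seq (loops e (Seq (Pop X one) c)) (Empty X)"

lemma sem_drain:
  assumes "\<And>i. i \<le> m \<Longrightarrow> t i X = unary (m - i)"
    and "\<And>i x. i < m \<Longrightarrow> sem N c ((t i)(X := unary (m - Suc i))) x \<longleftrightarrow> x = t (Suc i)"
    and "m \<le> N ^ Suc e" "t 0 = s"
  shows "sem N (drain e X c) s x \<longleftrightarrow> x = t m"
proof -
  have "sem N (loops e (Seq (Pop X one) c)) s x \<longleftrightarrow> (\<exists>i\<le>m. x = t i)" for x
  proof (rule sem_loops_chain[where t = t and m = m, OF _ _ assms(3,4)])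
    fix i x assume i: "i < m"
    then have "t i X = one # unary (m - Suc i)"
      using assms(1)[of i] by (simp add: Suc_diff_Suc flip: unary_simps(2))
    then show "sem N (Seq (Pop X one) c) (t i) x \<longleftrightarrow> x = t (Suc i)"
      using assms(2)[OF i] by simp
  next
    show "\<not> sem N (Seq (Pop X one) c) (t m) x" for x
      using assms(1)[of m] by simp
  qed
  then show ?thesis
    using assms(1) by (auto simp: drain_def)
qed

definition clear :: "nat \<Rightarrow> 'r \<Rightarrow> ('r, 'a symbol) cmd" where
  "clear e X = Seq (loops e (Pop X one)) (Empty X)"

lemma sem_loops_Pop:
  assumes "s X = unary m" "m \<le> N ^ Suc e"
  shows "sem N (loops e (Pop X one)) s x \<longleftrightarrow> (\<exists>i\<le>m. x = s(X := unary i))"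
proof -
  have "sem N (loops e (Pop X one)) s x \<longleftrightarrow> (\<exists>i\<le>m. x = s(X := unary (m - i)))"
  proof (rule sem_loops_chain[where t = "\<lambda>i. s(X := unary (m - i))", OF _ _ assms(2)])
    fix i x assume "i < m"
    then have "m - i = Suc (m - Suc i)" by simp
    then show "sem N (Pop X one) (s(X := unary (m - i))) x \<longleftrightarrow> x = s(X := unary (m - Suc i))"
      by auto
  qed (use assms in auto)
  also have "\<dots> \<longleftrightarrow> (\<exists>i\<le>m. x = s(X := unary i))"
    by (metis diff_diff_cancel diff_le_self)
  finally show ?thesis .
qed

lemma sem_clear:
  assumes "s X = unary m" "m \<le> N ^ Suc e"
  shows "sem N (clear e X) s x \<longleftrightarrow> x = s(X := [])"
  using sem_loops_Pop[of s X m N e] assms by (auto simp: clear_def)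

datatype reg = In | Aux | I | J | Var nat | Arr nat

instance reg :: countable
  by countable_datatype

type_synonym 'a mem = "(reg, 'a symbol) store"

definition add :: "nat \<Rightarrow> reg \<Rightarrow> reg \<Rightarrow> (reg, 'a symbol) cmd" where
  "add e X Y = Seq (drain e X (Seq (Push Aux one) (Push Y one))) (drain e Aux (Push X one))"

lemma sem_add:
  fixes s :: "'a mem"
  assumes "s X = unary m" "s Y = unary n" "s Aux = []" "X \<noteq> Y" "X \<noteq> Aux" "Y \<noteq> Aux"
    and "m \<le> N ^ Suc e"
  shows "sem N (add e X Y) s x \<longleftrightarrow> x = s(Y := unary (n + m))"
proof -
  have 1: "sem N (drain e X (Seq (Push Aux one) (Push Y one))) s x \<longleftrightarrow>
      x = s(X := unary (m - m), Aux := unary m, Y := unary (n + m))" for x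
    by (rule sem_drain[where t = "\<lambda>i. s(X := unary (m - i), Aux := unary i, Y := unary (n + i))"])
      (use assms in auto)
  have 2: "sem N (drain e Aux (Push X one)) (s(X := [], Aux := unary m, Y := unary (n + m))) x \<longleftrightarrow>
      x = s(Y := unary (n + m), Aux := unary (m - m), X := unary m)" for x
    by (rule sem_drain[where t = "\<lambda>i. s(Y := unary (n + m), Aux := unary (m - i), X := unary i)"])
      (use assms in \<open>auto simp: fun_eq_iff\<close>)
  have "s(Y := unary (n + m), Aux := [], X := unary m) = s(Y := unary (n + m))"
    using assms by (auto simp: fun_eq_iff)
  then show ?thesis using 1 2 by (simp add: add_def)
qed

text \<open>The recursion ends in a test of \<open>Aux\<close>, which is empty between operations,
  as a substitute for a skip command.\<close>

primrec incr :: "nat \<Rightarrow> reg \<Rightarrow> (reg, 'a symbol) cmd" where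
  "incr 0 X = Empty Aux"
| "incr (Suc k) X = Seq (Push X one) (incr k X)"

lemma sem_incr:
  "s X = unary n \<Longrightarrow> s Aux = [] \<Longrightarrow> X \<noteq> Aux \<Longrightarrow> sem N (incr k X) s x \<longleftrightarrow> x = s(X := unary (n + k))"
proof (induction k arbitrary: s n)
  case 0
  then have "s(X := unary (n + 0)) = s" by (simp add: fun_upd_idem)
  then show ?case using 0 by auto
next
  case (Suc k)
  let ?s = "s(X := unary (Suc n))"
  have "sem N (incr k X) ?s x \<longleftrightarrow> x = ?s(X := unary (Suc n + k))"
    by (rule Suc.IH) (use Suc.prems in auto)
  moreover have "sem N (incr (Suc k) X) s x \<longleftrightarrow> sem N (incr k X) ?s x"
    using Suc.prems(1) by simp
  moreover have "?s(X := unary (Suc n + k)) = s(X := unary (n + Suc k))" by simp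
  ultimately show ?case by metis
qed

text \<open>One Horner step in base M + 1, where M is the content of \<open>Var 0\<close>: the
  number in \<open>I\<close> is multiplied by the base, with \<open>J\<close> as intermediate
  store.\<close>

definition scale :: "nat \<Rightarrow> (reg, 'a symbol) cmd" where
  "scale e = Seq (drain e I (Seq (Push J one) (add e (Var 0) J))) (drain e J (Push I one))"

lemma sem_scale:
  fixes s :: "'a mem"
  assumes "s I = unary k" "s J = []" "s Aux = []" "s (Var 0) = unary M"
    and "k * Suc M \<le> N ^ Suc e" "M \<le> N ^ Suc e"
  shows "sem N (scale e) s x \<longleftrightarrow> x = s(I := unary (k * Suc M))"
proof -
  have k: "k \<le> N ^ Suc e" by (rule le_trans[OF _ assms(5)]) simp
  have 1: "sem N (drain e I (Seq (Push J one) (add e (Var 0) J))) s x \<longleftrightarrow>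
      x = s(I := unary (k - k), J := unary (k * Suc M))" for x
  proof (rule sem_drain[where t = "\<lambda>i. s(I := unary (k - i), J := unary (i * Suc M))"])
    fix i x assume "i < k"
    let ?s = "s(I := unary (k - Suc i), J := unary (Suc (i * Suc M)))"
    have "sem N (add e (Var 0) J) ?s x \<longleftrightarrow> x = ?s(J := unary (Suc (i * Suc M) + M))"
      by (rule sem_add) (use assms in auto)
    moreover have "(s(I := unary (k - i), J := unary (i * Suc M)))(I := unary (k - Suc i)) =
        s(J := unary (i * Suc M), I := unary (k - Suc i))" by simp
    moreover have "(s(J := unary (i * Suc M), I := unary (k - Suc i)))(J :=
        one # unary (i * Suc M)) = ?s"
      by simp
    moreover have "Suc (i * Suc M) + M = Suc i * Suc M" by simp
    ultimately show "sem N (Seq (Push J one) (add e (Var 0) J))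
        ((s(I := unary (k - i), J := unary (i * Suc M)))(I := unary (k - Suc i))) x \<longleftrightarrow>
      x = s(I := unary (k - Suc i), J := unary (Suc i * Suc M))"
      by (simp del: mult_Suc mult_Suc_right unary_simps(2))
  qed (use assms k in auto)
  have 2: "sem N (drain e J (Push I one)) (s(I := [], J := unary (k * Suc M))) x \<longleftrightarrow>
      x = s(J := unary (k * Suc M - k * Suc M), I := unary (k * Suc M))" for x
    by (rule sem_drain[where t = "\<lambda>i. s(J := unary (k * Suc M - i), I := unary i)"])
      (use assms in \<open>auto simp: fun_eq_iff\<close>)
  have "s(J := [], I := unary (k * Suc M)) = s(I := unary (k * Suc M))"
    using assms by (auto simp: fun_eq_iff)
  then show ?thesis using 1 2 by (simp add: scale_def)
qed

text \<open>Random access into the stack \<open>X\<close>: symbols are moved to \<open>Aux\<close>,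
  the exposed position is inspected by \<open>c\<close>, and everything is moved back. How many
  symbols are moved is left to chance, so \<open>c\<close> must reject a wrong number:
  \<open>hit\<close> by demanding that the index \<open>I\<close> is used up, \<open>off\<close> by
  demanding that \<open>X\<close> is.\<close>

definition look :: "nat \<Rightarrow> reg \<Rightarrow> 'a symbol list \<Rightarrow> (reg, 'a symbol) cmd \<Rightarrow> (reg, 'a symbol) cmd" where
  "look e X S c = Seq (loops e (Seq (Pop I one) (pick S (\<lambda>b. Seq (Pop X b) (Push Aux b)))))
     (Seq c (Seq (loops e (pick S (\<lambda>b. Seq (Pop Aux b) (Push X b)))) (Empty Aux)))"

definition hit :: "reg \<Rightarrow> 'a symbol \<Rightarrow> (reg, 'a symbol) cmd" where
  "hit X b = Seq (Empty I) (Seq (Pop X b) (Push X b))"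

definition off :: "nat \<Rightarrow> reg \<Rightarrow> (reg, 'a symbol) cmd" where
  "off e X = Seq (Empty X) (clear e I)"

text \<open>\<open>P i\<close> is the verdict of \<open>c\<close> after \<open>i\<close> symbols
  have been moved. As \<open>c\<close> leaves \<open>X\<close> and \<open>Aux\<close> alone, moving
  back restores \<open>X\<close>, and the net effect is that the index is cleared.\<close>

lemma sem_look:
  fixes s :: "'a mem"
  assumes "s I = unary k" "s X = l" "s Aux = []" "set l \<subseteq> set S" "X \<noteq> I" "X \<noteq> Aux" "S \<noteq> []"
    and "k \<le> N ^ Suc e" "length l \<le> N ^ Suc e"
    and c: "\<And>i x. i \<le> k \<Longrightarrow> i \<le> length l \<Longrightarrow>
      sem N c (s(I := unary (k - i), X := drop i l, Aux := rev (take i l))) x \<longleftrightarrow>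
      P i \<and> x = s(I := [], Aux := rev (take i l), X := drop i l)"
  shows "sem N (look e X S c) s x \<longleftrightarrow> (\<exists>i. i \<le> k \<and> i \<le> length l \<and> P i) \<and> x = s(I := [])"
proof -
  let ?t = "\<lambda>i. s(I := unary (k - i), X := drop i l, Aux := rev (take i l))"
  let ?u = "\<lambda>n i. s(I := [], Aux := rev (take (n - i) l), X := drop (n - i) l)"
  have 1: "sem N (loops e (Seq (Pop I one) (pick S (\<lambda>b. Seq (Pop X b) (Push Aux b))))) s x \<longleftrightarrow>
      (\<exists>i\<le>min k (length l). x = ?t i)" for x
  proof (rule sem_loops_chain)
    fix i x assume i: "i < min k (length l)"
    then have "l ! i \<in> set S" "k - i = Suc (k - Suc i)" using assms by auto
    then show "sem N (Seq (Pop I one) (pick S (\<lambda>b. Seq (Pop X b) (Push Aux b)))) (?t i) x \<longleftrightarrow> x =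
        ?t (Suc i)"
      using i assms by (auto simp: take_Suc_conv_app_nth simp flip: Cons_nth_drop_Suc)
  next
    fix x show "\<not> sem N (Seq (Pop I one) (pick S (\<lambda>b. Seq (Pop X b) (Push Aux b))))
        (?t (min k (length l))) x"
      using assms by (auto simp: min_def)
  qed (use assms in \<open>auto simp: fun_eq_iff\<close>)
  have 2: "sem N (loops e (pick S (\<lambda>b. Seq (Pop Aux b) (Push X b)))) (?u n 0) x \<longleftrightarrow>
      (\<exists>i\<le>n. x = ?u n i)" if n: "n \<le> length l" for n x
  proof (rule sem_loops_chain)
    fix i x assume i: "i < n"
    define j where "j = n - Suc i"
    have j: "n - i = Suc j" "n - Suc i = j" "j < length l" using i n by (auto simp: j_def)
    then have "l ! j \<in> set S" using assms by auto
    then show "sem N (pick S (\<lambda>b. Seq (Pop Aux b) (Push X b))) (?u n i) x \<longleftrightarrow> x = ?u n (Suc i)"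
      using assms unfolding j by (auto simp: take_Suc_conv_app_nth[OF j(3)] Cons_nth_drop_Suc[OF
          j(3)])
  qed (use assms n in \<open>auto\<close>)
  have 3: "sem N (Seq (loops e (pick S (\<lambda>b. Seq (Pop Aux b) (Push X b)))) (Empty Aux)) (?u n 0) x \<longleftrightarrow>
      x = s(I := [])" if n: "n \<le> length l" for n x
  proof -
    have "sem N (Seq (loops e (pick S (\<lambda>b. Seq (Pop Aux b) (Push X b)))) (Empty Aux)) (?u n 0) x \<longleftrightarrow>
      x = ?u n n"
      unfolding sem.simps(4) 2[OF n] using n assms(5,6) by (auto simp: le_antisym)
    also have "?u n n = s(I := [])" using assms by (auto simp: fun_eq_iff)
    finally show ?thesis .
  qed
  have "sem N (look e X S c) s x \<longleftrightarrow> (\<exists>i\<le>min k (length l). P i \<and>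
      sem N (Seq (loops e (pick S (\<lambda>b. Seq (Pop Aux b) (Push X b)))) (Empty Aux)) (?u i 0) x)"
    unfolding look_def sem.simps(4)[of N "loops e (Seq (Pop I one) (pick S (\<lambda>b. Seq (Pop X b)
        (Push Aux b))))"] 1
      sem.simps(4)[of N c] using c by auto
  then show ?thesis using 3 by auto
qed

lemma sem_look_hit:
  fixes s :: "'a mem"
  assumes "s I = unary k" "s X = l" "s Aux = []" "set l \<subseteq> set S" "X \<noteq> I" "X \<noteq> Aux" "S \<noteq> []"
    and "k \<le> N ^ Suc e" "length l \<le> N ^ Suc e"
  shows "sem N (look e X S (hit X b)) s x \<longleftrightarrow> k < length l \<and> l ! k = b \<and> x = s(I := [])"
proof -
  have "sem N (look e X S (hit X b)) s x \<longleftrightarrow>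
    (\<exists>i. i \<le> k \<and> i \<le> length l \<and> i = k \<and> k < length l \<and> l ! k = b) \<and> x = s(I := [])"
  proof (rule sem_look[OF assms])
    fix i x assume "i \<le> k" "i \<le> length l"
    then show "sem N (hit X b) (s(I := unary (k - i), X := drop i l, Aux := rev (take i l))) x \<longleftrightarrow>
       (i = k \<and> k < length l \<and> l ! k = b) \<and> x = s(I := [], Aux := rev (take i l), X := drop i l)"
      using assms by (cases "i = length l") (auto simp: hit_def simp flip: Cons_nth_drop_Suc)
  qed
  then show ?thesis by auto
qed

lemma sem_look_off:
  fixes s :: "'a mem"
  assumes "s I = unary k" "s X = l" "s Aux = []" "set l \<subseteq> set S" "X \<noteq> I" "X \<noteq> Aux" "S \<noteq> []"
    and "k \<le> N ^ Suc e" "length l \<le> N ^ Suc e"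
  shows "sem N (look e X S (off e X)) s x \<longleftrightarrow> length l \<le> k \<and> x = s(I := [])"
proof -
  have "sem N (look e X S (off e X)) s x \<longleftrightarrow>
    (\<exists>i. i \<le> k \<and> i \<le> length l \<and> i = length l) \<and> x = s(I := [])"
  proof (rule sem_look[OF assms])
    fix i x assume i: "i \<le> k" "i \<le> length l"
    let ?s = "s(I := unary (k - i), X := drop i l, Aux := rev (take i l))"
    have "?s(I := []) = s(I := [], Aux := rev (take i l), X := drop i l)"
      using assms by (auto simp: fun_eq_iff)
    then have *: "sem N (clear e I) ?s x \<longleftrightarrow> x = s(I := [], Aux := rev (take i l), X := drop i l)"
        for x
      using sem_clear[of ?s I "k - i" N e] assms by auto
    then show "sem N (off e X) ?s x \<longleftrightarrow> i = length l \<and> x = s(I := [], Aux := rev (take i l), X :=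
        drop i l)"
      using assms i by (simp add: off_def *) auto
  qed
  then show ?thesis by auto
qed

text \<open>Equality and inequality need programs of their own, because the failure of a
  nondeterministic test cannot be turned into a success. Unequal counters are recognised by one
  being empty while the other is not.\<close>

definition compare :: "nat \<Rightarrow> bool \<Rightarrow> (reg, 'a symbol) cmd" where
  "compare e b = Seq (loops e (Seq (Pop I one) (Pop J one)))
     (if b then Seq (Empty I) (Empty J)
      else Choice (Seq (Pop I one) (Seq (Empty J) (clear e I)))
        (Seq (Pop J one) (Seq (Empty I) (clear e J))))"

lemma sem_compare:
  fixes s :: "'a mem"
  assumes "s I = unary m" "s J = unary n" "m \<le> N ^ Suc e" "n \<le> N ^ Suc e"
  shows "sem N (compare e b) s x \<longleftrightarrow> (m = n \<longleftrightarrow> b) \<and> x = s(I := [], J := [])"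
proof -
  let ?t = "\<lambda>i. s(I := unary (m - i), J := unary (n - i))"
  have 1: "sem N (loops e (Seq (Pop I one) (Pop J one))) s x \<longleftrightarrow> (\<exists>i\<le>min m n. x = ?t i)" for x
  proof (rule sem_loops_chain)
    fix i x assume "i < min m n"
    then obtain a b where "m - i = Suc a" "n - i = Suc b" "m - Suc i = a" "n - Suc i = b"
      by (metis Suc_diff_Suc min_less_iff_conj)
    then show "sem N (Seq (Pop I one) (Pop J one)) (?t i) x \<longleftrightarrow> x = ?t (Suc i)"
      by simp
  next
    show "\<not> sem N (Seq (Pop I one) (Pop J one)) (?t (min m n)) x" for x
      by (cases "m \<le> n") auto
    show "min m n \<le> N ^ Suc e" using assms(3) by simp
    show "?t 0 = s" using assms(1,2) by (metis diff_zero fun_upd_triv)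
  qed
  show ?thesis
  proof (cases b)
    case True
    then show ?thesis by (auto simp: compare_def 1)
  next
    case False
    have cI: "sem N (clear e I) (s(J := l, I := unary k)) x \<longleftrightarrow> x = s(J := l, I := [])"
      if "k \<le> m" for k l x
      by (subst sem_clear[where m = k]) (use that assms in auto)
    have cJ: "sem N (clear e J) (s(I := l, J := unary k)) x \<longleftrightarrow> x = s(I := l, J := [])"
      if "k \<le> n" for k l x
      by (subst sem_clear[where m = k]) (use that assms in auto)
    have tw: "s(J := [], I := []) = s(I := [], J := [])" by (auto simp: fun_eq_iff)
    have *: "sem N (Choice (Seq (Pop I one) (Seq (Empty J) (clear e I)))
        (Seq (Pop J one) (Seq (Empty I) (clear e J)))) (?t i) x \<longleftrightarrow>
      (i = n \<and> n < m \<or> i = m \<and> m < n) \<and> x = s(I := [], J := [])" if "i \<le> min m n" for i x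
    proof -
      have "sem N (Seq (Pop I one) (Seq (Empty J) (clear e I))) (?t i) x \<longleftrightarrow>
        i = n \<and> n < m \<and> x = s(I := [], J := [])"
      proof (cases "m - i")
        case (Suc k)
        have "sem N (Seq (Pop I one) (Seq (Empty J) (clear e I))) (?t i) x \<longleftrightarrow>
          n - i = 0 \<and> sem N (clear e I) (s(J := unary (n - i), I := unary k)) x"
          by (auto simp: Suc)
        also have "\<dots> \<longleftrightarrow> n - i = 0 \<and> x = s(J := unary (n - i), I := [])"
          using cI[of k] Suc by simp
        finally show ?thesis using that Suc tw by auto
      qed (use that in auto)
      moreover have "sem N (Seq (Pop J one) (Seq (Empty I) (clear e J))) (?t i) x \<longleftrightarrow>
        i = m \<and> m < n \<and> x = s(I := [], J := [])"
      proof (cases "n - i")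
        case (Suc k)
        have "sem N (Seq (Pop J one) (Seq (Empty I) (clear e J))) (?t i) x \<longleftrightarrow>
          m - i = 0 \<and> sem N (clear e J) (s(I := unary (m - i), J := unary k)) x"
          by (auto simp: Suc)
        also have "\<dots> \<longleftrightarrow> m - i = 0 \<and> x = s(I := unary (m - i), J := [])"
          using cJ[of k] Suc by simp
        finally show ?thesis using that Suc by auto
      qed (use that in auto)
      ultimately show ?thesis unfolding sem.simps(5) by blast
    qed
    have "compare e b = Seq (loops e (Seq (Pop I one) (Pop J one)))
        (Choice (Seq (Pop I one) (Seq (Empty J) (clear e I)))
          (Seq (Pop J one) (Seq (Empty I) (clear e J))) :: (reg, 'a symbol) cmd)"
      using False by (simp add: compare_def)
    then have "sem N (compare e b) s x \<longleftrightarrow> (\<exists>i\<le>min m n.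
        sem N (Choice (Seq (Pop I one) (Seq (Empty J) (clear e I)))
          (Seq (Pop J one) (Seq (Empty I) (clear e J)))) (?t i) x)"
      by (simp only: sem.simps(4)[of N "loops e (Seq (Pop I one) (Pop J one))"] 1) blast
    also have "\<dots> \<longleftrightarrow> (\<exists>i\<le>min m n. (i = n \<and> n < m \<or> i = m \<and> m < n) \<and> x = s(I := [], J := []))"
      using * by blast
    also have "\<dots> \<longleftrightarrow> m \<noteq> n \<and> x = s(I := [], J := [])"
      by (auto simp: min_def neq_iff)
    finally show ?thesis using False by simp
  qed
qed

section \<open>Evaluation of first-order sentences\<close>

text \<open>All relations are ternary, so that a single storage layout serves them all; a binary
  relation is obtained by keeping one argument fixed.\<close>

datatype 'a fo =
    FRel nat nat nat nat
  | At nat nat 'a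
  | Past nat nat
  | FEq nat nat nat
  | FNot "'a fo"
  | FAnd "'a fo" "'a fo"
  | FAll nat "'a fo"

primrec eval :: "'a list \<Rightarrow> nat \<Rightarrow> (nat \<Rightarrow> nat \<Rightarrow> nat \<Rightarrow> nat \<Rightarrow> bool) \<Rightarrow> (nat \<Rightarrow> nat) \<Rightarrow> 'a fo \<Rightarrow> bool" where
  "eval w M R \<rho> (FRel r a b c) \<longleftrightarrow> R r (\<rho> a) (\<rho> b) (\<rho> c)"
| "eval w M R \<rho> (At v k a) \<longleftrightarrow> \<rho> v + k < length w \<and> w ! (\<rho> v + k) = a"
| "eval w M R \<rho> (Past v k) \<longleftrightarrow> length w \<le> \<rho> v + k"
| "eval w M R \<rho> (FEq u k v) \<longleftrightarrow> \<rho> u + k = \<rho> v"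
| "eval w M R \<rho> (FNot \<phi>) \<longleftrightarrow> \<not> eval w M R \<rho> \<phi>"
| "eval w M R \<rho> (FAnd \<phi> \<psi>) \<longleftrightarrow> eval w M R \<rho> \<phi> \<and> eval w M R \<rho> \<psi>"
| "eval w M R \<rho> (FAll v \<phi>) \<longleftrightarrow> (\<forall>x\<le>M. eval w M R (\<rho>(v := x)) \<phi>)"

primrec bound_vars :: "'a fo \<Rightarrow> nat set" where
  "bound_vars (FRel r a b c) = {}"
| "bound_vars (At v k a) = {}"
| "bound_vars (Past v k) = {}"
| "bound_vars (FEq u k v) = {}"
| "bound_vars (FNot \<phi>) = bound_vars \<phi>"
| "bound_vars (FAnd \<phi> \<psi>) = bound_vars \<phi> \<union> bound_vars \<psi>"
| "bound_vars (FAll v \<phi>) = insert v (bound_vars \<phi>)"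

text \<open>Evaluation expects the register of a variable to be empty when its quantifier is reached,
  so nested quantifiers must bind distinct variables.\<close>

primrec wf_fo :: "'a fo \<Rightarrow> bool" where
  "wf_fo (FRel r a b c) \<longleftrightarrow> True"
| "wf_fo (At v k a) \<longleftrightarrow> True"
| "wf_fo (Past v k) \<longleftrightarrow> True"
| "wf_fo (FEq u k v) \<longleftrightarrow> True"
| "wf_fo (FNot \<phi>) \<longleftrightarrow> wf_fo \<phi>"
| "wf_fo (FAnd \<phi> \<psi>) \<longleftrightarrow> wf_fo \<phi> \<and> wf_fo \<psi>"
| "wf_fo (FAll v \<phi>) \<longleftrightarrow> v \<noteq> 0 \<and> v \<notin> bound_vars \<phi> \<and> wf_fo \<phi>"

primrec rels :: "'a fo \<Rightarrow> nat" where
  "rels (FRel r a b c) = Suc r"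
| "rels (At v k a) = 0"
| "rels (Past v k) = 0"
| "rels (FEq u k v) = 0"
| "rels (FNot \<phi>) = rels \<phi>"
| "rels (FAnd \<phi> \<psi>) = max (rels \<phi>) (rels \<psi>)"
| "rels (FAll v \<phi>) = rels \<phi>"

primrec offset :: "'a fo \<Rightarrow> nat" where
  "offset (FRel r a b c) = 0"
| "offset (At v k a) = k"
| "offset (Past v k) = k"
| "offset (FEq u k v) = k"
| "offset (FNot \<phi>) = offset \<phi>"
| "offset (FAnd \<phi> \<psi>) = max (offset \<phi>) (offset \<psi>)"
| "offset (FAll v \<phi>) = offset \<phi>"

text \<open>Only finitely many values of \<open>R\<close> matter, so finite arrays of bits can stand
  in for it.\<close>

lemma eval_cong:
  assumes "\<And>r x y z. r < q \<Longrightarrow> x \<le> M \<Longrightarrow> y \<le> M \<Longrightarrow> z \<le> M \<Longrightarrow> R r x y z = R' r x y z"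
  shows "rels \<phi> \<le> q \<Longrightarrow> (\<And>v. \<rho> v \<le> M) \<Longrightarrow> eval w M R \<rho> \<phi> \<longleftrightarrow> eval w M R' \<rho> \<phi>"
proof (induction \<phi> arbitrary: \<rho>)
  case (FAll v \<phi>)
  have "eval w M R (\<rho>(v := x)) \<phi> \<longleftrightarrow> eval w M R' (\<rho>(v := x)) \<phi>" if "x \<le> M" for x
    by (rule FAll.IH) (use FAll.prems that in auto)
  then show ?case by simp
qed (use assms in auto)

section \<open>Programs that certify the truth value of a formula\<close>

abbreviation bits :: "'a symbol list" where
  "bits \<equiv> [Work 0, Work 1]"

definition locate :: "nat \<Rightarrow> nat \<Rightarrow> nat \<Rightarrow> nat \<Rightarrow> (reg, 'a symbol) cmd" where
  "locate e a b c = Seq (add e (Var a) I) (Seq (scale e)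
     (Seq (add e (Var b) I) (Seq (scale e) (add e (Var c) I))))"

definition read :: "nat \<Rightarrow> nat \<Rightarrow> nat \<Rightarrow> 'a :: finite symbol \<Rightarrow> (reg, 'a symbol) cmd" where
  "read e v k b = Seq (add e (Var v) I) (Seq (incr k I) (look e In letters (hit In b)))"

definition read_off :: "nat \<Rightarrow> nat \<Rightarrow> nat \<Rightarrow> (reg, 'a :: finite symbol) cmd" where
  "read_off e v k = Seq (add e (Var v) I) (Seq (incr k I) (look e In letters (off e In)))"

text \<open>A nondeterministic program can confirm but not refute. Therefore the truth value
  \<open>p\<close> to be confirmed is a parameter: negation flips it, conjunction becomes a choice
  when \<open>p\<close> is false, and a universal quantifier becomes the guess of a
  counterexample.\<close>

primrec chk :: "nat \<Rightarrow> bool \<Rightarrow> 'a :: finite fo \<Rightarrow> (reg, 'a symbol) cmd" where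
  "chk e p (FRel r a b c) = Seq (locate e a b c)
     (look e (Arr r) bits (hit (Arr r) (Work (if p then 1 else 0))))"
| "chk e p (At v k a) = (if p then read e v k (Letter a)
     else pick letters (\<lambda>b. if b = Letter a then read_off e v k else read e v k b))"
| "chk e p (Past v k) = (if p then read_off e v k else pick letters (read e v k))"
| "chk e p (FEq u k v) = Seq (add e (Var u) I) (Seq (incr k I)
     (Seq (add e (Var v) J) (compare e p)))"
| "chk e p (FNot \<phi>) = chk e (\<not> p) \<phi>"
| "chk e p (FAnd \<phi> \<psi>) = (if p then Seq (chk e p \<phi>) (chk e p \<psi>) else Choice (chk e p \<phi>) (chk e p \<psi>))"
| "chk e p (FAll v \<phi>) = Seq (add e (Var 0) (Var v)) (if p
     then Seq (chk e p \<phi>) (Seq (loops e (Seq (Pop (Var v) one) (chk e p \<phi>))) (Empty (Var v)))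
     else Seq (loops e (Pop (Var v) one)) (Seq (chk e p \<phi>) (clear e (Var v))))"

definition mem :: "'a list \<Rightarrow> (nat \<Rightarrow> 'a symbol list) \<Rightarrow> (nat \<Rightarrow> nat) \<Rightarrow> 'a mem" where
  "mem w A \<rho> = (\<lambda>r. case r of In \<Rightarrow> map Letter w | Aux \<Rightarrow> [] | I \<Rightarrow> [] | J \<Rightarrow> []
     | Var v \<Rightarrow> unary (\<rho> v) | Arr r \<Rightarrow> A r)"

lemma mem_simps [simp]:
  "mem w A \<rho> In = map Letter w" "mem w A \<rho> Aux = []" "mem w A \<rho> I = []" "mem w A \<rho> J = []"
  "mem w A \<rho> (Var v) = unary (\<rho> v)" "mem w A \<rho> (Arr r) = A r"
  by (simp_all add: mem_def)

lemma mem_upd: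
  "(mem w A \<rho>)(Var v := unary n) = mem w A (\<rho>(v := n))"
  "(mem w A \<rho>)(Arr r := l) = mem w (A(r := l)) \<rho>"
  by (auto simp: mem_def fun_eq_iff split: reg.splits)

lemma mem_restore: "(mem w A \<rho>)(I := l, I := []) = mem w A \<rho>"
  "(mem w A \<rho>)(I := []) = mem w A \<rho>"
  by (auto simp: mem_def fun_eq_iff)

text \<open>The arguments are the digits of a number in base M + 1, which \<open>locate\<close>
  computes by Horner's rule.\<close>

definition cell :: "nat \<Rightarrow> nat \<Rightarrow> nat \<Rightarrow> nat \<Rightarrow> nat" where
  "cell M x y z = (x * Suc M + y) * Suc M + z"

lemma cell_less: "x \<le> M \<Longrightarrow> y \<le> M \<Longrightarrow> z \<le> M \<Longrightarrow> cell M x y z < Suc M ^ 3"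
proof -
  assume xyz: "x \<le> M" "y \<le> M" "z \<le> M"
  have "x * Suc M + y < Suc M * Suc M"
    using mult_le_mono1[OF xyz(1), of "Suc M"] xyz(2) by (simp add: le_less_trans)
  then have "Suc (x * Suc M + y) * Suc M \<le> Suc M * Suc M * Suc M"
    by (intro mult_le_mono1) simp
  then show ?thesis using xyz(3) by (simp add: cell_def power3_eq_cube)
qed

lemma sem_Seq_det:
  "(\<And>x. sem N c s x \<longleftrightarrow> x = s') \<Longrightarrow> sem N (Seq c d) s x \<longleftrightarrow> sem N d s' x"
  by simp

lemma sem_Seq_ex:
  "(\<And>x. sem N c s x \<longleftrightarrow> (\<exists>y. P y \<and> x = f y)) \<Longrightarrow> sem N (Seq c d) s x \<longleftrightarrow> (\<exists>y. P y \<and> sem N d (f y) x)"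
  by auto

text \<open>The three caps cover the longest walks that occur: along the array of a relation, along
  the input word, and along an index made of a domain element and an offset of at most
  \<open>K\<close>.\<close>

locale evaluation =
  fixes N e M :: nat and w :: "'a :: finite list" and A :: "nat \<Rightarrow> 'a symbol list" and q K :: nat
  assumes cap: "Suc M ^ 3 \<le> N ^ Suc e" "length w \<le> N ^ Suc e" "M + K \<le> N ^ Suc e"
    and arrays: "\<And>r. r < q \<Longrightarrow> length (A r) = Suc M ^ 3 \<and> set (A r) \<subseteq> {Work 0, Work 1}"
begin

definition R :: "nat \<Rightarrow> nat \<Rightarrow> nat \<Rightarrow> nat \<Rightarrow> bool" where
  "R r x y z \<longleftrightarrow> A r ! cell M x y z = Work 1"

lemma sem_locate:
  assumes "\<And>v. \<rho> v \<le> M" "\<rho> 0 = M"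
  shows "sem N (locate e a b c) (mem w A \<rho>) x \<longleftrightarrow>
    x = (mem w A \<rho>)(I := unary (cell M (\<rho> a) (\<rho> b) (\<rho> c)))"
proof -
  let ?s = "mem w A \<rho>"
  have M: "M \<le> N ^ Suc e" using cap(3) by simp
  have le: "v \<le> M \<Longrightarrow> v \<le> N ^ Suc e" for v using M by simp
  have c: "cell M (\<rho> a) (\<rho> b) 0 \<le> N ^ Suc e"
    using cell_less[OF assms(1)[of a] assms(1)[of b], of 0] cap(1) by simp
  then have c1: "(\<rho> a * Suc M + \<rho> b) * Suc M \<le> N ^ Suc e" by (simp add: cell_def)
  have c2: "\<rho> a * Suc M \<le> N ^ Suc e"
    by (rule le_trans[OF _ c1]) simp
  have 1: "sem N (add e (Var v) I) (?s(I := unary k)) x \<longleftrightarrow> x = ?s(I := unary (k + \<rho> v))" for v k x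
    using sem_add[of "?s(I := unary k)" "Var v" "\<rho> v" I k N e x] le[OF assms(1)] by simp
  have 2: "sem N (scale e) (?s(I := unary k)) x \<longleftrightarrow> x = ?s(I := unary (k * Suc M))"
    if "k * Suc M \<le> N ^ Suc e" for k x
    using sem_scale[of "?s(I := unary k)" k M N e x] that M assms(2) by simp
  have s: "?s = ?s(I := unary 0)" using mem_restore(2)[of w A \<rho>] by simp
  have 3: "sem N (add e (Var a) I) ?s x \<longleftrightarrow> x = ?s(I := unary (\<rho> a))" for x
    using 1[of a 0] s by simp
  show ?thesis
    unfolding locate_def sem_Seq_det[OF 3] sem_Seq_det[OF 2[OF c2]] sem_Seq_det[OF 1]
      sem_Seq_det[OF 2[OF c1]] 1 cell_def ..
qed

lemma sem_load:
  assumes "\<And>v. \<rho> v \<le> M" "\<rho> 0 = M" "k \<le> K"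
  shows "sem N (Seq (add e (Var v) I) (Seq (incr k I) c)) (mem w A \<rho>) x \<longleftrightarrow>
    sem N c ((mem w A \<rho>)(I := unary (\<rho> v + k))) x"
proof -
  let ?s = "mem w A \<rho>"
  have "\<rho> v \<le> N ^ Suc e" using assms(1)[of v] cap(3) by simp
  then have 1: "sem N (add e (Var v) I) ?s x \<longleftrightarrow> x = ?s(I := unary (\<rho> v))" for x
    using sem_add[of ?s "Var v" "\<rho> v" I 0 N e x] by simp
  have 2: "sem N (incr k I) (?s(I := unary (\<rho> v))) x \<longleftrightarrow> x = ?s(I := unary (\<rho> v + k))" for x
    using sem_incr[of "?s(I := unary (\<rho> v))" I "\<rho> v" N k x] by simp
  show ?thesis
    unfolding sem_Seq_det[OF 1] sem_Seq_det[OF 2] ..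
qed

lemma sem_read:
  assumes "\<And>v. \<rho> v \<le> M" "\<rho> 0 = M" "k \<le> K"
  shows "sem N (read e v k b) (mem w A \<rho>) x \<longleftrightarrow>
      x = mem w A \<rho> \<and> \<rho> v + k < length w \<and> Letter (w ! (\<rho> v + k)) = b"
    "sem N (read_off e v k) (mem w A \<rho>) x \<longleftrightarrow> x = mem w A \<rho> \<and> length w \<le> \<rho> v + k"
proof -
  let ?s = "(mem w A \<rho>)(I := unary (\<rho> v + k))"
  have le: "\<rho> v + k \<le> N ^ Suc e" using assms(1)[of v] assms(3) cap(3) by simp
  show "sem N (read e v k b) (mem w A \<rho>) x \<longleftrightarrow>
      x = mem w A \<rho> \<and> \<rho> v + k < length w \<and> Letter (w ! (\<rho> v + k)) = b"
    unfolding read_def sem_load[of \<rho> k, OF assms]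
    by (subst sem_look_hit[where k = "\<rho> v + k" and l = "map Letter w"])
      (use le cap(2) in \<open>auto simp: mem_restore simp del: power_Suc\<close>)
  show "sem N (read_off e v k) (mem w A \<rho>) x \<longleftrightarrow> x = mem w A \<rho> \<and> length w \<le> \<rho> v + k"
    unfolding read_off_def sem_load[of \<rho> k, OF assms]
    by (subst sem_look_off[where k = "\<rho> v + k" and l = "map Letter w"])
      (use le cap(2) in \<open>auto simp: mem_restore simp del: power_Suc\<close>)
qed

lemma sem_countdown:
  assumes "\<And>y x. y \<le> m \<Longrightarrow> sem N c (mem w A (\<rho>(v := y))) x \<longleftrightarrow> x = mem w A (\<rho>(v := y)) \<and> Q y"
  shows "k \<le> m \<Longrightarrow> (sem N (Seq (Pop (Var v) one) c) ^^ k) (mem w A (\<rho>(v := m))) x \<longleftrightarrow>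
    x = mem w A (\<rho>(v := m - k)) \<and> (\<forall>y<m. m - k \<le> y \<longrightarrow> Q y)"
proof (induction k arbitrary: x)
  case (Suc k)
  let ?c = "Seq (Pop (Var v) one) c"
  obtain j where j: "m - k = Suc j" "m - Suc k = j" "j \<le> m" using Suc.prems
    by (metis Suc_diff_le diff_Suc_Suc diff_le_self)
  have "(sem N ?c ^^ Suc k) (mem w A (\<rho>(v := m))) x \<longleftrightarrow>
      (\<forall>y<m. m - k \<le> y \<longrightarrow> Q y) \<and> sem N ?c (mem w A (\<rho>(v := m - k))) x"
    unfolding relpowp.simps(2) relcompp_apply Suc.IH[OF Suc_leD[OF Suc.prems]] by blast
  also have "sem N ?c (mem w A (\<rho>(v := m - k))) x \<longleftrightarrow>
      sem N c (mem w A (\<rho>(v := j))) x"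
    by (simp add: j mem_upd)
  also have "\<dots> \<longleftrightarrow> x = mem w A (\<rho>(v := j)) \<and> Q j" using assms[OF j(3)] .
  also have "(\<forall>y<m. m - k \<le> y \<longrightarrow> Q y) \<and> x = mem w A (\<rho>(v := j)) \<and> Q j \<longleftrightarrow>
      x = mem w A (\<rho>(v := m - Suc k)) \<and> (\<forall>y<m. m - Suc k \<le> y \<longrightarrow> Q y)"
  proof -
    have "j < m" using j by simp
    then have "(\<forall>y<m. j \<le> y \<longrightarrow> Q y) \<longleftrightarrow> Q j \<and> (\<forall>y<m. Suc j \<le> y \<longrightarrow> Q y)"
      by (auto simp: le_less Suc_le_eq)
    then show ?thesis unfolding j by blast
  qed
  finally show ?case .
qed auto

lemma sem_countdown_all:
  assumes "\<And>y x. y \<le> m \<Longrightarrow> sem N c (mem w A (\<rho>(v := y))) x \<longleftrightarrow> x = mem w A (\<rho>(v := y)) \<and> Q y"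
    and "m \<le> N ^ Suc e"
  shows "sem N (Seq (loops e (Seq (Pop (Var v) one) c)) (Empty (Var v))) (mem w A (\<rho>(v := m))) x \<longleftrightarrow>
    x = mem w A (\<rho>(v := 0)) \<and> (\<forall>y<m. Q y)"
proof -
  let ?c = "Seq (Pop (Var v) one) c"
  note c = sem_countdown[where m = m and Q = Q, OF assms(1)]
  \<comment> \<open>After \<open>m\<close> rounds the register is empty and its \<open>Pop\<close>
    fails.\<close>
  have no: "\<not> (sem N ?c ^^ k) (mem w A (\<rho>(v := m))) y" if "m < k" for k y
  proof
    assume "(sem N ?c ^^ k) (mem w A (\<rho>(v := m))) y"
    then have "(sem N ?c ^^ (Suc m + (k - Suc m))) (mem w A (\<rho>(v := m))) y" using that by simp
    then obtain z where "(sem N ?c ^^ Suc m) (mem w A (\<rho>(v := m))) z"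
      unfolding relpowp_add by blast
    then obtain z' where "(sem N ?c ^^ m) (mem w A (\<rho>(v := m))) z'" "sem N ?c z' z" by auto
    then show False using c[of m z'] by simp
  qed
  show ?thesis (is "?L \<longleftrightarrow> ?R")
  proof
    assume ?L
    then obtain k where k: "(sem N ?c ^^ k) (mem w A (\<rho>(v := m))) x" "x (Var v) = []"
      by (auto simp: sem_loops simp del: power_Suc)
    then have "k \<le> m" using no leI by blast
    with c[of k x] k have "x = mem w A (\<rho>(v := m - k))" "\<forall>y<m. m - k \<le> y \<longrightarrow> Q y" by auto
    with k(2) show ?R by simp
  next
    assume ?R
    then have "(sem N ?c ^^ m) (mem w A (\<rho>(v := m))) x" using c[of m x] by simp
    then show ?L using \<open>?R\<close> assms(2) by (auto simp: sem_loops simp del: power_Suc)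
  qed
qed

lemma sem_chk:
  assumes "wf_fo \<phi>" "rels \<phi> \<le> q" "offset \<phi> \<le> K" "\<And>v. \<rho> v \<le> M" "\<rho> 0 = M"
    "\<And>v. v \<in> bound_vars \<phi> \<Longrightarrow> \<rho> v = 0"
  shows "sem N (chk e p \<phi>) (mem w A \<rho>) x \<longleftrightarrow> x = mem w A \<rho> \<and> (eval w M R \<rho> \<phi> \<longleftrightarrow> p)"
  using assms
proof (induction \<phi> arbitrary: \<rho> p x)
  case (FRel r a b c)
  let ?k = "cell M (\<rho> a) (\<rho> b) (\<rho> c)"
  let ?s = "(mem w A \<rho>)(I := unary ?k)"
  have k: "?k < length (A r)"
    using arrays[of r] FRel.prems cell_less[of "\<rho> a" M "\<rho> b" "\<rho> c"] by simp
  have "set (A r) \<subseteq> {Work 0, Work 1}" using arrays[of r] FRel.prems(2) by simp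
  then have "A r ! ?k \<in> {Work 0, Work 1}" using nth_mem[OF k] by blast
  then have p: "A r ! ?k = Work (if p then 1 else 0) \<longleftrightarrow> (R r (\<rho> a) (\<rho> b) (\<rho> c) \<longleftrightarrow> p)"
    by (auto simp: R_def)
  have "sem N (look e (Arr r) bits (hit (Arr r) (Work (if p then 1 else 0)))) ?s x \<longleftrightarrow>
      ?k < length (A r) \<and> A r ! ?k = Work (if p then 1 else 0) \<and> x = ?s(I := [])"
    by (rule sem_look_hit) (use arrays[of r] FRel.prems(2) k cap(1) in \<open>auto simp del: power_Suc\<close>)
  then show ?case
    using k p by (simp add: sem_locate[of \<rho>, OF FRel.prems(4,5)] mem_restore) blast
next
  case (At v k a)
  note rd = sem_read[of \<rho> k, OF At.prems(4,5)]
  have k: "k \<le> K" using At.prems by simp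
  show ?case
  proof (cases p)
    case True
    then show ?thesis using rd(1)[OF k] by auto
  next
    case False
    \<comment> \<open>The atom fails in one of two ways, which are offered as alternatives: another
      letter is found, or the position lies beyond the word.\<close>
    have "sem N (chk e p (At v k a)) (mem w A \<rho>) x \<longleftrightarrow>
       (\<exists>b. sem N (if b = a then read_off e v k else read e v k (Letter b)) (mem w A \<rho>) x)"
      using False by auto
    also have "\<dots> \<longleftrightarrow> x = mem w A \<rho> \<and> \<not> (\<rho> v + k < length w \<and> w ! (\<rho> v + k) = a)"
      by (cases "\<rho> v + k < length w") (auto simp: rd(1)[OF k] rd(2)[OF k])
    finally show ?thesis using False by simp
  qed
next
  case (Past v k)
  have k: "k \<le> K" using Past.prems by simp
  show ?case
    using sem_read[of \<rho> k, OF Past.prems(4,5) k] by (auto simp: not_le)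
next
  case (FEq u k v)
  let ?s = "(mem w A \<rho>)(I := unary (\<rho> u + k))"
  have k: "k \<le> K" using FEq.prems by simp
  have le: "\<rho> u + k \<le> N ^ Suc e" "\<rho> v \<le> N ^ Suc e"
    using FEq.prems(4)[of u] FEq.prems(4)[of v] k cap(3) by simp_all
  have 1: "sem N (add e (Var v) J) ?s y \<longleftrightarrow> y = ?s(J := unary (\<rho> v))" for y
    using sem_add[of ?s "Var v" "\<rho> v" J 0 N e y] le by simp
  have 2: "sem N (compare e p) (?s(J := unary (\<rho> v))) x \<longleftrightarrow>
      (\<rho> u + k = \<rho> v \<longleftrightarrow> p) \<and> x = ?s(J := unary (\<rho> v), I := [], J := [])"
    by (rule sem_compare) (use le in simp_all)
  have 3: "?s(J := unary (\<rho> v), I := [], J := []) = mem w A \<rho>"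
    by (auto simp: fun_eq_iff mem_def)
  show ?case
    unfolding chk.simps sem_load[of \<rho> k, OF FEq.prems(4,5) k] sem_Seq_det[OF 1] 2 3
    by auto
next
  case (FNot \<phi>)
  then show ?case by (cases p) simp_all
next
  case (FAnd \<phi> \<psi>)
  have 1: "sem N (chk e p \<phi>) (mem w A \<rho>) x \<longleftrightarrow> x = mem w A \<rho> \<and> (eval w M R \<rho> \<phi> \<longleftrightarrow> p)" for p x
    by (rule FAnd.IH(1)) (use FAnd.prems in auto)
  have 2: "sem N (chk e p \<psi>) (mem w A \<rho>) x \<longleftrightarrow> x = mem w A \<rho> \<and> (eval w M R \<rho> \<psi> \<longleftrightarrow> p)" for p x
    by (rule FAnd.IH(2)) (use FAnd.prems in auto)
  show ?case by (cases p) (auto simp: 1 2)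
next
  case (FAll v \<phi>)
  have v: "v \<noteq> 0" "\<rho> v = 0" "\<rho>(v := 0) = \<rho>" using FAll.prems by auto
  have M: "M \<le> N ^ Suc e" using cap(3) by simp
  have IH: "sem N (chk e p \<phi>) (mem w A (\<rho>(v := y))) x \<longleftrightarrow>
      x = mem w A (\<rho>(v := y)) \<and> (eval w M R (\<rho>(v := y)) \<phi> \<longleftrightarrow> p)" if "y \<le> M" for y p x
    by (rule FAll.IH) (use FAll.prems that v in auto)
  have 1: "sem N (add e (Var 0) (Var v)) (mem w A \<rho>) y \<longleftrightarrow> y = mem w A (\<rho>(v := M))" for y
    using sem_add[of "mem w A \<rho>" "Var 0" M "Var v" 0 N e y] FAll.prems(5) v M by (simp add: mem_upd)
  show ?case
  proof (cases p)
    case True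
    \<comment> \<open>The value M is checked before the loop and the smaller values after each pop.
      The final test ensures that the count went down to 0, and it leaves the register of the bound
      variable empty as it was found.\<close>
    have 2: "sem N (Seq (loops e (Seq (Pop (Var v) one) (chk e True \<phi>))) (Empty (Var v))) (mem w A
        (\<rho>(v := M))) x \<longleftrightarrow>
      x = mem w A (\<rho>(v := 0)) \<and> (\<forall>y<M. eval w M R (\<rho>(v := y)) \<phi>)"
      by (rule sem_countdown_all) (use IH[of _ True] M in auto)
    have "sem N (chk e p (FAll v \<phi>)) (mem w A \<rho>) x \<longleftrightarrow> eval w M R (\<rho>(v := M)) \<phi> \<and>
       sem N (Seq (loops e (Seq (Pop (Var v) one) (chk e True \<phi>))) (Empty (Var v))) (mem w A
           (\<rho>(v := M))) x"
      using True IH[of M True] unfolding chk.simps sem.simps(4)[of N "add e (Var 0) (Var v)"] 1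
      by (simp only: if_True simp_thms sem.simps(4)[of N "chk e True \<phi>"] ex_simps order_refl) blast
    also have "\<dots> \<longleftrightarrow> x = mem w A \<rho> \<and> (\<forall>y\<le>M. eval w M R (\<rho>(v := y)) \<phi>)"
      unfolding 2 v(3) by (auto simp: le_less)
    finally show ?thesis using True by simp
  next
    case False
    have 2: "sem N (loops e (Pop (Var v) one)) (mem w A (\<rho>(v := M))) x \<longleftrightarrow>
        (\<exists>y\<le>M. x = mem w A (\<rho>(v := y)))" for x
      using sem_loops_Pop[of "mem w A (\<rho>(v := M))" "Var v" M N e x] M by (simp add: mem_upd)
    have 3: "sem N (clear e (Var v)) (mem w A (\<rho>(v := y))) x \<longleftrightarrow> x = mem w A \<rho>" if "y \<le> M" for y x
      using sem_clear[of "mem w A (\<rho>(v := y))" "Var v" y N e x] M that v(3)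
        mem_upd(1)[of w A "\<rho>(v := y)" v 0] by simp
    have eq: "chk e p (FAll v \<phi>) = Seq (add e (Var 0) (Var v)) (Seq (loops e (Pop (Var v) one))
        (Seq (chk e False \<phi>) (clear e (Var v))))"
      using False by simp
    have "sem N (chk e p (FAll v \<phi>)) (mem w A \<rho>) x \<longleftrightarrow> (\<exists>y\<le>M. \<exists>z.
       sem N (chk e False \<phi>) (mem w A (\<rho>(v := y))) z \<and> sem N (clear e (Var v)) z x)"
      unfolding eq sem_Seq_det[OF 1] sem_Seq_ex[OF 2] sem.simps(4)[of N "chk e False \<phi>"] ..
    also have "\<dots> \<longleftrightarrow> x = mem w A \<rho> \<and> (\<exists>y\<le>M. \<not> eval w M R (\<rho>(v := y)) \<phi>)"
    proof -
      have "(\<exists>z. sem N (chk e False \<phi>) (mem w A (\<rho>(v := y))) z \<and> sem N (clear e (Var v)) z x) \<longleftrightarrow>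
        x = mem w A \<rho> \<and> \<not> eval w M R (\<rho>(v := y)) \<phi>" if "y \<le> M" for y
        unfolding IH[OF that] using 3[OF that, of x] by metis
      then show ?thesis by metis
    qed
    finally show ?thesis using False by simp
  qed
qed

end


lemma syms_loops [simp]: "syms (loops e c) = syms c"
  by (induction e) auto

lemma syms_incr: "b \<in> syms (incr k X) \<Longrightarrow> b = one"
  by (induction k) auto

lemma syms_look:
  "S \<noteq> [] \<Longrightarrow> syms (look e X S c) = insert one (set S) \<union> syms c"
  by (auto simp: look_def syms_pick)

lemma Blank_chk: "Blank \<notin> syms (chk e p \<phi>)"
proof (induction \<phi> arbitrary: p)
  case (FRel r a b c)
  show ?case
    by (simp add: locate_def scale_def add_def drain_def syms_look hit_def)
next
  case (At v k a)
  have "b \<in> range Letter \<Longrightarrow> Blank \<notin> syms (read e v k b)" "Blank \<notin> syms (read_off e v k)"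
    for b :: "'a symbol"
    by (auto simp: read_def read_off_def add_def drain_def clear_def syms_look hit_def off_def
        dest!: syms_incr)
  then show ?case by (auto simp: syms_pick)
next
  case (Past v k)
  have "b \<in> range Letter \<Longrightarrow> Blank \<notin> syms (read e v k b)" "Blank \<notin> syms (read_off e v k)"
    for b :: "'a symbol"
    by (auto simp: read_def read_off_def add_def drain_def clear_def syms_look hit_def off_def
        dest!: syms_incr)
  then show ?case by (auto simp: syms_pick)
next
  case (FEq u k v)
  show ?case
    by (auto simp: add_def drain_def clear_def compare_def dest!: syms_incr)
qed (auto simp: add_def drain_def clear_def)

text \<open>\<open>I\<close> is raised from 1 to (M + 1)^3, the size of the table of a ternary
  relation, and then used up while one arbitrary bit is pushed per unit.\<close>

definition guess :: "nat \<Rightarrow> nat \<Rightarrow> (reg, 'a symbol) cmd" where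
  "guess e r = Seq (Push I one) (Seq (scale e) (Seq (scale e) (Seq (scale e)
     (Seq (loops e (Seq (Pop I one) (pick bits (Push (Arr r))))) (Empty I)))))"

primrec guesses :: "nat \<Rightarrow> nat \<Rightarrow> (reg, 'a symbol) cmd \<Rightarrow> (reg, 'a symbol) cmd" where
  "guesses e 0 c = c"
| "guesses e (Suc r) c = Seq (guess e r) (guesses e r c)"

lemma sem_guess_power:
  fixes s :: "'a mem"
  shows "(sem N (Seq (Pop I one) (pick bits (Push (Arr r)))) ^^ k) (s(I := unary m, Arr r :=
      [])) x \<longleftrightarrow>
    k \<le> m \<and> (\<exists>l. length l = k \<and> set l \<subseteq> {Work 0, Work 1} \<and> x = s(I := unary (m - k), Arr r := l))"
proof (induction k arbitrary: x)
  case (Suc k)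
  let ?c = "Seq (Pop I one) (pick bits (Push (Arr r)))"
  have c: "sem N ?c (s(I := unary i, Arr r := l)) x \<longleftrightarrow>
      (\<exists>b\<in>{Work 0, Work 1}. i = Suc (i - 1) \<and> x = s(I := unary (i - 1), Arr r := b # l))" for i l x
    by (cases i) auto
  have "(sem N ?c ^^ Suc k) (s(I := unary m, Arr r := [])) x \<longleftrightarrow>
    k \<le> m \<and> (\<exists>l. length l = k \<and> set l \<subseteq> {Work 0, Work 1} \<and> sem N ?c (s(I :=
        unary (m - k), Arr r := l)) x)"
    unfolding relpowp.simps(2) relcompp_apply Suc by blast
  also have "\<dots> \<longleftrightarrow> Suc k \<le> m \<and> (\<exists>l. length l = Suc k \<and> set l \<subseteq> {Work 0, Work 1} \<and>
      x = s(I := unary (m - Suc k), Arr r := l))" (is "?L \<longleftrightarrow> ?R")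
  proof
    assume ?L
    then obtain l b where lb: "length l = k" "set l \<subseteq> {Work 0, Work 1}" "b \<in> {Work 0, Work 1}"
      "m - k = Suc (m - k - 1)" "x = s(I := unary (m - k - 1), Arr r := b # l)"
      unfolding c by blast
    then have "Suc k \<le> m" "m - k - 1 = m - Suc k" by simp_all
    then show ?R using lb by (intro conjI exI[of _ "b # l"]) auto
  next
    assume R: ?R
    then obtain l where l: "length l = Suc k" "set l \<subseteq> {Work 0, Work 1}"
      "x = s(I := unary (m - Suc k), Arr r := l)" by blast
    then obtain b l' where b: "l = b # l'" by (cases l) auto
    have "Suc k \<le> m" using R by blast
    then have "k \<le> m" "m - k = Suc (m - k - 1)" "m - k - 1 = m - Suc k" by linarith+
    then show ?L unfolding c using l b by (intro conjI exI[of _ l']) auto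
  qed
  finally show ?case .
qed auto

lemma sem_guess:
  assumes "A r = []" "\<rho> 0 = M" "Suc M ^ 3 \<le> N ^ Suc e"
  shows "sem N (guess e r) (mem w A \<rho>) x \<longleftrightarrow>
    (\<exists>l. length l = Suc M ^ 3 \<and> set l \<subseteq> {Work 0, Work 1} \<and> x = mem w (A(r := l)) \<rho>)"
proof -
  let ?s = "mem w A \<rho>"
  let ?c = "Seq (Pop I one) (pick bits (Push (Arr r)))"
  have m: "1 * Suc M * Suc M * Suc M = Suc M ^ 3" by (simp add: power3_eq_cube)
  have le3: "1 * Suc M * Suc M * Suc M \<le> N ^ Suc e" unfolding m by (rule assms(3))
  have le2: "1 * Suc M * Suc M \<le> N ^ Suc e" by (rule le_trans[OF _ le3]) simp
  have le1: "1 * Suc M \<le> N ^ Suc e" by (rule le_trans[OF _ le2]) simp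
  have 1: "sem N (Push I one) ?s x \<longleftrightarrow> x = ?s(I := unary 1)" for x by simp
  have 2: "sem N (scale e) (?s(I := unary k)) x \<longleftrightarrow> x = ?s(I := unary (k * Suc M))"
    if "k * Suc M \<le> N ^ Suc e" for k x
    using sem_scale[of "?s(I := unary k)" k M N e x] that le1 assms(2) by simp
  let ?m = "Suc M ^ 3"
  have s: "?s(I := unary ?m) = ?s(I := unary ?m, Arr r := [])"
    using assms(1) by (auto simp: fun_eq_iff mem_def)
  have "sem N (guess e r) ?s x \<longleftrightarrow> sem N (Seq (loops e ?c) (Empty I)) (?s(I := unary ?m)) x"
    unfolding guess_def sem_Seq_det[OF 1] sem_Seq_det[OF 2[OF le1]]
      sem_Seq_det[OF 2[OF le2]] sem_Seq_det[OF 2[OF le3]] m ..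
  also have "\<dots> \<longleftrightarrow> (\<exists>l. length l = ?m \<and> set l \<subseteq> {Work 0, Work 1} \<and> x = ?s(I := [], Arr r := l))"
    (is "?L \<longleftrightarrow> ?R")
  proof -
    have loop: "sem N (loops e ?c) (?s(I := unary ?m)) t \<longleftrightarrow> (\<exists>k\<le>N ^ Suc e. k \<le> ?m \<and>
      (\<exists>l. length l = k \<and> set l \<subseteq> {Work 0, Work 1} \<and> t = ?s(I := unary (?m - k), Arr r :=
          l)))" for t
      by (subst s) (simp only: sem_loops sem_guess_power)
    show ?thesis
    proof
      assume ?L
      then have "sem N (loops e ?c) (?s(I := unary ?m)) x" and xI: "x I = []"
        unfolding sem.simps(4)[of N "loops e ?c"] sem.simps(3) by auto
      then obtain k l where kl: "k \<le> ?m" "length l = k" "set l \<subseteq> {Work 0, Work 1}"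
        "x = ?s(I := unary (?m - k), Arr r := l)"
        unfolding loop by blast
      from kl(4) have "x I = unary (?m - k)" by simp
      with xI kl(1) have "k = ?m" by simp
      with kl show ?R by (intro exI[of _ l]) simp
    next
      assume ?R
      then obtain l where l: "length l = ?m" "set l \<subseteq> {Work 0, Work 1}" "x = ?s(I := [], Arr r :=
          l)"
        by blast
      then have "sem N (loops e ?c) (?s(I := unary ?m)) x"
        unfolding loop using assms(3) by (intro exI[of _ ?m] exI[of _ l] conjI) simp_all
      then show ?L unfolding sem.simps(4)[of N "loops e ?c"] sem.simps(3) using l(3)
        by (intro exI[of _ x]) simp
    qed
  qed
  also have "\<dots> \<longleftrightarrow> (\<exists>l. length l = Suc M ^ 3 \<and> set l \<subseteq> {Work 0, Work 1} \<and> x = mem w (A(r := l)) \<rho>)"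
    unfolding mem_restore(2) mem_upd ..
  finally show ?thesis .
qed

lemma sem_guesses:
  assumes "\<rho> 0 = M" "Suc M ^ 3 \<le> N ^ Suc e"
  shows "(\<And>r. r < q \<Longrightarrow> A r = []) \<Longrightarrow> sem N (guesses e q c) (mem w A \<rho>) x \<longleftrightarrow>
    (\<exists>A'. (\<forall>r<q. length (A' r) = Suc M ^ 3 \<and> set (A' r) \<subseteq> {Work 0, Work 1}) \<and>
      (\<forall>r\<ge>q. A' r = A r) \<and> sem N c (mem w A' \<rho>) x)"
proof (induction q arbitrary: A)
  case 0
  have "(\<forall>r. A' r = A r) \<longleftrightarrow> A' = A" for A' by auto
  then show ?case by simp
next
  case (Suc q)
  let ?good = "\<lambda>l. length l = Suc M ^ 3 \<and> set l \<subseteq> {Work 0, Work 1}"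
  have "sem N (guesses e (Suc q) c) (mem w A \<rho>) x \<longleftrightarrow>
    (\<exists>l. ?good l \<and> sem N (guesses e q c) (mem w (A(q := l)) \<rho>) x)"
    using sem_guess[where A = A and r = q and \<rho> = \<rho> and w = w, OF _ assms] Suc.prems[of q] by auto
  also have "\<dots> \<longleftrightarrow> (\<exists>l. ?good l \<and> (\<exists>A'. (\<forall>r<q. ?good (A' r)) \<and>
      (\<forall>r\<ge>q. A' r = (A(q := l)) r) \<and> sem N c (mem w A' \<rho>) x))"
  proof -
    have "sem N (guesses e q c) (mem w (A(q := l)) \<rho>) x \<longleftrightarrow> (\<exists>A'. (\<forall>r<q. ?good (A' r)) \<and>
      (\<forall>r\<ge>q. A' r = (A(q := l)) r) \<and> sem N c (mem w A' \<rho>) x)" for l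
      by (rule Suc.IH) (use Suc.prems in auto)
    then show ?thesis by simp
  qed
  also have "\<dots> \<longleftrightarrow> (\<exists>A'. (\<forall>r<Suc q. ?good (A' r)) \<and> (\<forall>r\<ge>Suc q. A' r = A r) \<and> sem N c (mem w A' \<rho>) x)"
    (is "?L \<longleftrightarrow> ?R")
  proof
    assume ?L
    then obtain l A' where "?good l" "\<forall>r<q. ?good (A' r)" "\<forall>r\<ge>q. A' r = (A(q := l)) r"
        "sem N c (mem w A' \<rho>) x"
      by blast
    then show ?R by (intro exI[of _ A']) (auto simp: less_Suc_eq)
  next
    assume ?R
    then obtain A' where A': "\<forall>r<Suc q. ?good (A' r)" "\<forall>r\<ge>Suc q. A' r = A r" "sem N c (mem w A' \<rho>)
        x"
      by blast
    then have "\<forall>r\<ge>q. A' r = (A(q := A' q)) r" by (auto simp: Suc_le_eq)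
    moreover have "?good (A' q)" "\<forall>r<q. ?good (A' r)" using A'(1) by simp_all
    ultimately show ?L using A'(3) by blast
  qed
  finally show ?case .
qed

lemma cell_inject:
  assumes "y \<le> M" "z \<le> M"
  shows "cell M x y z mod Suc M = z" "cell M x y z div Suc M mod Suc M = y"
    "cell M x y z div Suc M div Suc M = x"
proof -
  have 1: "cell M x y z div Suc M = x * Suc M + y" "cell M x y z mod Suc M = z"
    unfolding cell_def using assms by (simp_all del: mult_Suc_right)
  then show "cell M x y z mod Suc M = z" "cell M x y z div Suc M mod Suc M = y"
    "cell M x y z div Suc M div Suc M = x"
    using assms by (simp_all del: mult_Suc_right)
qed

text \<open>The easy direction of Fagin's theorem, for a domain whose size is itself guessed.\<close>

theorem fo_in_NP:
  fixes \<phi> :: "'a :: finite fo"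
  assumes "wf_fo \<phi>"
    and L: "\<And>w. w \<in> L \<longleftrightarrow>
      (\<exists>M\<le>(length w + 2) ^ Suc k. \<exists>R. eval w M R ((\<lambda>_. 0)(0 := M)) \<phi>)"
  shows "L \<in> NP"
proof -
  define K where "K = offset \<phi>"
  define q where "q = rels \<phi>"
  \<comment> \<open>From N \<ge> 2 and M \<le> N^(k+1) follows M + 1 \<le> N^(k+2). Hence an array
    has at most N^(3k+6) cells, and M + K is at most N^(k+2) times N^(K+1). The exponent
    \<open>Suc e\<close> exceeds both.\<close>
  define e where "e = 3 * k + K + 6"
  \<comment> \<open>No test follows the first loop, so it may stop after any number of rounds: this
    is the guess of M.\<close>
  define c :: "(reg, 'a symbol) cmd" where
    "c = Seq (loops k (Push (Var 0) one)) (guesses e q (chk e True \<phi>))"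
  have v0: "0 \<notin> bound_vars \<phi>" if "wf_fo \<phi>" for \<phi> :: "'a fo"
    using that by (induction \<phi>) auto
  have "(\<exists>x. sem (length w + 2) c (input In w) x) \<longleftrightarrow> w \<in> L" for w
  proof -
    define N where "N = length w + 2"
    have N: "2 \<le> N" "length w \<le> N" by (simp_all add: N_def)
    define \<rho> where "\<rho> M = (\<lambda>_ :: nat. 0)(0 := M)" for M :: nat
    have cap: "Suc M ^ 3 \<le> N ^ Suc e" "length w \<le> N ^ Suc e" "M + K \<le> N ^ Suc e"
      if "M \<le> N ^ Suc k" for M
    proof -
      have "1 \<le> N ^ Suc k" using N by simp
      then have "Suc M \<le> 2 * N ^ Suc k" using that by linarith
      also have "\<dots> \<le> N ^ (k + 2)" using N by simp
      finally have 1: "Suc M \<le> N ^ (k + 2)" .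
      then have "Suc M ^ 3 \<le> (N ^ (k + 2)) ^ 3" by (rule power_mono) simp
      also have "\<dots> = N ^ (3 * k + 6)"
        unfolding power_mult[symmetric] by (rule arg_cong[of _ _ "(^) N"]) simp
      also have "\<dots> \<le> N ^ Suc e" using N by (intro power_increasing) (auto simp: e_def)
      finally show "Suc M ^ 3 \<le> N ^ Suc e" .
      have "N ^ 1 \<le> N ^ Suc e" using N by (intro power_increasing) auto
      then show "length w \<le> N ^ Suc e" using N(2) by (simp only: power_one_right)
      have K: "Suc K \<le> N ^ Suc K"
        using less_exp[of "Suc K"] power_mono[of 2 N "Suc K"] N by linarith
      have "M + K \<le> Suc M * Suc K" by simp
      also have "\<dots> \<le> N ^ (k + 2) * N ^ Suc K" using 1 K by (rule mult_mono) auto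
      also have "\<dots> = N ^ (k + 2 + Suc K)" by (simp add: power_add)
      also have "\<dots> \<le> N ^ Suc e" using N by (intro power_increasing) (auto simp: e_def)
      finally show "M + K \<le> N ^ Suc e" .
    qed
    have start: "input In w = mem w (\<lambda>_. []) (\<rho> 0)"
      by (auto simp: input_def mem_def \<rho>_def fun_eq_iff split: reg.splits)
    have push: "(sem N (Push (Var 0) one) ^^ M) (mem w A (\<rho> 0)) x \<longleftrightarrow> x = mem w A (\<rho> M)" for A M x
    proof (induction M arbitrary: x)
      case (Suc M)
      have "(mem w A (\<rho> M))(Var 0 := one # mem w A (\<rho> M) (Var 0)) = mem w A (\<rho> (Suc M))"
        using mem_upd(1)[of w A "\<rho> M" 0 "Suc M"] by (simp add: \<rho>_def)
      then show ?case unfolding relpowp.simps(2) relcompp_apply Suc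
        by (simp only: sem.simps simp_thms)
    qed auto
    have loop: "sem N (loops k (Push (Var 0) one)) (mem w (\<lambda>_. []) (\<rho> 0)) x \<longleftrightarrow>
      (\<exists>M\<le>N ^ Suc k. x = mem w (\<lambda>_. []) (\<rho> M))" for x
      unfolding sem_loops push ..
    have "(\<exists>x. sem N c (input In w) x) \<longleftrightarrow>
      (\<exists>M\<le>N ^ Suc k. \<exists>x. sem N (guesses e q (chk e True \<phi>)) (mem w (\<lambda>_. []) (\<rho> M)) x)"
      unfolding c_def start sem_Seq_ex[OF loop] by blast
    also have "\<dots> \<longleftrightarrow> (\<exists>M\<le>N ^ Suc k. \<exists>R. eval w M R (\<rho> M) \<phi>)"
    proof (intro ex_cong1 conj_cong refl)
      fix M assume M: "M \<le> N ^ Suc k"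
      let ?good = "\<lambda>A :: nat \<Rightarrow> 'a symbol list. \<forall>r<q. length (A r) = Suc M ^ 3 \<and>
          set (A r) \<subseteq> {Work 0, Work 1}"
      let ?rel = "\<lambda>A r x y z. A r ! cell M x y z = Work 1"
      have chk: "sem N (chk e True \<phi>) (mem w A (\<rho> M)) x \<longleftrightarrow>
          x = mem w A (\<rho> M) \<and> eval w M (?rel A) (\<rho> M) \<phi>" if "?good A" for A x
      proof -
        interpret evaluation N e M w A q K
          using cap[OF M] that by unfold_locales auto
        have "R = ?rel A" by (intro ext) (simp add: R_def)
        moreover have "sem N (chk e True \<phi>) (mem w A (\<rho> M)) x \<longleftrightarrow>
            x = mem w A (\<rho> M) \<and> (eval w M R (\<rho> M) \<phi> \<longleftrightarrow> True)"
          by (rule sem_chk) (use assms(1) v0[OF assms(1)] in \<open>auto simp: q_def K_def \<rho>_def\<close>)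
        ultimately show ?thesis by simp
      qed
      have "(\<exists>x. sem N (guesses e q (chk e True \<phi>)) (mem w (\<lambda>_. []) (\<rho> M)) x) \<longleftrightarrow>
        (\<exists>A. ?good A \<and> (\<forall>r\<ge>q. A r = []) \<and> eval w M (?rel A) (\<rho> M) \<phi>)"
        (is "?L \<longleftrightarrow> ?R")
      proof -
        have guesses: "sem N (guesses e q (chk e True \<phi>)) (mem w (\<lambda>_. []) (\<rho> M)) x \<longleftrightarrow>
          (\<exists>A. ?good A \<and> (\<forall>r\<ge>q. A r = []) \<and> sem N (chk e True \<phi>) (mem w A (\<rho> M)) x)" for x
          by (rule sem_guesses) (use cap(1)[OF M] in \<open>simp_all add: \<rho>_def del: power_Suc\<close>)
        show ?thesis
        proof
          assume ?L
          then obtain x A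
              where A: "?good A" "\<forall>r\<ge>q. A r = []" "sem N (chk e True \<phi>) (mem w A (\<rho> M)) x"
            unfolding guesses by blast
          from A(3)[unfolded chk[OF A(1)]] A(1,2) show ?R
            by (intro exI[of _ A] conjI) simp_all
        next
          assume ?R
          then obtain A where A: "?good A" "\<forall>r\<ge>q. A r = []" "eval w M (?rel A) (\<rho> M) \<phi>" by blast
          then have "sem N (chk e True \<phi>) (mem w A (\<rho> M)) (mem w A (\<rho> M))"
            using chk[OF A(1)] by simp
          with A(1,2) show ?L unfolding guesses
            by (intro exI[of _ "mem w A (\<rho> M)"] exI[of _ A] conjI)
        qed
      qed
      also have "\<dots> \<longleftrightarrow> (\<exists>R. eval w M R (\<rho> M) \<phi>)"
      proof
        assume "\<exists>R. eval w M R (\<rho> M) \<phi>"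
        then obtain R where R: "eval w M R (\<rho> M) \<phi>" ..
        \<comment> \<open>The array lists the relation in the order of \<open>cell\<close>, whose
          digits are recovered by division with remainder.\<close>
        define A :: "nat \<Rightarrow> 'a symbol list"
            where "A r = (if r < q then map (\<lambda>i. Work (if R r (i div Suc M div Suc M)
          (i div Suc M mod Suc M) (i mod Suc M) then 1 else 0)) [0..<Suc M ^ 3] else [])" for r
        show "\<exists>A. ?good A \<and> (\<forall>r\<ge>q. A r = []) \<and> eval w M (?rel A) (\<rho> M) \<phi>"
        proof (intro exI[of _ A] conjI)
          show "?good A" by (simp add: A_def image_subset_iff del: power_Suc)
          show "\<forall>r\<ge>q. A r = []" by (simp add: A_def)
          have "?rel A r x y z \<longleftrightarrow> R r x y z" if "r < q" "x \<le> M" "y \<le> M" "z \<le> M" for r x y z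
            using that cell_less[OF that(2-4)] cell_inject[OF that(3,4), of x]
            by (simp add: A_def del: power_Suc)
          then show "eval w M (?rel A) (\<rho> M) \<phi>"
            using eval_cong[of q M "?rel A" R \<phi> "\<rho> M" w] R by (simp add: q_def \<rho>_def)
        qed
      qed blast
      finally show "(\<exists>x. sem N (guesses e q (chk e True \<phi>)) (mem w (\<lambda>_. []) (\<rho> M)) x) \<longleftrightarrow>
        (\<exists>R. eval w M R (\<rho> M) \<phi>)" .
    qed
    finally show ?thesis unfolding L N_def \<rho>_def .
  qed
  then have L_eq: "{w. \<exists>x. sem (length w + 2) c (input In w) x} = L" by auto
  have "Blank \<notin> syms c"
  proof -
    have "Blank \<notin> syms (guess e r :: (reg, 'a symbol) cmd)" for r
      by (auto simp: guess_def scale_def add_def drain_def)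
    then have "Blank \<notin> syms (guesses e q d)" if "Blank \<notin> syms d" for d :: "(reg, 'a symbol) cmd"
      using that by (induction q) auto
    then show ?thesis using Blank_chk[of e True \<phi>] by (simp add: c_def)
  qed
  from program_in_NP[OF this, of In] show ?thesis unfolding L_eq .
qed

section \<open>Small position models\<close>

fun shift :: "direction \<Rightarrow> int \<Rightarrow> int \<times> int \<Rightarrow> int \<times> int" where
  "shift North k (x, y) = (x, y + k)"
| "shift South k (x, y) = (x, y - k)"
| "shift East k (x, y) = (x + k, y)"
| "shift West k (x, y) = (x - k, y)"

lemma shift_simps [simp]: "shift d 0 p = p" "shift d i (shift d j p) = shift d (i + j) p"
  by (cases p; cases d; simp)+

lemma step_rel_shift: "(p, q) \<in> step_rel d \<longleftrightarrow> q = shift d 1 p"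
  by (cases p; cases d; auto)

lemma star_rel_shift: "(p, q) \<in> (step_rel d)\<^sup>* \<longleftrightarrow> (\<exists>n :: nat. q = shift d (int n) p)"
proof
  assume "(p, q) \<in> (step_rel d)\<^sup>*"
  then show "\<exists>n :: nat. q = shift d (int n) p"
  proof induction
    case base
    show ?case by (rule exI[of _ 0]) simp
  next
    case (step q r)
    then obtain n :: nat where "q = shift d (int n) p" by blast
    with step(2) show ?case
      by (intro exI[of _ "Suc n"]) (simp add: step_rel_shift)
  qed
next
  have "(p, shift d (int n) p) \<in> (step_rel d)\<^sup>*" for n
  proof (induction n)
    case (Suc n)
    have "(shift d (int n) p, shift d (int (Suc n)) p) \<in> step_rel d"
      by (simp add: step_rel_shift)
    with Suc show ?case by (rule rtrancl_into_rtrancl)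
  qed simp
  then show "\<exists>n :: nat. q = shift d (int n) p \<Longrightarrow> (p, q) \<in> (step_rel d)\<^sup>*" by blast
qed

lemma truth_Box:
  "truth P p (Box (Step d) \<phi>) \<longleftrightarrow> truth P (shift d 1 p) \<phi>"
  "truth P p (Box (Star d) \<phi>) \<longleftrightarrow> (\<forall>n :: nat. truth P (shift d (int n) p) \<phi>)"
  unfolding truth.simps(4) rel.simps step_rel_shift star_rel_shift by blast+

text \<open>The local form of the star. Away from the border this fixed-point equation is all that
  the tables check.\<close>

lemma truth_Star_unfold:
  "truth P p (Box (Star d) \<phi>) \<longleftrightarrow> truth P p \<phi> \<and> truth P (shift d 1 p) (Box (Star d) \<phi>)"
proof -
  have "(\<forall>n :: nat. truth P (shift d (int n) p) \<phi>) \<longleftrightarrow>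
      truth P (shift d (int 0) p) \<phi> \<and> (\<forall>n :: nat. truth P (shift d (int (Suc n)) p) \<phi>)"
    using not0_implies_Suc by metis
  then show ?thesis by (simp add: truth_Box add.commute del: truth.simps(4))
qed

declare truth.simps(4) [simp del]

lemma truth_cong:
  "(\<And>i. i \<in> agents \<phi> \<Longrightarrow> P i = Q i) \<Longrightarrow> truth P p \<phi> \<longleftrightarrow> truth Q p \<phi>"
proof (induction \<phi> arbitrary: p)
  case (Box \<alpha> \<phi>)
  then show ?case by (cases \<alpha>) (auto simp: truth_Box)
qed auto

text \<open>Restricting an arbitrary assignment to \<open>Agt\<close> makes it extensional, and
  truth is kept by \<open>truth_cong\<close>.\<close>

lemma satisfiable_iff:
  assumes "agents \<phi> \<subseteq> Agt"
  shows "satisfiable Agt \<phi> \<longleftrightarrow> (\<exists>P p. truth P p \<phi>)"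
proof
  assume "\<exists>P p. truth P p \<phi>"
  then obtain P p where "truth P p \<phi>" by blast
  then have "truth (restrict P Agt) p \<phi>"
    using truth_cong[of \<phi> "restrict P Agt" P p] assms by (metis restrict_apply subsetD)
  then show "satisfiable Agt \<phi>"
    unfolding satisfiable_def position_models_def
        by (intro bexI[of _ "restrict P Agt"] exI[of _ p]) auto
qed (auto simp: satisfiable_def)

primrec depth :: "'i fm \<Rightarrow> nat" where
  "depth (Here i) = 0"
| "depth (Neg \<phi>) = depth \<phi>"
| "depth (Conj \<phi> \<psi>) = max (depth \<phi>) (depth \<psi>)"
| "depth (Box \<alpha> \<phi>) = Suc (depth \<phi>)"

text \<open>Beyond distance \<open>d\<close> only the side is remembered, as the value d + 1 or its
  negative.\<close>

definition clip :: "nat \<Rightarrow> int \<Rightarrow> int" where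
  "clip d t = max (- int d - 1) (min (int d + 1) t)"

text \<open>A formula of depth \<open>d\<close> cannot distinguish points whose offsets from all agents agree up to
  the threshold \<open>d\<close>.\<close>

definition near :: "'i set \<Rightarrow> ('i \<Rightarrow> int) \<Rightarrow> ('i \<Rightarrow> int) \<Rightarrow> nat \<Rightarrow> int \<Rightarrow> int \<Rightarrow> bool" where
  "near S a b d x x' \<longleftrightarrow> (\<forall>i\<in>S. clip d (x - a i) = clip d (x' - b i))"

text \<open>The radius must detect whether two agents leave room for a point that is farther than d
  < D from both. This takes a distance of at least 2 * d + 2, and \<open>clip (2 * D + 1)\<close> is
  exact up to 2 * D + 1.\<close>

definition spread :: "'i set \<Rightarrow> ('i \<Rightarrow> int) \<Rightarrow> ('i \<Rightarrow> int) \<Rightarrow> nat \<Rightarrow> bool" where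
  "spread S a b D \<longleftrightarrow> (\<forall>i\<in>S. near S a b (2 * D + 1) (a i) (b i))"

section \<open>Back-and-forth on one axis\<close>

lemma clip_mono: "clip (Suc d) s = clip (Suc d) t \<Longrightarrow> clip d s = clip d t"
  by (auto simp: clip_def)

lemma clip_uminus: "clip d (- t) = - clip d t"
  by (auto simp: clip_def)

lemma near_mono: "near S a b (Suc d) x x' \<Longrightarrow> near S a b d x x'"
  by (auto simp: near_def intro: clip_mono)

lemma near_sym: "near S a b d x x' \<Longrightarrow> near S b a d x' x"
  by (auto simp: near_def)

lemma near_uminus: "near S (\<lambda>i. - a i) (\<lambda>i. - b i) d (- x) (- x') \<longleftrightarrow> near S a b d x x'"
proof -
  have "clip d (- s - - t) = - clip d (s - t)" for s t by (simp add: clip_def)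
  then show ?thesis by (simp only: near_def neg_equal_iff_equal)
qed

lemma spread_sym: "spread S a b D \<Longrightarrow> spread S b a D"
  by (auto simp: spread_def near_def)

lemma spread_uminus: "spread S (\<lambda>i. - a i) (\<lambda>i. - b i) D \<longleftrightarrow> spread S a b D"
  by (simp add: spread_def near_uminus)

lemma near_step:
  assumes "near S a b (Suc d) x x'" "\<bar>k\<bar> \<le> 1"
  shows "near S a b d (x + k) (x' + k)"
  unfolding near_def
proof
  fix i assume "i \<in> S"
  then have "clip (Suc d) (x - a i) = clip (Suc d) (x' - b i)" using assms by (auto simp: near_def)
  then show "clip d (x + k - a i) = clip d (x' + k - b i)"
    using assms(2) by (auto simp: clip_def min_def max_def split: if_splits)
qed

text \<open>An upward move of any length in one model is answered by an upward move in the other, at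
  the price of one unit of the threshold. The lost unit guarantees that the answer does not fall
  below \<open>x'\<close>.\<close>

lemma near_up:
  assumes S: "finite S" and sp: "spread S a b D" and near: "near S a b (Suc d) x x'"
    and d: "Suc d \<le> D" and z: "x \<le> z"
  shows "\<exists>z'\<ge>x'. near S a b d z z'"
proof -
  have sp: "clip (2 * D + 1) (a i - a j) = clip (2 * D + 1) (b i - b j)" if "i \<in> S" "j \<in> S" for i j
    using sp that by (auto simp: spread_def near_def)
  have nr: "clip (Suc d) (x - a i) = clip (Suc d) (x' - b i)" if "i \<in> S" for i
    using near that by (auto simp: near_def)
  have cl: "clip d s = int d + 1 \<longleftrightarrow> int d + 1 \<le> s" "clip d s = - int d - 1 \<longleftrightarrow> s \<le> - int d - 1" for s
    by (auto simp: clip_def)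
  show ?thesis
  proof (cases "\<exists>j\<in>S. \<bar>z - a j\<bar> \<le> int d")
    case True
    then obtain j where j: "j \<in> S" "\<bar>z - a j\<bar> \<le> int d" by blast
    \<comment> \<open>Close to an agent, the offset from this agent is copied; the distances between
      agents take care of all other offsets.\<close>
    define z' where "z' = b j + (z - a j)"
    have "clip d (z - a i) = clip d (z' - b i)" if "i \<in> S" for i
      using sp[OF j(1) that] j(2) d unfolding z'_def
      by (auto simp: clip_def min_def max_def split: if_splits)
    moreover have "x' \<le> z'"
      using nr[OF j(1)] j(2) z unfolding z'_def
      by (auto simp: clip_def min_def max_def split: if_splits)
    ultimately show ?thesis by (auto simp: near_def)
  next
    case False
    then have far: "z - a i \<ge> int d + 1 \<or> z - a i \<le> - int d - 1" if "i \<in> S" for i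
      using that by force
    show ?thesis
    proof (cases "\<exists>j\<in>S. a j < z \<and> x - a j \<le> int d + 1")
      case True
      \<comment> \<open>Now \<open>z\<close> lies deep in a gap, and \<open>x\<close> is not yet far
        above the lower end of this gap. The answer is put d + 1 above the highest agent below
        \<open>z\<close>. If an agent follows above, the gap is at least 2 * d + 2 wide, in the
        other model too.\<close>
      define L where "L = {i \<in> S. a i < z}"
      have "finite L" "L \<noteq> {}" using S True by (auto simp: L_def)
      then obtain j where j: "j \<in> L" "\<And>i. i \<in> L \<Longrightarrow> a i \<le> a j"
        using Max_in[of "a ` L"] Max_ge[of "a ` L"]
            by (metis (no_types, lifting) finite_imageI imageE image_eqI image_is_empty)
      have jS: "j \<in> S" "a j < z" using j(1) by (auto simp: L_def)
      have xj: "x - a j \<le> int d + 1" using True j(2) by (force simp: L_def)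
      define z' where "z' = b j + int d + 1"
      have "clip d (z - a i) = clip d (z' - b i)" if i: "i \<in> S" for i
      proof (cases "a i < z")
        case True
        then have "a i \<le> a j" using j(2) i by (auto simp: L_def)
        then have "b i \<le> b j" using sp[OF i jS(1)]
          by (auto simp: clip_def min_def max_def split: if_splits)
        then have "clip d (z' - b i) = int d + 1" by (simp add: cl z'_def)
        moreover have "clip d (z - a i) = int d + 1" using far[OF i] True by (simp add: cl)
        ultimately show ?thesis by simp
      next
        case False
        then have zi: "z - a i \<le> - int d - 1" using far[OF i] by linarith
        moreover have "z - a j \<ge> int d + 1" using far[OF jS(1)] jS(2) by linarith
        ultimately have "a i - a j \<ge> 2 * int d + 2" by linarith
        then have "b i - b j \<ge> 2 * int d + 2" using sp[OF i jS(1)] d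
          by (auto simp: clip_def min_def max_def split: if_splits)
        then have "clip d (z' - b i) = - int d - 1" by (simp add: cl z'_def)
        moreover have "clip d (z - a i) = - int d - 1" using zi by (simp add: cl)
        ultimately show ?thesis by simp
      qed
      moreover have "x' \<le> z'"
        using nr[OF jS(1)] xj unfolding z'_def
        by (auto simp: clip_def min_def max_def split: if_splits)
      ultimately show ?thesis by (auto simp: near_def)
    next
      case no: False
      \<comment> \<open>Here \<open>x\<close> is already in the gap of \<open>z\<close>, more than d
        + 1 above all agents below it. Staying at \<open>x'\<close> answers the move.\<close>
      have "clip d (z - a i) = clip d (x' - b i)" if i: "i \<in> S" for i
      proof (cases "a i < z")
        case True
        then have "x - a i \<ge> int d + 2" using no i by force
        then have "x' - b i \<ge> int d + 2" using nr[OF i]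
          by (auto simp: clip_def min_def max_def split: if_splits)
        then have "clip d (x' - b i) = int d + 1" by (simp add: cl)
        moreover have "clip d (z - a i) = int d + 1" using far[OF i] True by (simp add: cl)
        ultimately show ?thesis by simp
      next
        case False
        then have zi: "z - a i \<le> - int d - 1" using far[OF i] by linarith
        then have "x - a i \<le> - int d - 1" using z by linarith
        then have "x' - b i \<le> - int d - 1" using nr[OF i]
          by (auto simp: clip_def min_def max_def split: if_splits)
        then have "clip d (x' - b i) = - int d - 1" by (simp add: cl)
        moreover have "clip d (z - a i) = - int d - 1" using zi by (simp add: cl)
        ultimately show ?thesis by simp
      qed
      then show ?thesis by (auto simp: near_def)
    qed
  qed
qed

lemma near_down:
  assumes "finite S" "spread S a b D" "near S a b (Suc d) x x'" "Suc d \<le> D" "z \<le> x"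
  shows "\<exists>z'\<le>x'. near S a b d z z'"
proof -
  obtain z' where "- x' \<le> z'" "near S (\<lambda>i. - a i) (\<lambda>i. - b i) d (- z) z'"
    using near_up[of S "\<lambda>i. - a i" "\<lambda>i. - b i" D d "- x" "- x'" "- z"] assms
    by (auto simp: spread_uminus near_uminus)
  then have "- z' \<le> x'" "near S a b d z (- z')"
    using near_uminus[of S a b d z "- z'"] by simp_all
  then show ?thesis by blast
qed

section \<open>Both axes together\<close>

definition near2 where
  "near2 S P Q d p q \<longleftrightarrow> near S (fst \<circ> P) (fst \<circ> Q) d (fst p) (fst q) \<and>
     near S (snd \<circ> P) (snd \<circ> Q) d (snd p) (snd q)"

definition spread2 where
  "spread2 S P Q D \<longleftrightarrow> spread S (fst \<circ> P) (fst \<circ> Q) D \<and> spread S (snd \<circ> P) (snd \<circ> Q) D"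

lemma near2_sym: "near2 S P Q d p q \<Longrightarrow> near2 S Q P d q p"
  and spread2_sym: "spread2 S P Q D \<Longrightarrow> spread2 S Q P D"
  by (auto simp: near2_def spread2_def near_sym spread_sym)

lemma near2_mono: "near2 S P Q (Suc d) p q \<Longrightarrow> near2 S P Q d p q"
  by (auto simp: near2_def near_mono)

lemma near2_step: "near2 S P Q (Suc d) p q \<Longrightarrow> near2 S P Q d (shift v 1 p) (shift v 1 q)"
  using near_step[of S _ _ d _ _ 1] near_step[of S _ _ d _ _ "- 1"]
  by (cases p; cases q; cases v) (auto simp: near2_def near_mono)

text \<open>A shift changes one coordinate, which is answered on its axis. The other coordinate
  stays and merely loses one unit of the threshold.\<close>

lemma near2_star:
  assumes "finite S" "spread2 S P Q D" "near2 S P Q (Suc d) p q" "Suc d \<le> D"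
  shows "\<exists>m :: nat. near2 S P Q d (shift v (int n) p) (shift v (int m) q)"
proof -
  obtain x y x' y' where pq: "p = (x, y)" "q = (x', y')" by (cases p; cases q)
  have s: "spread S (fst \<circ> P) (fst \<circ> Q) D" "spread S (snd \<circ> P) (snd \<circ> Q) D"
    using assms by (auto simp: spread2_def)
  have r: "near S (fst \<circ> P) (fst \<circ> Q) (Suc d) x x'" "near S (snd \<circ> P) (snd \<circ> Q) (Suc d) y y'"
    using assms by (auto simp: near2_def pq)
  note up = near_up[OF assms(1) _ _ assms(4)]
  note down = near_down[OF assms(1) _ _ assms(4)]
  show ?thesis
  proof (cases v)
    case North
    obtain z where "z \<ge> y'" "near S (snd \<circ> P) (snd \<circ> Q) d (y + int n) z"
      using up[OF s(2) r(2)] by (metis le_add_same_cancel1 of_nat_0_le_iff)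
    then show ?thesis using North r near_mono
      by (intro exI[of _ "nat (z - y')"]) (auto simp: near2_def pq)
  next
    case South
    obtain z where "z \<le> y'" "near S (snd \<circ> P) (snd \<circ> Q) d (y - int n) z"
      using down[OF s(2) r(2), of "y - int n"] by auto
    then show ?thesis using South r near_mono
      by (intro exI[of _ "nat (y' - z)"]) (auto simp: near2_def pq)
  next
    case East
    obtain z where "z \<ge> x'" "near S (fst \<circ> P) (fst \<circ> Q) d (x + int n) z"
      using up[OF s(1) r(1)] by (metis le_add_same_cancel1 of_nat_0_le_iff)
    then show ?thesis using East r near_mono
      by (intro exI[of _ "nat (z - x')"]) (auto simp: near2_def pq)
  next
    case West
    obtain z where "z \<le> x'" "near S (fst \<circ> P) (fst \<circ> Q) d (x - int n) z"
      using down[OF s(1) r(1), of "x - int n"] by auto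
    then show ?thesis using West r near_mono
      by (intro exI[of _ "nat (x' - z)"]) (auto simp: near2_def pq)
  qed
qed

lemma near2_weaken: "near2 S P Q e p q \<Longrightarrow> d \<le> e \<Longrightarrow> near2 S P Q d p q"
  by (induction e) (auto simp: le_Suc_eq near2_mono)

text \<open>Each modality spends one unit of the threshold. At threshold 0 \<open>clip\<close> still
  separates the offset 0 from all others, which is what \<open>Here\<close> needs. The converse
  direction for stars is the same argument with the models exchanged.\<close>

lemma truth_near2:
  assumes S: "finite S" and sp: "spread2 S P Q D"
  shows "agents \<phi> \<subseteq> S \<Longrightarrow> depth \<phi> \<le> D \<Longrightarrow> near2 S P Q (depth \<phi>) p q \<Longrightarrow>
    truth P p \<phi> \<longleftrightarrow> truth Q q \<phi>"
proof (induction \<phi> arbitrary: p q)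
  case (Here i)
  then have "clip 0 (fst p - fst (P i)) = clip 0 (fst q - fst (Q i))"
    "clip 0 (snd p - snd (P i)) = clip 0 (snd q - snd (Q i))"
    by (auto simp: near2_def near_def)
  then have "fst p = fst (P i) \<longleftrightarrow> fst q = fst (Q i)" "snd p = snd (P i) \<longleftrightarrow> snd q = snd (Q i)"
    by (auto simp: clip_def)
  then show ?case by (auto simp: prod_eq_iff)
next
  case (Conj \<phi> \<psi>)
  then show ?case
    using Conj.IH[of p q] near2_weaken[OF Conj.prems(3), of "depth \<phi>"]
      near2_weaken[OF Conj.prems(3), of "depth \<psi>"] by simp
next
  case (Box \<alpha> \<phi>)
  then have d: "agents \<phi> \<subseteq> S" "Suc (depth \<phi>) \<le> D" "near2 S P Q (Suc (depth \<phi>)) p q" by auto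
  show ?case
  proof (cases \<alpha>)
    case (Step v)
    then show ?thesis
      using Box.IH[OF d(1) _ near2_step[OF d(3)]] d(2) by (simp add: truth_Box)
  next
    case (Star v)
    have "truth P p (Box (Star v) \<phi>)" if "truth Q q (Box (Star v) \<phi>)"
      unfolding truth_Box
    proof
      fix n :: nat
      obtain m :: nat where "near2 S P Q (depth \<phi>) (shift v (int n) p) (shift v (int m) q)"
        using near2_star[OF S sp d(3,2)] by blast
      from Box.IH[OF d(1) _ this] show "truth P (shift v (int n) p) \<phi>"
        using d(2) that by (simp add: truth_Box)
    qed
    moreover have "truth Q q (Box (Star v) \<phi>)" if "truth P p (Box (Star v) \<phi>)"
      unfolding truth_Box
    proof
      fix n :: nat
      obtain m :: nat where "near2 S Q P (depth \<phi>) (shift v (int n) q) (shift v (int m) p)"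
        using near2_star[OF S spread2_sym[OF sp] near2_sym[OF d(3)] d(2)] by blast
      then have "near2 S P Q (depth \<phi>) (shift v (int m) p) (shift v (int n) q)" by (rule near2_sym)
      from Box.IH[OF d(1) _ this] show "truth Q (shift v (int n) q) \<phi>"
        using d(2) that by (simp add: truth_Box)
    qed
    ultimately show ?thesis using Star by blast
  qed
qed auto

lemma spread2_refl: "spread2 S P P D"
  by (auto simp: spread2_def spread_def near_def)

text \<open>The witness \<open>b i\<close> counts the integers below \<open>a i\<close> that are close to some \<open>a j\<close>, so long gaps
  are contracted.\<close>

lemma compress:
  fixes a :: "'i \<Rightarrow> int"
  assumes S: "finite S"
  shows "\<exists>b. spread S a b D \<and>
    (\<forall>i\<in>S. int D < b i \<and> b i + int D < int (card S * (4 * D + 5)))"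
proof -
  \<comment> \<open>\<open>L\<close> is the value at which \<open>clip (2 * D + 1)\<close>
    saturates. An interval of radius \<open>L\<close> has 4 * D + 5 points, whence the constant in
    the bound.\<close>
  define L :: int where "L = 2 * int D + 2"
  define T where "T = (\<Union>i\<in>S. {a i - L..a i + L})"
  define b where "b x = int (card {t \<in> T. t < x})" for x
  have T: "finite T" using S by (auto simp: T_def)
  have card_T: "card T \<le> card S * (4 * D + 5)"
  proof -
    have "card T \<le> (\<Sum>i\<in>S. card {a i - L..a i + L})"
      unfolding T_def using S by (rule card_UN_le)
    also have "\<dots> = card S * (4 * D + 5)" by (simp add: L_def nat_add_distrib nat_mult_distrib)
    finally show ?thesis .
  qed
  have diff: "b y - b x = int (card (T \<inter> {x..<y}))" if "x \<le> y" for x y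
  proof -
    have eq: "{t \<in> T. t < y} = {t \<in> T. t < x} \<union> (T \<inter> {x..<y})" using that by auto
    have "card {t \<in> T. t < y} = card {t \<in> T. t < x} + card (T \<inter> {x..<y})"
      unfolding eq by (rule card_Un_disjoint) (use T in auto)
    then show ?thesis by (simp add: b_def)
  qed
  have in_T: "{a i - L..a i + L} \<subseteq> T" if "i \<in> S" for i using that by (auto simp: T_def)
  \<comment> \<open>Between agents at distance at most \<open>L\<close> no integer is left out, so
    the distance is exact. Across a longer gap at least \<open>L\<close> integers survive, and both
    distances are clipped to \<open>L\<close>.\<close>
  have sp: "clip (2 * D + 1) (a i - a j) = clip (2 * D + 1) (b (a i) - b (a j))"
    if ij: "i \<in> S" "j \<in> S" "a j \<le> a i" for i j
  proof (cases "a i - a j \<le> L")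
    case True
    then have "T \<inter> {a j..<a i} = {a j..<a i}" using in_T[OF ij(2)] by (auto simp: L_def)
    then show ?thesis using diff[OF ij(3)] ij(3) by simp
  next
    case False
    then have "{a j..<a j + L} \<subseteq> T \<inter> {a j..<a i}" using in_T[OF ij(2)] by (auto simp: L_def)
    then have "card {a j..<a j + L} \<le> card (T \<inter> {a j..<a i})" using T by (intro card_mono) auto
    then have "L \<le> b (a i) - b (a j)" using diff[OF ij(3)] by (simp add: L_def)
    then show ?thesis using False by (auto simp: clip_def L_def)
  qed
  have "spread S a (b \<circ> a) D"
    unfolding spread_def near_def
  proof safe
    fix i j assume ij: "i \<in> S" "j \<in> S"
    show "clip (2 * D + 1) (a i - a j) = clip (2 * D + 1) ((b \<circ> a) i - (b \<circ> a) j)"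
      using sp[OF ij] sp[OF ij(2,1)] clip_uminus[of "2 * D + 1" "a i - a j"]
        clip_uminus[of "2 * D + 1" "b (a i) - b (a j)"] by (cases "a j \<le> a i") auto
  qed
  \<comment> \<open>The \<open>L\<close> integers on either side of an agent belong to
    \<open>T\<close>; this leaves the margin at both ends of the grid.\<close>
  moreover have "int D < b (a i)" if "i \<in> S" for i
  proof -
    have "{a i - L..<a i} \<subseteq> {t \<in> T. t < a i}" using in_T[OF that] by auto
    then have "card {a i - L..<a i} \<le> card {t \<in> T. t < a i}" using T by (intro card_mono) auto
    then show ?thesis by (simp add: b_def L_def)
  qed
  moreover have "b (a i) + int D < int (card S * (4 * D + 5))" if "i \<in> S" for i
  proof -
    have "{t \<in> T. t < a i} \<union> {a i..a i + L} \<subseteq> T" using in_T[OF that] by (auto simp: L_def)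
    then have "card ({t \<in> T. t < a i} \<union> {a i..a i + L}) \<le> card T" using T by (intro card_mono) auto
    moreover have "card ({t \<in> T. t < a i} \<union> {a i..a i + L}) = card {t \<in> T. t < a i} + card {a i..a
        i + L}"
      using T by (intro card_Un_disjoint) auto
    ultimately have "b (a i) + L < int (card T)" by (simp add: b_def L_def)
    moreover have "int (card T) \<le> int (card S * (4 * D + 5))"
      using card_T by (simp only: of_nat_le_iff)
    ultimately show ?thesis unfolding L_def by linarith
  qed
  ultimately show ?thesis by (intro exI[of _ "b \<circ> a"]) simp
qed

lemma small_model:
  fixes \<phi> :: "'i fm"
  assumes "truth P p \<phi>" "depth \<phi> \<le> D" "(card (agents \<phi>) + 1) * (4 * D + 5) \<le> M"
  shows "\<exists>Q q. truth Q q \<phi> \<and> (\<forall>i\<in>agents \<phi>. int D < fst (Q i) \<and> fst (Q i) + int D < int M \<and>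
      int D < snd (Q i) \<and> snd (Q i) + int D < int M) \<and>
    0 \<le> fst q \<and> fst q \<le> int M \<and> 0 \<le> snd q \<and> snd q \<le> int M"
proof -
  have fin: "finite (agents \<phi>)" by (induction \<phi>) auto
  \<comment> \<open>The point of evaluation is treated as one more agent, \<open>None\<close>, so
    that the contraction moves it along with the others. This is the + 1 in the bound on
    \<open>M\<close>.\<close>
  define S where "S = insert None (Some ` agents \<phi>)"
  have S: "finite S" using fin by (simp add: S_def)
  have card: "card S = card (agents \<phi>) + 1"
    using fin by (simp add: S_def card_image)
  define A where "A = case_option p P"
  have M: "int (card S * (4 * D + 5)) \<le> int M"
    using assms(3) unfolding card of_nat_le_iff .
  obtain b where b: "spread S (fst \<circ> A) b D"
    and b_bound: "\<forall>i\<in>S. int D < b i \<and> b i + int D < int (card S * (4 * D + 5))"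
    using compress[OF S, of "fst \<circ> A" D] by blast
  obtain c where c: "spread S (snd \<circ> A) c D"
    and c_bound: "\<forall>i\<in>S. int D < c i \<and> c i + int D < int (card S * (4 * D + 5))"
    using compress[OF S, of "snd \<circ> A" D] by blast
  have b': "int D < b i \<and> b i + int D < int M" and c': "int D < c i \<and> c i + int D < int M"
    if "i \<in> S" for i
    using bspec[OF b_bound that] bspec[OF c_bound that] M by linarith+
  define Q where "Q i = (b (Some i), c (Some i))" for i
  define q where "q = (b None, c None)"
  have sub: "near (agents \<phi>) (\<lambda>i. u (Some i)) (\<lambda>i. v (Some i)) d x y" if "near S u v d x y"
    for u v d x y using that by (auto simp: near_def S_def)
  have Afst: "(\<lambda>i. (fst \<circ> A) (Some i)) = fst \<circ> P" "(\<lambda>i. (snd \<circ> A) (Some i)) = snd \<circ> P"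
    and Qfst: "(\<lambda>i. b (Some i)) = fst \<circ> Q" "(\<lambda>i. c (Some i)) = snd \<circ> Q"
    by (auto simp: A_def Q_def)
  have weaken: "near S u v d x y" if "near S u v e x y" "d \<le> e" for u v d e x y
    using that by (induction e) (auto simp: le_Suc_eq near_mono)
  have "spread2 (agents \<phi>) P Q D"
    unfolding spread2_def
  proof
    have "near (agents \<phi>) (fst \<circ> P) (fst \<circ> Q) (2 * D + 1) ((fst \<circ> A) (Some i)) (b (Some i))"
        if "i \<in> agents \<phi>" for i
      using sub[of "fst \<circ> A" b] b that unfolding Afst Qfst by (auto simp: spread_def S_def)
    then show "spread (agents \<phi>) (fst \<circ> P) (fst \<circ> Q) D"
      by (simp add: spread_def A_def Q_def)
    have "near (agents \<phi>) (snd \<circ> P) (snd \<circ> Q) (2 * D + 1) ((snd \<circ> A) (Some i)) (c (Some i))"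
        if "i \<in> agents \<phi>" for i
      using sub[of "snd \<circ> A" c] c that unfolding Afst Qfst by (auto simp: spread_def S_def)
    then show "spread (agents \<phi>) (snd \<circ> P) (snd \<circ> Q) D"
      by (simp add: spread_def A_def Q_def)
  qed
  moreover have "near2 (agents \<phi>) P Q (depth \<phi>) p q"
    unfolding near2_def
  proof
    have "near S (fst \<circ> A) b (2 * D + 1) (fst p) (b None)" "near S (snd \<circ> A) c (2 * D + 1) (snd p)
        (c None)"
      using b c by (auto simp: spread_def S_def A_def)
    then have "near S (fst \<circ> A) b (depth \<phi>) (fst p) (b None)" "near S (snd \<circ> A) c (depth \<phi>)
        (snd p) (c None)"
      using weaken assms(2) by (metis le_add1 le_trans mult_2 add_leD1)+
    from this[THEN sub] show "near (agents \<phi>) (fst \<circ> P) (fst \<circ> Q) (depth \<phi>) (fst p) (fst q)"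
      "near (agents \<phi>) (snd \<circ> P) (snd \<circ> Q) (depth \<phi>) (snd p) (snd q)"
      unfolding Afst Qfst by (simp_all add: q_def)
  qed
  ultimately have "truth Q q \<phi>"
    using truth_near2[OF fin _ order_refl assms(2)] assms(1) by blast
  moreover have "int D < fst (Q i) \<and> fst (Q i) + int D < int M \<and> int D < snd (Q i) \<and>
      snd (Q i) + int D < int M"
    if "i \<in> agents \<phi>" for i
    using b'[of "Some i"] c'[of "Some i"] that by (auto simp: Q_def S_def)
  moreover have "0 \<le> fst q" "fst q \<le> int M" "0 \<le> snd q" "snd q \<le> int M"
    using b'[of None] c'[of None] by (auto simp: q_def S_def)
  ultimately show ?thesis by blast
qed

section \<open>A first-order description of satisfiable words\<close>

definition FOr :: "'a fo \<Rightarrow> 'a fo \<Rightarrow> 'a fo" where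
  "FOr \<phi> \<psi> = FNot (FAnd (FNot \<phi>) (FNot \<psi>))"

definition FImp :: "'a fo \<Rightarrow> 'a fo \<Rightarrow> 'a fo" where
  "FImp \<phi> \<psi> = FNot (FAnd \<phi> (FNot \<psi>))"

definition FIff :: "'a fo \<Rightarrow> 'a fo \<Rightarrow> 'a fo" where
  "FIff \<phi> \<psi> = FAnd (FImp \<phi> \<psi>) (FImp \<psi> \<phi>)"

definition FEx :: "nat \<Rightarrow> 'a fo \<Rightarrow> 'a fo" where
  "FEx v \<phi> = FNot (FAll v (FNot \<phi>))"

definition any :: "'x list \<Rightarrow> ('x \<Rightarrow> 'a fo) \<Rightarrow> 'a fo" where
  "any xs f = foldr (\<lambda>x. FOr (f x)) xs (FNot (FEq 0 0 0))"

definition every :: "'x list \<Rightarrow> ('x \<Rightarrow> 'a fo) \<Rightarrow> 'a fo" where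
  "every xs f = foldr (\<lambda>x. FAnd (f x)) xs (FEq 0 0 0)"

lemma eval_derived [simp]:
  "eval w M R \<rho> (FOr \<phi> \<psi>) \<longleftrightarrow> eval w M R \<rho> \<phi> \<or> eval w M R \<rho> \<psi>"
  "eval w M R \<rho> (FImp \<phi> \<psi>) \<longleftrightarrow> (eval w M R \<rho> \<phi> \<longrightarrow> eval w M R \<rho> \<psi>)"
  "eval w M R \<rho> (FIff \<phi> \<psi>) \<longleftrightarrow> (eval w M R \<rho> \<phi> \<longleftrightarrow> eval w M R \<rho> \<psi>)"
  "eval w M R \<rho> (FEx v \<phi>) \<longleftrightarrow> (\<exists>x\<le>M. eval w M R (\<rho>(v := x)) \<phi>)"
  "eval w M R \<rho> (any xs f) \<longleftrightarrow> (\<exists>x\<in>set xs. eval w M R \<rho> (f x))"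
  "eval w M R \<rho> (every xs f) \<longleftrightarrow> (\<forall>x\<in>set xs. eval w M R \<rho> (f x))"
proof -
  show 1: "eval w M R \<rho> (FOr \<phi> \<psi>) \<longleftrightarrow> eval w M R \<rho> \<phi> \<or> eval w M R \<rho> \<psi>" for \<phi> \<psi>
    by (auto simp: FOr_def)
  show "eval w M R \<rho> (any xs f) \<longleftrightarrow> (\<exists>x\<in>set xs. eval w M R \<rho> (f x))"
    by (induction xs) (auto simp: any_def 1)
  show "eval w M R \<rho> (every xs f) \<longleftrightarrow> (\<forall>x\<in>set xs. eval w M R \<rho> (f x))"
    by (induction xs) (auto simp: every_def)
qed (auto simp: FImp_def FIff_def FEx_def)

lemma bound_vars_derived [simp]:
  "bound_vars (FOr \<phi> \<psi>) = bound_vars \<phi> \<union> bound_vars \<psi>"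
  "bound_vars (FImp \<phi> \<psi>) = bound_vars \<phi> \<union> bound_vars \<psi>"
  "bound_vars (FIff \<phi> \<psi>) = bound_vars \<phi> \<union> bound_vars \<psi>"
  "bound_vars (FEx v \<phi>) = insert v (bound_vars \<phi>)"
  "bound_vars (any xs f) = (\<Union>x\<in>set xs. bound_vars (f x))"
  "bound_vars (every xs f) = (\<Union>x\<in>set xs. bound_vars (f x))"
proof -
  show 1: "bound_vars (FOr \<phi> \<psi>) = bound_vars \<phi> \<union> bound_vars \<psi>" for \<phi> \<psi>
    by (auto simp: FOr_def)
  show "bound_vars (any xs f) = (\<Union>x\<in>set xs. bound_vars (f x))"
    by (induction xs) (auto simp: any_def 1)
  show "bound_vars (every xs f) = (\<Union>x\<in>set xs. bound_vars (f x))"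
    by (induction xs) (auto simp: every_def)
qed (auto simp: FImp_def FIff_def FEx_def)

lemma wf_fo_derived [simp]:
  "wf_fo (FOr \<phi> \<psi>) \<longleftrightarrow> wf_fo \<phi> \<and> wf_fo \<psi>"
  "wf_fo (FImp \<phi> \<psi>) \<longleftrightarrow> wf_fo \<phi> \<and> wf_fo \<psi>"
  "wf_fo (FIff \<phi> \<psi>) \<longleftrightarrow> wf_fo \<phi> \<and> wf_fo \<psi>"
  "wf_fo (FEx v \<phi>) \<longleftrightarrow> v \<noteq> 0 \<and> v \<notin> bound_vars \<phi> \<and> wf_fo \<phi>"
  "wf_fo (any xs f) \<longleftrightarrow> (\<forall>x\<in>set xs. wf_fo (f x))"
  "wf_fo (every xs f) \<longleftrightarrow> (\<forall>x\<in>set xs. wf_fo (f x))"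
proof -
  show 1: "wf_fo (FOr \<phi> \<psi>) \<longleftrightarrow> wf_fo \<phi> \<and> wf_fo \<psi>" for \<phi> \<psi>
    by (auto simp: FOr_def)
  show "wf_fo (any xs f) \<longleftrightarrow> (\<forall>x\<in>set xs. wf_fo (f x))"
    by (induction xs) (auto simp: any_def 1)
  show "wf_fo (every xs f) \<longleftrightarrow> (\<forall>x\<in>set xs. wf_fo (f x))"
    by (induction xs) (auto simp: every_def)
qed (auto simp: FImp_def FIff_def FEx_def)

section \<open>Local conditions on words and grids\<close>

definition letter_at :: "letter list \<Rightarrow> nat \<Rightarrow> letter \<Rightarrow> bool" where
  "letter_at w i a \<longleftrightarrow> i < length w \<and> w ! i = a"

definition bit_at :: "letter list \<Rightarrow> nat \<Rightarrow> bool" where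
  "bit_at w i \<longleftrightarrow> letter_at w i (L_Bit False) \<or> letter_at w i (L_Bit True)"

text \<open>Successor on the line of integers whose two halves outside \<open>0..M\<close> are collapsed to \<open>0\<close>
    and \<open>M\<close>.\<close>

definition succ :: "nat \<Rightarrow> nat \<Rightarrow> nat \<Rightarrow> bool" where
  "succ M x x' \<longleftrightarrow> Suc x = x' \<or> x = 0 \<and> x' = 0 \<or> x = M \<and> x' = M"

fun adjacent :: "nat \<Rightarrow> direction \<Rightarrow> nat \<Rightarrow> nat \<Rightarrow> nat \<Rightarrow> nat \<Rightarrow> bool" where
  "adjacent M North x y x' y' \<longleftrightarrow> x = x' \<and> succ M y y'"
| "adjacent M South x y x' y' \<longleftrightarrow> x = x' \<and> succ M y' y"
| "adjacent M East x y x' y' \<longleftrightarrow> y = y' \<and> succ M x x'"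
| "adjacent M West x y x' y' \<longleftrightarrow> y = y' \<and> succ M x' x"

text \<open>The border in direction \<open>d\<close>. A step from there returns to the same cell,
  where the unfolding of a star would also admit the value false for the star; a condition of its
  own is imposed on these cells.\<close>

fun extreme :: "nat \<Rightarrow> direction \<Rightarrow> nat \<Rightarrow> nat \<Rightarrow> bool" where
  "extreme M North x y \<longleftrightarrow> y = M"
| "extreme M South x y \<longleftrightarrow> y = 0"
| "extreme M East x y \<longleftrightarrow> x = M"
| "extreme M West x y \<longleftrightarrow> x = 0"

text \<open>\<open>E i j\<close>: the letters from \<open>i\<close> to \<open>j\<close> encode a formula; \<open>B i j\<close>: they are the binary
  name of an agent; \<open>S i j\<close>: the names starting at \<open>i\<close> and \<open>j\<close> are equal; \<open>T i x y\<close>: the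
  subformula starting at \<open>i\<close> is true at \<open>(x, y)\<close>.\<close>

locale tables =
  fixes w :: "letter list" and M :: nat
    and E B S :: "nat \<Rightarrow> nat \<Rightarrow> bool" and T :: "nat \<Rightarrow> nat \<Rightarrow> nat \<Rightarrow> bool"
  assumes root: "\<exists>j\<le>M. length w \<le> j \<and> E 0 j" "\<exists>x\<le>M. \<exists>y\<le>M. T 0 x y"
    and parse: "\<forall>i\<le>M. \<forall>j\<le>M. E i j \<longrightarrow>
      letter_at w i L_Here \<and> (\<exists>k\<le>M. Suc i = k \<and> B k j) \<or>
      (letter_at w i L_Neg \<or> (\<exists>d\<in>{North, South, East, West}. letter_at w i (L_Box (Step d)) \<or>
          letter_at w i (L_Box (Star d)))) \<and>
        (\<exists>k\<le>M. Suc i = k \<and> E k j) \<or>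
      letter_at w i L_Conj \<and> (\<exists>k\<le>M. \<exists>l\<le>M. Suc i = k \<and> E k l \<and> E l j)"
    and bits: "\<forall>i\<le>M. \<forall>j\<le>M. B i j \<longrightarrow>
      i = j \<and> \<not> bit_at w i \<or>
      (letter_at w i (L_Bit True) \<or> letter_at w i (L_Bit False) \<and> bit_at w (Suc i)) \<and>
          (\<exists>k\<le>M. Suc i = k \<and> B k j)"
    and same: "\<forall>i\<le>M. \<forall>j\<le>M. \<not> bit_at w i \<and> \<not> bit_at w j \<longrightarrow> S i j"
      "\<forall>i\<le>M. \<forall>j\<le>M. \<forall>k\<le>M. \<forall>l\<le>M. Suc i = k \<and> Suc j = l \<and> S k l \<and>
        (letter_at w i (L_Bit True) \<and> letter_at w j (L_Bit True) \<or> letter_at w i (L_Bit False) \<and>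
            letter_at w j (L_Bit False)) \<longrightarrow> S i j"
    and here: "\<forall>i\<le>M. letter_at w i L_Here \<longrightarrow> (\<exists>x\<le>M. \<exists>y\<le>M. x \<noteq> 0 \<and> x \<noteq> M \<and> y \<noteq> 0 \<and> y \<noteq> M \<and>
      (\<forall>x'\<le>M. \<forall>y'\<le>M. T i x' y' \<longleftrightarrow> x' = x \<and> y' = y))"
    and agree: "\<forall>i\<le>M. \<forall>j\<le>M. \<forall>k\<le>M. \<forall>l\<le>M. \<forall>x\<le>M. \<forall>y\<le>M.
      letter_at w i L_Here \<and> letter_at w j L_Here \<and> Suc i = k \<and> Suc j = l \<and> S k l \<and> T i x y \<longrightarrow>
          T j x y"
    and neg: "\<forall>i\<le>M. \<forall>k\<le>M. \<forall>x\<le>M. \<forall>y\<le>M. letter_at w i L_Neg \<and> Suc i = k \<longrightarrow> (T i x y \<longleftrightarrow> \<not> T k x y)"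
    and conj: "\<forall>i\<le>M. \<forall>k\<le>M. \<forall>l\<le>M. \<forall>x\<le>M. \<forall>y\<le>M. letter_at w i L_Conj \<and> Suc i = k \<and> E k l \<longrightarrow>
      (T i x y \<longleftrightarrow> T k x y \<and> T l x y)"
    and step: "\<forall>d\<in>{North, South, East, West}. \<forall>i\<le>M. \<forall>k\<le>M. \<forall>x\<le>M. \<forall>y\<le>M. \<forall>x'\<le>M. \<forall>y'\<le>M.
      letter_at w i (L_Box (Step d)) \<and> Suc i = k \<and> adjacent M d x y x' y' \<longrightarrow> (T i x y \<longleftrightarrow> T k x' y')"
    and star: "\<forall>d\<in>{North, South, East, West}. \<forall>i\<le>M. \<forall>k\<le>M. \<forall>x\<le>M. \<forall>y\<le>M. \<forall>x'\<le>M. \<forall>y'\<le>M.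
      letter_at w i (L_Box (Star d)) \<and> Suc i = k \<longrightarrow>
        (adjacent M d x y x' y' \<longrightarrow> (T i x y \<longleftrightarrow> T k x y \<and> T i x' y')) \<and>
        (extreme M d x y \<longrightarrow> (T i x y \<longleftrightarrow> T k x y))"

definition name_at :: "letter list \<Rightarrow> nat \<Rightarrow> nat \<Rightarrow> bool" where
  "name_at w i m \<longleftrightarrow> (\<forall>k<length (binary m). letter_at w (i + Suc k) (L_Bit (binary m ! k))) \<and>
     \<not> bit_at w (i + Suc (length (binary m)))"

abbreviation "dirs \<equiv> [North, South, East, West]"

abbreviation "tE i j \<equiv> FRel 0 i j 1"
abbreviation "tB i j \<equiv> FRel 1 i j 1"
abbreviation "tS i j \<equiv> FRel 2 i j 1"
abbreviation "tT i x y \<equiv> FRel 3 i x y"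

definition bit :: "nat \<Rightarrow> nat \<Rightarrow> letter fo" where
  "bit v k = FOr (At v k (L_Bit False)) (At v k (L_Bit True))"

definition succ_fo :: "nat \<Rightarrow> nat \<Rightarrow> letter fo" where
  "succ_fo x x' = FOr (FEq x 1 x') (FOr (FAnd (FEq x 0 1) (FEq x' 0 1)) (FAnd (FEq x 0 0) (FEq x'
      0 0)))"

fun adjacent_fo :: "direction \<Rightarrow> nat \<Rightarrow> nat \<Rightarrow> nat \<Rightarrow> nat \<Rightarrow> letter fo" where
  "adjacent_fo North x y x' y' = FAnd (FEq x 0 x') (succ_fo y y')"
| "adjacent_fo South x y x' y' = FAnd (FEq x 0 x') (succ_fo y' y)"
| "adjacent_fo East x y x' y' = FAnd (FEq y 0 y') (succ_fo x x')"
| "adjacent_fo West x y x' y' = FAnd (FEq y 0 y') (succ_fo x' x)"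

fun extreme_fo :: "direction \<Rightarrow> nat \<Rightarrow> nat \<Rightarrow> letter fo" where
  "extreme_fo North x y = FEq y 0 0"
| "extreme_fo South x y = FEq y 0 1"
| "extreme_fo East x y = FEq x 0 0"
| "extreme_fo West x y = FEq x 0 1"

text \<open>Variable 0 holds the largest element \<open>M\<close> of the domain; variable 1 is never bound
    and holds 0.\<close>

definition sentences :: "letter fo list" where
  "sentences = [
     FEx 3 (FAnd (Past 3 0) (tE 1 3)),
     FEx 5 (FEx 6 (tT 1 5 6)),
     FAll 2 (FAll 3 (FImp (tE 2 3)
       (FOr (FAnd (At 2 0 L_Here) (FEx 4 (FAnd (FEq 2 1 4) (tB 4 3))))
       (FOr (FAnd (FOr (At 2 0 L_Neg) (any dirs (\<lambda>d. FOr (At 2 0 (L_Box (Step d))) (At 2 0 (L_Box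
           (Star d))))))
         (FEx 4 (FAnd (FEq 2 1 4) (tE 4 3))))
       (FAnd (At 2 0 L_Conj) (FEx 4 (FEx 5 (FAnd (FEq 2 1 4) (FAnd (tE 4 5) (tE 5 3)))))))))),
     FAll 2 (FAll 3 (FImp (tB 2 3)
       (FOr (FAnd (FEq 2 0 3) (FNot (bit 2 0)))
         (FAnd (FOr (At 2 0 (L_Bit True)) (FAnd (At 2 0 (L_Bit False)) (bit 2 1)))
           (FEx 4 (FAnd (FEq 2 1 4) (tB 4 3))))))),
     FAll 2 (FAll 3 (FImp (FAnd (FNot (bit 2 0)) (FNot (bit 3 0))) (tS 2 3))),
     FAll 2 (FAll 3 (FAll 4 (FAll 5 (FImp (FAnd (FEq 2 1 4) (FAnd (FEq 3 1 5) (FAnd (tS 4 5)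
       (FOr (FAnd (At 2 0 (L_Bit True)) (At 3 0 (L_Bit True)))
         (FAnd (At 2 0 (L_Bit False)) (At 3 0 (L_Bit False))))))) (tS 2 3))))),
     FAll 2 (FImp (At 2 0 L_Here) (FEx 5 (FEx 6 (FAnd (FNot (FEq 5 0 1)) (FAnd (FNot (FEq 5 0 0))
       (FAnd (FNot (FEq 6 0 1)) (FAnd (FNot (FEq 6 0 0))
         (FAll 7 (FAll 8 (FIff (tT 2 7 8) (FAnd (FEq 7 0 5) (FEq 8 0 6)))))))))))),
     FAll 2 (FAll 3 (FAll 4 (FAll 5 (FAll 6 (FAll 7 (FImp (FAnd (At 2 0 L_Here) (FAnd (At 3 0
         L_Here)
       (FAnd (FEq 2 1 4) (FAnd (FEq 3 1 5) (FAnd (tS 4 5) (tT 2 6 7)))))) (tT 3 6 7))))))),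
     FAll 2 (FAll 4 (FAll 5 (FAll 6 (FImp (FAnd (At 2 0 L_Neg) (FEq 2 1 4))
       (FIff (tT 2 5 6) (FNot (tT 4 5 6))))))),
     FAll 2 (FAll 3 (FAll 4 (FAll 5 (FAll 6 (FImp (FAnd (At 2 0 L_Conj) (FAnd (FEq 2 1 3) (tE 3 4)))
       (FIff (tT 2 5 6) (FAnd (tT 3 5 6) (tT 4 5 6)))))))),
     every dirs (\<lambda>d. FAll 2 (FAll 4 (FAll 5 (FAll 6 (FAll 7 (FAll 8 (FImp
       (FAnd (At 2 0 (L_Box (Step d))) (FAnd (FEq 2 1 4) (adjacent_fo d 5 6 7 8)))
       (FIff (tT 2 5 6) (tT 4 7 8))))))))),
     every dirs (\<lambda>d. FAll 2 (FAll 4 (FAll 5 (FAll 6 (FAll 7 (FAll 8 (FImp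
       (FAnd (At 2 0 (L_Box (Star d))) (FEq 2 1 4))
       (FAnd (FImp (adjacent_fo d 5 6 7 8) (FIff (tT 2 5 6) (FAnd (tT 4 5 6) (tT 2 7 8))))
         (FImp (extreme_fo d 5 6) (FIff (tT 2 5 6) (tT 4 5 6))))))))))) ]"

text \<open>A fixed finite set of agents has finitely many names, each of constant length, so they
  can be written into the sentence by means of offsets.\<close>

definition names_fo :: "nat list \<Rightarrow> letter fo" where
  "names_fo ms = FAll 2 (FImp (At 2 0 L_Here) (any ms (\<lambda>m.
     FAnd (every [0..<length (binary m)] (\<lambda>k. At 2 (Suc k) (L_Bit (binary m ! k))))
       (FNot (bit 2 (Suc (length (binary m))))))))"

lemma eval_bit [simp]: "eval w M R \<rho> (bit v k) \<longleftrightarrow> bit_at w (\<rho> v + k)"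
  by (auto simp: bit_def bit_at_def letter_at_def)

lemma eval_adjacent [simp]:
  "\<rho> 0 = M \<Longrightarrow> \<rho> 1 = 0 \<Longrightarrow> eval w M R \<rho> (adjacent_fo d x y x' y') \<longleftrightarrow>
     adjacent M d (\<rho> x) (\<rho> y) (\<rho> x') (\<rho> y')"
  by (cases d) (auto simp: succ_fo_def succ_def)

lemma eval_extreme [simp]:
  "\<rho> 0 = M \<Longrightarrow> \<rho> 1 = 0 \<Longrightarrow> eval w M R \<rho> (extreme_fo d x y) \<longleftrightarrow> extreme M d (\<rho> x) (\<rho> y)"
  by (cases d) auto

lemma wf_adjacent [simp]: "wf_fo (adjacent_fo d x y x' y')" "bound_vars (adjacent_fo d x y x' y')
    = {}"
  "wf_fo (extreme_fo d x y)" "bound_vars (extreme_fo d x y) = {}"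
  "wf_fo (bit v k)" "bound_vars (bit v k) = {}"
  by (cases d; simp add: succ_fo_def bit_def)+

lemma wf_sentences: "wf_fo (every sentences id)" "wf_fo (names_fo ms)"
  by (simp_all add: sentences_def names_fo_def)

lemma eval_At [simp]: "eval w M R \<rho> (At v k a) \<longleftrightarrow> letter_at w (\<rho> v + k) a"
  by (simp add: letter_at_def)

text \<open>The list \<open>sentences\<close> mirrors the assumptions of \<open>tables\<close> one
  by one, in the same order.\<close>

lemma eval_sentences:
  "eval w M R ((\<lambda>_. 0)(0 := M)) (every sentences id) \<longleftrightarrow>
     tables w M (\<lambda>i j. R 0 i j 0) (\<lambda>i j. R 1 i j 0) (\<lambda>i j. R 2 i j 0) (R 3)"
  unfolding eval_derived(6) sentences_def tables_def
  by (simp add: all_conj_distrib del: eval.simps(2) split del: if_split)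

lemma eval_names:
  "eval w M R ((\<lambda>_. 0)(0 := M)) (names_fo ms) \<longleftrightarrow>
     (\<forall>i\<le>M. letter_at w i L_Here \<longrightarrow> (\<exists>m\<in>set ms. name_at w i m))"
  by (simp add: names_fo_def name_at_def Ball_def del: eval.simps(2))

section \<open>Soundness of the description\<close>


lemma no_bit_drop: "no_bit (drop i w) \<longleftrightarrow> \<not> bit_at w i"
proof (cases "i < length w")
  case True
  then have "drop i w = w ! i # drop (Suc i) w" by (simp add: Cons_nth_drop_Suc)
  then show ?thesis using True by (cases "w ! i") (auto simp: no_bit_def bit_at_def letter_at_def)
qed (auto simp: no_bit_def bit_at_def letter_at_def)

lemma drop_letter_at: "letter_at w i a \<Longrightarrow> drop i w = a # drop (Suc i) w"
  by (auto simp: letter_at_def Cons_nth_drop_Suc)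

lemma letter_at_drop: "drop i w = a # l \<Longrightarrow> letter_at w i a \<and> drop (Suc i) w = l"
proof -
  assume 1: "drop i w = a # l"
  then have "i < length w" by (metis drop_all leI list.distinct(1))
  with 1 show ?thesis by (auto simp: letter_at_def simp flip: Cons_nth_drop_Suc)
qed

lemma binary_0 [simp]: "binary 0 = []"
  by (simp add: binary.simps)

lemma binary_pos: "m \<noteq> 0 \<Longrightarrow> binary m = odd m # binary (m div 2)"
  by (subst binary.simps) simp

lemma name_at_drop:
  "(\<forall>k<length bs. letter_at w (p + k) (L_Bit (bs ! k))) \<and> \<not> bit_at w (p + length bs) \<longleftrightarrow>
     (\<exists>v. drop p w = map L_Bit bs @ v \<and> no_bit v)"
proof (induction bs arbitrary: p)
  case Nil
  show ?case using no_bit_drop[of p w] by simp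
next
  case (Cons b bs)
  have "(\<forall>k<length (b # bs). letter_at w (p + k) (L_Bit ((b # bs) ! k))) \<and>
      \<not> bit_at w (p + length (b # bs)) \<longleftrightarrow>
    letter_at w p (L_Bit b) \<and> ((\<forall>k<length bs. letter_at w (Suc p + k) (L_Bit (bs ! k))) \<and>
      \<not> bit_at w (Suc p + length bs))"
    by (auto simp: All_less_Suc2)
  also have "\<dots> \<longleftrightarrow> letter_at w p (L_Bit b) \<and> (\<exists>v. drop (Suc p) w = map L_Bit bs @ v \<and> no_bit v)"
    unfolding Cons.IH ..
  also have "\<dots> \<longleftrightarrow> (\<exists>v. drop p w = map L_Bit (b # bs) @ v \<and> no_bit v)"
    using drop_letter_at[of w p "L_Bit b"] letter_at_drop[of p w "L_Bit b"] by auto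
  finally show ?case .
qed

lemma name_at_iff: "name_at w i m \<longleftrightarrow> (\<exists>v. drop (Suc i) w = map L_Bit (binary m) @ v \<and> no_bit v)"
  using name_at_drop[of "binary m" w "Suc i"] by (simp add: name_at_def)

lemma name_at_unique:
  "drop (Suc i) w = map L_Bit (binary m) @ v \<Longrightarrow> no_bit v \<Longrightarrow> name_at w i m' \<longleftrightarrow> m' = m"
  unfolding name_at_iff using bits_append_inject binary_inject by metis

lemma agents_encode:
  "i \<in> agents \<phi> \<Longrightarrow> no_bit u \<Longrightarrow> \<exists>s v. encode \<phi> @ u = s @ L_Here # map L_Bit (binary i) @ v \<and> no_bit v"
proof (induction \<phi> arbitrary: u)
  case (Here j)
  then show ?case by (intro exI[of _ "[]"] exI[of _ u]) simp
next
  case (Neg \<phi>)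
  have "\<exists>s v. encode \<phi> @ u = s @ L_Here # map L_Bit (binary i) @ v \<and> no_bit v"
    by (rule Neg.IH) (use Neg.prems in auto)
  then obtain s v where "encode \<phi> @ u = s @ L_Here # map L_Bit (binary i) @ v" "no_bit v" by blast
  then show ?case by (intro exI[of _ "L_Neg # s"] exI[of _ v]) simp
next
  case (Box \<alpha> \<phi>)
  have "\<exists>s v. encode \<phi> @ u = s @ L_Here # map L_Bit (binary i) @ v \<and> no_bit v"
    by (rule Box.IH) (use Box.prems in auto)
  then obtain s v where "encode \<phi> @ u = s @ L_Here # map L_Bit (binary i) @ v" "no_bit v" by blast
  then show ?case by (intro exI[of _ "L_Box \<alpha> # s"] exI[of _ v]) simp
next
  case (Conj \<phi> \<psi>)
  from Conj.prems(1) consider "i \<in> agents \<phi>" | "i \<in> agents \<psi>" by auto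
  then show ?case
  proof cases
    case 1
    with Conj.IH(1)[of "encode \<psi> @ u"] obtain s v
      where "encode \<phi> @ encode \<psi> @ u = s @ L_Here # map L_Bit (binary i) @ v" "no_bit v"
      using no_bit_encode by blast
    then show ?thesis by (intro exI[of _ "L_Conj # s"] exI[of _ v]) simp
  next
    case 2
    with Conj.IH(2) Conj.prems obtain s v
      where "encode \<psi> @ u = s @ L_Here # map L_Bit (binary i) @ v" "no_bit v" by blast
    then show ?thesis by (intro exI[of _ "L_Conj # encode \<phi> @ s"] exI[of _ v]) simp
  qed
qed

text \<open>Every agent of a formula is named after some \<open>L_Here\<close> in its code, so it
  suffices to inspect these positions.\<close>

lemma agents_names:
  assumes "\<forall>i\<le>M. letter_at (encode \<phi>) i L_Here \<longrightarrow> (\<exists>m\<in>A. name_at (encode \<phi>) i m)"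
    and "length (encode \<phi>) \<le> M"
  shows "agents \<phi> \<subseteq> A"
proof
  fix i assume "i \<in> agents \<phi>"
  then obtain s v where s: "encode \<phi> = s @ L_Here # map L_Bit (binary i) @ v" "no_bit v"
    using agents_encode[of i \<phi> "[]"] by (auto simp: no_bit_def)
  then have "letter_at (encode \<phi>) (length s) L_Here" "drop (Suc (length s)) (encode \<phi>) =
      map L_Bit (binary i) @ v"
    by (simp_all add: letter_at_def)
  moreover from this have "length s \<le> M" using assms(2) by (simp add: letter_at_def)
  ultimately obtain m where "m \<in> A" "name_at (encode \<phi>) (length s) m" using assms(1) by blast
  then show "i \<in> A"
    using name_at_unique[OF \<open>drop (Suc (length s)) (encode \<phi>) = _\<close> s(2), of m] by simp
qed

text \<open>The unfolding equation alone would also hold for \<open>f\<close> constantly false.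
  Agreement with \<open>g\<close> from \<open>N\<close> on excludes this, by induction downwards
  from \<open>N\<close>.\<close>

lemma iterate_sequence:
  fixes f g :: "nat \<Rightarrow> bool"
  assumes "\<And>n. f n \<longleftrightarrow> g n \<and> f (Suc n)" "\<And>n. n \<ge> N \<Longrightarrow> f n \<longleftrightarrow> g n"
  shows "f 0 \<longleftrightarrow> (\<forall>n. g n)"
proof
  assume "f 0"
  then have "f n" for n by (induction n) (use assms(1) in blast)+
  then show "\<forall>n. g n" using assms(1) by blast
next
  assume g: "\<forall>n. g n"
  have "f (N - k)" for k
  proof (induction k)
    case (Suc k)
    show ?case
    proof (cases "k < N")
      case True
      then have "N - k = Suc (N - Suc k)" by simp
      then show ?thesis using Suc assms(1)[of "N - Suc k"] g by simp
    next
      case False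
      then show ?thesis using Suc by simp
    qed
  qed (use assms(2) g in simp)
  from this[of N] show "f 0" by simp
qed

section \<open>Reading a formula and a model off the tables\<close>

context tables
begin

lemma length_le: "length w \<le> M"
  using root(1) by auto

lemma bits_sound:
  "B i j \<Longrightarrow> i \<le> length w \<Longrightarrow> j \<le> M \<Longrightarrow>
    \<exists>m. i \<le> j \<and> j \<le> length w \<and> drop i w = map L_Bit (binary m) @ drop j w \<and> no_bit (drop j w)"
proof (induction "length w - i" arbitrary: i rule: less_induct)
  case less
  have "i \<le> M" using less.prems length_le by simp
  with bits less.prems have "i = j \<and> \<not> bit_at w i \<or>
      (letter_at w i (L_Bit True) \<or> letter_at w i (L_Bit False) \<and> bit_at w (Suc i)) \<and> B (Suc i) j"
    by auto
  then consider "i = j" "\<not> bit_at w i"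
    | b where "letter_at w i (L_Bit b)" "b \<or> bit_at w (Suc i)" "B (Suc i) j" by blast
  then show ?case
  proof cases
    case 1
    then show ?thesis using less.prems by (intro exI[of _ 0]) (auto simp: no_bit_drop)
  next
    case 2
    then have i: "i < length w" "drop i w = L_Bit b # drop (Suc i) w"
      by (auto simp: letter_at_def drop_letter_at)
    have "\<exists>m. Suc i \<le> j \<and> j \<le> length w \<and> drop (Suc i) w = map L_Bit (binary m) @ drop j w \<and>
        no_bit (drop j w)"
      by (rule less.hyps) (use i(1) 2(3) less.prems in \<open>simp_all add: diff_less_mono2\<close>)
    then obtain m where m: "Suc i \<le> j" "j \<le> length w" "drop (Suc i) w =
        map L_Bit (binary m) @ drop j w"
      "no_bit (drop j w)" by blast
    \<comment> \<open>The most significant bit comes last and must be true, otherwise a number would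
      have several names. This is why \<open>bits\<close> demands a further bit after a false
      one.\<close>
    have "m \<noteq> 0" if "\<not> b"
    proof
      assume "m = 0"
      then have "no_bit (drop (Suc i) w)" using m by simp
      then show False using 2(2) that by (simp add: no_bit_drop)
    qed
    then have "binary (2 * m + of_bool b) = b # binary m"
      by (cases b) (simp_all add: binary_pos)
    then show ?thesis using i m by (intro exI[of _ "2 * m + of_bool b"]) simp
  qed
qed

text \<open>\<open>S\<close> is constrained from below only: surplus pairs just make
  \<open>agree\<close> harder to satisfy.\<close>

lemma same_sound:
  "drop i w = map L_Bit bs @ u \<Longrightarrow> drop j w = map L_Bit bs @ v \<Longrightarrow> no_bit u \<Longrightarrow> no_bit v \<Longrightarrow>
    i \<le> M \<Longrightarrow> j \<le> M \<Longrightarrow> S i j"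
proof (induction bs arbitrary: i j)
  case Nil
  then have "\<not> bit_at w i" "\<not> bit_at w j" using no_bit_drop by (metis append_Nil list.simps(8))+
  then show ?case using same(1) Nil by simp
next
  case (Cons b bs)
  from Cons.prems have "letter_at w i (L_Bit b)" "drop (Suc i) w = map L_Bit bs @ u"
    "letter_at w j (L_Bit b)" "drop (Suc j) w = map L_Bit bs @ v"
    using letter_at_drop[of i w "L_Bit b"] letter_at_drop[of j w "L_Bit b"] by auto
  moreover from this have "Suc i \<le> M" "Suc j \<le> M" using length_le by (auto simp: letter_at_def)
  moreover from calculation Cons.prems have "S (Suc i) (Suc j)" using Cons.IH by blast
  ultimately show ?case
    using same(2)[rule_format, of i j "Suc i" "Suc j"] Cons.prems(5,6) by (cases b) auto
qed

definition clamp :: "int \<Rightarrow> nat" where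
  "clamp x = nat (max 0 (min (int M) x))"

lemma clamp_le [simp]: "clamp x \<le> M"
  by (simp add: clamp_def)

text \<open>The truth table extended to the whole plane through the nearest point of the
  grid.\<close>

definition holds :: "nat \<Rightarrow> int \<times> int \<Rightarrow> bool" where
  "holds i p \<longleftrightarrow> T i (clamp (fst p)) (clamp (snd p))"

lemma adjacent_clamp:
  "adjacent M d (clamp (fst p)) (clamp (snd p)) (clamp (fst (shift d 1 p))) (clamp (snd (shift d 1
      p)))"
proof -
  have 1: "succ M (clamp x) (clamp (x + 1))" for x
    by (auto simp: succ_def clamp_def)
  have "succ M (clamp (x - 1)) (clamp x)" for x
    using 1[of "x - 1"] by simp
  with 1 show ?thesis by (cases p; cases d) auto
qed

lemma extreme_clamp:
  "n \<ge> nat \<bar>fst p\<bar> + nat \<bar>snd p\<bar> + M \<Longrightarrow>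
    extreme M d (clamp (fst (shift d (int n) p))) (clamp (snd (shift d (int n) p)))"
  by (cases p; cases d) (auto simp: clamp_def)

lemma holds_step:
  assumes "letter_at w i (L_Box (Step d))"
  shows "holds i p \<longleftrightarrow> holds (Suc i) (shift d 1 p)"
proof -
  have "i \<le> M" "Suc i \<le> M" using assms length_le by (auto simp: letter_at_def)
  moreover have "d \<in> {North, South, East, West}" by (cases d) auto
  ultimately show ?thesis
    using step assms adjacent_clamp[of d p] unfolding holds_def by (metis clamp_le)
qed

text \<open>Along a ray the table satisfies the unfolding equation of the star. After finitely many
  shifts the clamped ray has reached the border, where star and body agree, so
  \<open>iterate_sequence\<close> applies.\<close>

lemma holds_star:
  assumes "letter_at w i (L_Box (Star d))"
  shows "holds i p \<longleftrightarrow> (\<forall>n :: nat. holds (Suc i) (shift d (int n) p))"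
proof -
  have i: "i \<le> M" "Suc i \<le> M" using assms length_le by (auto simp: letter_at_def)
  have d: "d \<in> {North, South, East, West}" by (cases d) auto
  have 1: "holds i p \<longleftrightarrow> holds (Suc i) p \<and> holds i (shift d 1 p)" for p
    using star d i assms adjacent_clamp[of d p] unfolding holds_def by (metis clamp_le)
  have 2: "holds i p \<longleftrightarrow> holds (Suc i) p" if "extreme M d (clamp (fst p)) (clamp (snd p))" for p
    using star d i assms that unfolding holds_def by (metis clamp_le)
  have "holds i (shift d (int 0) p) \<longleftrightarrow> (\<forall>n. holds (Suc i) (shift d (int n) p))"
  proof (rule iterate_sequence)
    show "holds i (shift d (int n) p) \<longleftrightarrow>
        holds (Suc i) (shift d (int n) p) \<and> holds i (shift d (int (Suc n)) p)" for n
      using 1[of "shift d (int n) p"] by simp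
    show "holds i (shift d (int n) p) \<longleftrightarrow> holds (Suc i) (shift d (int n) p)"
      if "n \<ge> nat \<bar>fst p\<bar> + nat \<bar>snd p\<bar> + M" for n
      using 2[OF extreme_clamp[OF that]] .
  qed
  then show ?thesis by simp
qed

text \<open>The position of an agent is read off at an occurrence of its name; \<open>agree\<close>
  makes all occurrences yield the same point, so the choice in \<open>place\<close> is determined
  for agents that occur.\<close>

definition occupies :: "nat \<Rightarrow> int \<times> int \<Rightarrow> bool" where
  "occupies m p \<longleftrightarrow> (\<exists>i x y. letter_at w i L_Here \<and> name_at w i m \<and> x \<le> M \<and> y \<le> M \<and> T i x y \<and>
     p = (int x, int y))"

definition place :: "nat \<Rightarrow> int \<times> int" where
  "place m = (SOME p. occupies m p)"

lemma holds_here: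
  assumes i: "letter_at w i L_Here" and m: "drop (Suc i) w = map L_Bit (binary m) @ v" "no_bit v"
  shows "place m = p \<longleftrightarrow> holds i p"
proof -
  have iM: "i \<le> M" "Suc i \<le> M" using i length_le by (auto simp: letter_at_def)
  from here[THEN spec, THEN mp, OF iM(1), THEN mp, OF i] obtain x y
    where xy: "x \<le> M" "y \<le> M" "x \<noteq> 0" "x \<noteq> M" "y \<noteq> 0" "y \<noteq> M"
      and "\<forall>x'\<le>M. \<forall>y'\<le>M. T i x' y' \<longleftrightarrow> x' = x \<and> y' = y"
    by (elim exE conjE)
  then have T: "T i x' y' \<longleftrightarrow> x' = x \<and> y' = y" if "x' \<le> M" "y' \<le> M" for x' y'
    using that by simp
  have "name_at w i m" using m name_at_iff by blast
  then have "occupies m (int x, int y)"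
    unfolding occupies_def using i xy T by blast
  moreover have "q = (int x, int y)" if "occupies m q" for q
  proof -
    from that obtain j x' y' where j: "letter_at w j L_Here" "name_at w j m" "x' \<le> M" "y' \<le> M"
        "T j x' y'"
      and q: "q = (int x', int y')" unfolding occupies_def by blast
    have jM: "j \<le> M" "Suc j \<le> M" using j(1) length_le by (auto simp: letter_at_def)
    from j(2) obtain v' where "drop (Suc j) w = map L_Bit (binary m) @ v'" "no_bit v'"
      by (auto simp: name_at_iff)
    then have "S (Suc j) (Suc i)" using same_sound m iM jM by blast
    then have "T i x' y'" using agree i j iM jM by blast
    then show ?thesis using T j q by simp
  qed
  ultimately have place: "place m = (int x, int y)"
    unfolding place_def by (rule some_equality)
  \<comment> \<open>An interior coordinate is the image of itself alone under \<open>clamp\<close>.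
    This is why \<open>here\<close> keeps agents off the border: a border cell stands for infinitely
    many points.\<close>
  have "clamp u = z \<longleftrightarrow> u = int z" if "z \<noteq> 0" "z \<noteq> M" "z \<le> M" for u z
    using that by (auto simp: clamp_def)
  then have "holds i p \<longleftrightarrow> fst p = int x \<and> snd p = int y"
    using T xy by (simp add: holds_def)
  then show ?thesis unfolding place by (cases p) auto
qed

text \<open>The formula is known only through the parse, so parse and truth are established in one
  induction on the length of the remaining word. That no bit follows position \<open>j\<close> is
  carried along because a name extends up to the first letter that is not a bit.\<close>

lemma parse_sound:
  "E i j \<Longrightarrow> i \<le> length w \<Longrightarrow> j \<le> M \<Longrightarrow> \<exists>\<phi>. i < j \<and> j \<le> length w \<and>
    drop i w = encode \<phi> @ drop j w \<and> no_bit (drop j w) \<and> (\<forall>p. truth place p \<phi> \<longleftrightarrow> holds i p)"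
proof (induction "length w - i" arbitrary: i j rule: less_induct)
  case less
  have iM: "i \<le> M" using less.prems length_le by simp
  have IH: "\<exists>\<phi>. k < j' \<and> j' \<le> length w \<and> drop k w = encode \<phi> @ drop j' w \<and>
      no_bit (drop j' w) \<and> (\<forall>p. truth place p \<phi> \<longleftrightarrow> holds k p)"
    if "i < k" "k \<le> length w" "E k j'" "j' \<le> M" for k j'
    by (rule less.hyps) (use that in auto)
  from iM parse less.prems consider (Here) "letter_at w i L_Here" "B (Suc i) j"
    | (Neg) "letter_at w i L_Neg" "E (Suc i) j"
    | (Step) d where "letter_at w i (L_Box (Step d))" "E (Suc i) j"
    | (Star) d where "letter_at w i (L_Box (Star d))" "E (Suc i) j"
    | (Conj) l where "letter_at w i L_Conj" "l \<le> M" "E (Suc i) l" "E l j"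
    by blast
  then show ?case
  proof cases
    case Here
    then have i: "Suc i \<le> length w" "drop i w = L_Here # drop (Suc i) w"
      by (auto simp: drop_letter_at) (simp add: letter_at_def)
    then obtain m where m: "Suc i \<le> j" "j \<le> length w" "drop (Suc i) w =
        map L_Bit (binary m) @ drop j w"
      "no_bit (drop j w)"
      using bits_sound[OF Here(2)] less.prems by blast
    then show ?thesis using i holds_here[OF Here(1) m(3,4)]
      by (intro exI[of _ "Here m"]) simp
  next
    case Neg
    then have i: "i < length w" "drop i w = L_Neg # drop (Suc i) w"
      by (auto simp: drop_letter_at) (simp add: letter_at_def)
    then obtain \<phi> where \<phi>: "Suc i < j" "j \<le> length w" "drop (Suc i) w = encode \<phi> @ drop j w"
      "no_bit (drop j w)" "\<forall>p. truth place p \<phi> \<longleftrightarrow> holds (Suc i) p"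
      using IH[OF lessI _ Neg(2) less.prems(3)] by (metis Suc_leI)
    moreover have "holds i p \<longleftrightarrow> \<not> holds (Suc i) p" for p
      using neg Neg(1) iM i length_le unfolding holds_def by (metis Suc_leI clamp_le le_trans)
    ultimately show ?thesis using i by (intro exI[of _ "Neg \<phi>"]) auto
  next
    case (Step d)
    then have i: "i < length w" "drop i w = L_Box (Step d) # drop (Suc i) w"
      by (auto simp: drop_letter_at) (simp add: letter_at_def)
    then obtain \<phi> where \<phi>: "Suc i < j" "j \<le> length w" "drop (Suc i) w = encode \<phi> @ drop j w"
      "no_bit (drop j w)" "\<forall>p. truth place p \<phi> \<longleftrightarrow> holds (Suc i) p"
      using IH[OF lessI _ Step(2) less.prems(3)] by (metis Suc_leI)
    then show ?thesis using i holds_step[OF Step(1)]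
      by (intro exI[of _ "Box (Step d) \<phi>"]) (simp add: truth_Box del: split_paired_All)
  next
    case (Star d)
    then have i: "i < length w" "drop i w = L_Box (Star d) # drop (Suc i) w"
      by (auto simp: drop_letter_at) (simp add: letter_at_def)
    then obtain \<phi> where \<phi>: "Suc i < j" "j \<le> length w" "drop (Suc i) w = encode \<phi> @ drop j w"
      "no_bit (drop j w)" "\<forall>p. truth place p \<phi> \<longleftrightarrow> holds (Suc i) p"
      using IH[OF lessI _ Star(2) less.prems(3)] by (metis Suc_leI)
    then show ?thesis using i holds_star[OF Star(1)]
      by (intro exI[of _ "Box (Star d) \<phi>"]) (simp add: truth_Box del: split_paired_All)
  next
    case (Conj l)
    then have i: "i < length w" "drop i w = L_Conj # drop (Suc i) w"
      by (auto simp: drop_letter_at) (simp add: letter_at_def)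
    then obtain \<phi> where \<phi>: "Suc i < l" "l \<le> length w" "drop (Suc i) w = encode \<phi> @ drop l w"
      "\<forall>p. truth place p \<phi> \<longleftrightarrow> holds (Suc i) p"
      using IH[OF lessI _ Conj(3,2)] by (metis Suc_leI)
    then obtain \<psi> where \<psi>: "l < j" "j \<le> length w" "drop l w = encode \<psi> @ drop j w"
      "no_bit (drop j w)" "\<forall>p. truth place p \<psi> \<longleftrightarrow> holds l p"
      using IH[OF _ _ Conj(4) less.prems(3)] by (metis Suc_lessD)
    have "holds i p \<longleftrightarrow> holds (Suc i) p \<and> holds l p" for p
      using conj Conj iM i length_le unfolding holds_def by (metis Suc_leI clamp_le le_trans)
    then show ?thesis using i \<phi> \<psi> by (intro exI[of _ "Conj \<phi> \<psi>"]) auto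
  qed
qed

lemma sound: "\<exists>\<phi>. w = encode \<phi> \<and> (\<exists>P p. truth P p \<phi>)"
proof -
  obtain j where j: "j \<le> M" "length w \<le> j" "E 0 j" using root(1) by blast
  with parse_sound[OF j(3)] obtain \<phi> where \<phi>: "w = encode \<phi> @ drop j w"
    "\<And>p. truth place p \<phi> \<longleftrightarrow> holds 0 p" by auto
  obtain x y where xy: "x \<le> M" "y \<le> M" "T 0 x y" using root(2) by blast
  then have "holds 0 (int x, int y)" by (simp add: holds_def clamp_def)
  then have "truth place (int x, int y) \<phi>" using \<phi>(2) by blast
  moreover have "w = encode \<phi>" using \<phi>(1) j(2) by simp
  ultimately show ?thesis by blast
qed

end

section \<open>Completeness of the description\<close>

definition is_bit :: "letter \<Rightarrow> bool" where
  "is_bit a \<longleftrightarrow> (\<exists>b. a = L_Bit b)"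

lemma is_bit_simps [simp]:
  "is_bit (L_Bit b)" "\<not> is_bit L_Here" "\<not> is_bit L_Neg" "\<not> is_bit L_Conj" "\<not> is_bit (L_Box \<alpha>)"
  by (auto simp: is_bit_def)

lemma no_bit_simps [simp]: "no_bit []" "no_bit (a # l) \<longleftrightarrow> \<not> is_bit a"
  by (auto simp: no_bit_def is_bit_def)

lemma encode_nonempty: "0 < length (encode \<phi>)"
  by (cases \<phi>) auto

text \<open>In prefix notation every position of the code without a bit starts a subformula, which
  is unique by \<open>encode_append_inject\<close>. Hence positions can index the truth
  table.\<close>

lemma parse_at:
  "i < length (encode \<phi>) \<Longrightarrow> no_bit u \<Longrightarrow> no_bit (drop i (encode \<phi>)) \<Longrightarrow>
    \<exists>\<psi> v. drop i (encode \<phi>) @ u = encode \<psi> @ v \<and> no_bit v \<and> depth \<psi> \<le> depth \<phi> \<and> agents \<psi> \<subseteq> agents \<phi>"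
proof (induction \<phi> arbitrary: i u)
  case (Here m)
  show ?case
  proof (cases i)
    case 0
    then show ?thesis using Here.prems(2) by (intro exI[of _ "Here m"] exI[of _ u]) simp
  next
    case (Suc k)
    then have "k < length (map L_Bit (binary m))" using Here.prems(1) by simp
    then have "drop i (encode (Here m)) = L_Bit (binary m ! k) # drop (Suc k) (map L_Bit (binary
        m))"
      using Suc by (simp add: Cons_nth_drop_Suc[symmetric])
    then have "\<not> no_bit (drop i (encode (Here m)))"
      by (simp only: no_bit_simps is_bit_simps) simp
    then show ?thesis using Here.prems(3) by contradiction
  qed
next
  case (Neg \<phi>)
  show ?case
  proof (cases i)
    case 0
    then show ?thesis using Neg.prems(2) by (intro exI[of _ "Neg \<phi>"] exI[of _ u]) simp
  next
    case (Suc k)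
    then show ?thesis using Neg.IH[of k u] Neg.prems by simp
  qed
next
  case (Box \<alpha> \<phi>)
  show ?case
  proof (cases i)
    case 0
    then show ?thesis using Box.prems(2) by (intro exI[of _ "Box \<alpha> \<phi>"] exI[of _ u]) simp
  next
    case (Suc k)
    then show ?thesis using Box.IH[of k u] Box.prems by (auto intro: le_SucI)
  qed
next
  case (Conj \<phi> \<psi>)
  show ?case
  proof (cases i)
    case 0
    then show ?thesis using Conj.prems(2) by (intro exI[of _ "Conj \<phi> \<psi>"] exI[of _ u]) simp
  next
    case (Suc k)
    show ?thesis
    proof (cases "k < length (encode \<phi>)")
      case True
      then have "drop k (encode \<phi>) \<noteq> []" by simp
      then have "no_bit (drop k (encode \<phi>))"
        using Conj.prems(3) Suc True by (cases "drop k (encode \<phi>)") simp_all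
      then obtain \<chi> v where "drop k (encode \<phi>) @ encode \<psi> @ u = encode \<chi> @ v" "no_bit v"
        "depth \<chi> \<le> depth \<phi>" "agents \<chi> \<subseteq> agents \<phi>"
        using Conj.IH(1)[OF True no_bit_encode] by blast
      then show ?thesis using Suc True by (intro exI[of _ \<chi>] exI[of _ v]) auto
    next
      case False
      then have psi: "k - length (encode \<phi>) < length (encode \<psi>)"
        using Conj.prems(1) Suc by simp
      from False obtain \<chi> v where "drop (k - length (encode \<phi>)) (encode \<psi>) @ u = encode \<chi> @ v"
          "no_bit v"
        "depth \<chi> \<le> depth \<psi>" "agents \<chi> \<subseteq> agents \<psi>"
        using Conj.IH(2)[of "k - length (encode \<phi>)" u] psi Conj.prems(2,3) Suc by auto
      then show ?thesis using Suc False by (intro exI[of _ \<chi>] exI[of _ v]) auto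
    qed
  qed
qed

lemma takeWhile_bits: "no_bit v \<Longrightarrow> takeWhile is_bit (map L_Bit bs @ v) = map L_Bit bs"
  by (induction bs) (cases v; auto)+

lemma length_encode:
  "depth \<phi> < length (encode \<phi>)" "card (agents \<phi>) \<le> length (encode \<phi>)"
proof -
  show "depth \<phi> < length (encode \<phi>)" by (induction \<phi>) auto
  show "card (agents \<phi>) \<le> length (encode \<phi>)"
  proof (induction \<phi>)
    case (Conj \<phi> \<psi>)
    then show ?case using card_Un_le[of "agents \<phi>" "agents \<psi>"] by simp
  qed auto
qed

section \<open>The tables of a small model\<close>

locale witness =
  fixes \<phi> :: "nat fm" and P :: "nat \<Rightarrow> int \<times> int" and p :: "int \<times> int" and D M :: nat
  assumes truth: "truth P p \<phi>" and depth: "depth \<phi> < D"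
    and margin: "\<And>i. i \<in> agents \<phi> \<Longrightarrow> int D < fst (P i) \<and> fst (P i) + int D < int M \<and>
      int D < snd (P i) \<and> snd (P i) + int D < int M"
    and p: "0 \<le> fst p \<and> fst p \<le> int M \<and> 0 \<le> snd p \<and> snd p \<le> int M"
    and length: "length (encode \<phi>) \<le> M"
begin

abbreviation w :: "letter list" where "w \<equiv> encode \<phi>"

definition E :: "nat \<Rightarrow> nat \<Rightarrow> bool" where
  "E i j \<longleftrightarrow> j \<le> List.length w \<and> no_bit (drop j w) \<and> (\<exists>\<psi>. drop i w = encode \<psi> @ drop j w)"

definition B :: "nat \<Rightarrow> nat \<Rightarrow> bool" where
  "B i j \<longleftrightarrow> i \<le> List.length w \<and> j \<le> List.length w \<and> no_bit (drop j w) \<and>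
     (\<exists>m. drop i w = map L_Bit (binary m) @ drop j w)"

definition S :: "nat \<Rightarrow> nat \<Rightarrow> bool" where
  "S i j \<longleftrightarrow> takeWhile is_bit (drop i w) = takeWhile is_bit (drop j w)"

definition T :: "nat \<Rightarrow> nat \<Rightarrow> nat \<Rightarrow> bool" where
  "T i x y \<longleftrightarrow> (\<exists>\<psi> v. drop i w = encode \<psi> @ v \<and> no_bit v \<and> truth P (int x, int y) \<psi>)"

lemma T_iff: "drop i w = encode \<psi> @ v \<Longrightarrow> no_bit v \<Longrightarrow> T i x y \<longleftrightarrow> truth P (int x, int y) \<psi>"
  unfolding T_def using encode_append_inject by metis

lemma subformula:
  assumes "letter_at w i a" "\<not> is_bit a"
  obtains \<psi> v where "drop i w = encode \<psi> @ v" "no_bit v" "depth \<psi> < D" "agents \<psi> \<subseteq> agents \<phi>"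
    "a # drop (Suc i) w = encode \<psi> @ v"
proof -
  have i: "drop i w = a # drop (Suc i) w" using assms(1) by (rule drop_letter_at)
  have "\<exists>\<psi> v. drop i w @ [] = encode \<psi> @ v \<and> no_bit v \<and> depth \<psi> \<le> depth \<phi> \<and> agents \<psi> \<subseteq> agents \<phi>"
    by (rule parse_at) (use assms i in \<open>auto simp: letter_at_def\<close>)
  then show thesis using that i depth by fastforce
qed

lemma E_split:
  assumes "drop i w = encode \<psi> @ u" "no_bit u" "i < List.length w"
  obtains j where "j \<le> M" "E i j" "drop j w = u" "j \<le> List.length w"
proof -
  let ?j = "i + List.length (encode \<psi>)"
  have "List.length (drop i w) = List.length (encode \<psi>) + List.length u" using assms(1) by simp
  then have "?j \<le> List.length w" using assms(3) by simp
  moreover have "drop ?j w = u" using assms(1) by (metis add.commute append_eq_conv_conj drop_drop)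
  ultimately show thesis using that[of ?j] assms length by (auto simp: E_def)
qed

text \<open>Coordinates up to 1 are at least D below every agent, so \<open>clip (D - 1)\<close>
  saturates there; likewise from M - 1 on. The bounds are 1 and M - 1 rather than 0 and M because a
  border cell is adjacent to itself while the real step leads one cell into the grid.\<close>

lemma near_border:
  assumes "\<And>i. i \<in> agents \<phi> \<Longrightarrow> int D < a i \<and> a i + int D < int M"
    and "u = v \<or> u \<le> 1 \<and> v \<le> 1 \<or> u \<ge> int M - 1 \<and> v \<ge> int M - 1"
  shows "near (agents \<phi>) a a (D - 1) u v"
  unfolding near_def
proof
  fix i assume "i \<in> agents \<phi>"
  from assms(1)[OF this] assms(2) depth show "clip (D - 1) (u - a i) = clip (D - 1) (v - a i)"
    by (auto simp: clip_def)
qed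

lemma truth_border:
  assumes "agents \<psi> \<subseteq> agents \<phi>" "depth \<psi> < D"
    and "x = x' \<or> x \<le> 1 \<and> x' \<le> 1 \<or> x \<ge> int M - 1 \<and> x' \<ge> int M - 1"
    and "y = y' \<or> y \<le> 1 \<and> y' \<le> 1 \<or> y \<ge> int M - 1 \<and> y' \<ge> int M - 1"
  shows "truth P (x, y) \<psi> \<longleftrightarrow> truth P (x', y') \<psi>"
proof (rule truth_near2[OF _ spread2_refl])
  show "finite (agents \<phi>)" by (induction \<phi>) auto
  have "near (agents \<phi>) (fst \<circ> P) (fst \<circ> P) (D - 1) x x'"
    by (rule near_border) (use margin assms(3) in simp_all)
  moreover have "near (agents \<phi>) (snd \<circ> P) (snd \<circ> P) (D - 1) y y'"
    by (rule near_border) (use margin assms(4) in simp_all)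
  ultimately have "near2 (agents \<phi>) P P (D - 1) (x, y) (x', y')"
    by (simp only: near2_def fst_conv snd_conv simp_thms)
  then show "near2 (agents \<phi>) P P (depth \<psi>) (x, y) (x', y')"
    by (rule near2_weaken) (use assms(2) in simp)
qed (use assms in auto)

lemma truth_adjacent:
  assumes "agents \<psi> \<subseteq> agents \<phi>" "depth \<psi> < D" "adjacent M d x y x' y'"
  shows "truth P (shift d 1 (int x, int y)) \<psi> \<longleftrightarrow> truth P (int x', int y') \<psi>"
  using assms(3)
  by (cases d) (auto simp: succ_def intro!: truth_border[OF assms(1,2)])

lemma truth_extreme:
  assumes "agents \<psi> \<subseteq> agents \<phi>" "depth \<psi> < D" "extreme M d x y"
  shows "truth P (shift d (int n) (int x, int y)) \<psi> \<longleftrightarrow> truth P (int x, int y) \<psi>"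
  using assms(3)
  by (cases d) (auto intro!: truth_border[OF assms(1,2)])

text \<open>The goals are the assumptions of \<open>tables\<close> in order. The conditions on
  letters and names follow from unique readability; those on steps and stars also use the constancy
  of truth beyond the border.\<close>

sublocale tables w M E B S T
proof (unfold_locales, goal_cases)
  case 1
  have "E 0 (List.length w)" by (auto simp: E_def)
  then show ?case using length by blast
next
  case 2
  have "T 0 (nat (fst p)) (nat (snd p))"
    using truth p T_iff[of 0 \<phi> "[]"] by simp
  then show ?case using p by (meson nat_le_iff)
next
  case 3
  show ?case
  proof (intro allI impI, goal_cases)
    case (1 i j)
    then obtain \<psi> where j: "j \<le> List.length w" "no_bit (drop j w)"
        and \<psi>: "drop i w = encode \<psi> @ drop j w"
      by (auto simp: E_def)
    have i: "i < List.length w"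
      using \<psi> encode_nonempty[of \<psi>] by (metis add_gr_0 length_append length_drop zero_less_diff)
    then have i': "Suc i \<le> M" "Suc i \<le> List.length w" using length by simp_all
    show ?case
    proof (cases \<psi>)
      case (Here m)
      then have "letter_at w i L_Here" "drop (Suc i) w = map L_Bit (binary m) @ drop j w"
        using letter_at_drop[of i w L_Here] \<psi> by auto
      then show ?thesis using i' j by (auto simp: B_def)
    next
      case (Neg \<chi>)
      then have "letter_at w i L_Neg" "drop (Suc i) w = encode \<chi> @ drop j w"
        using letter_at_drop[of i w L_Neg] \<psi> by auto
      then show ?thesis using i' j by (auto simp: E_def)
    next
      case (Box \<alpha> \<chi>)
      then have "letter_at w i (L_Box \<alpha>)" "drop (Suc i) w = encode \<chi> @ drop j w"
        using letter_at_drop[of i w "L_Box \<alpha>"] \<psi> by auto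
      moreover have "\<exists>d\<in>{North, South, East, West}. \<alpha> = Step d \<or> \<alpha> = Star d"
        by (cases \<alpha>) (use direction.exhaust in blast)+
      ultimately show ?thesis using i' j by (auto simp: E_def)
    next
      case (Conj \<chi> \<theta>)
      then have *: "letter_at w i L_Conj" "drop (Suc i) w = encode \<chi> @ encode \<theta> @ drop j w"
        using letter_at_drop[of i w L_Conj] \<psi> by auto
      then have "Suc i < List.length w"
        using encode_nonempty[of \<chi>] by (metis add_gr_0 length_append length_drop zero_less_diff)
      then obtain l where "l \<le> M" "E (Suc i) l" "drop l w = encode \<theta> @ drop j w"
        using E_split[OF *(2) no_bit_encode] by blast
      moreover from this have "E l j" using j unfolding E_def by blast
      ultimately show ?thesis using *(1) i' by blast
    qed
  qed
next
  case 4
  show ?case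
  proof (intro allI impI, goal_cases)
    case (1 i j)
    then obtain m where ij: "i \<le> List.length w" "j \<le> List.length w" "no_bit (drop j w)"
      and m: "drop i w = map L_Bit (binary m) @ drop j w" by (auto simp: B_def)
    show ?case
    proof (cases "m = 0")
      case True
      then have "drop i w = drop j w" using m by simp
      then have "i = j" using ij by (metis diff_diff_cancel length_drop)
      then show ?thesis using ij by (simp add: no_bit_drop)
    next
      case False
      then have i: "letter_at w i (L_Bit (odd m))" "drop (Suc i) w = map L_Bit (binary (m div 2))
          @ drop j w"
        using letter_at_drop[of i w "L_Bit (odd m)"] m binary_pos[OF False] by auto
      then have "B (Suc i) j" "Suc i \<le> M" using ij length by (auto simp: B_def letter_at_def)
      moreover have "bit_at w (Suc i)" if "even m"
      proof -
        have "m div 2 \<noteq> 0" using False that by auto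
        then have "\<not> no_bit (drop (Suc i) w)" unfolding i(2) by (simp add: binary_pos)
        then show ?thesis by (simp add: no_bit_drop)
      qed
      ultimately show ?thesis using i(1) by (cases "odd m") auto
    qed
  qed
next
  case 5
  have "takeWhile is_bit (drop i w) = []" if "\<not> bit_at w i" for i
    using that unfolding no_bit_drop[symmetric]
    by (cases "drop i w") auto
  then show ?case
    by (simp add: S_def)
next
  case 6
  show ?case
    by (auto simp: S_def drop_letter_at)
next
  case 7
  show ?case
  proof (intro allI impI, goal_cases)
    case (1 i)
    from 1(2) obtain \<psi> v where \<psi>: "drop i w = encode \<psi> @ v" "no_bit v" "agents \<psi> \<subseteq> agents \<phi>"
      "L_Here # drop (Suc i) w = encode \<psi> @ v"
      by (rule subformula) auto
    then obtain m where m: "\<psi> = Here m" by (cases \<psi>) auto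
    obtain x y where P: "P m = (x, y)" by (cases "P m")
    have "int D < x" "x + int D < int M" "int D < y" "y + int D < int M"
      using margin[of m] \<psi>(3) m P by auto
    moreover have "T i x' y' \<longleftrightarrow> int x' = x \<and> int y' = y" for x' y'
      using T_iff[OF \<psi>(1,2)] m P by auto
    ultimately show ?case
      by (intro exI[of _ "nat x"] exI[of _ "nat y"] conjI) auto
  qed
next
  case 8
  show ?case
  proof (intro allI impI, elim conjE)
    fix i j k l x y
    assume i: "letter_at w i L_Here" and j: "letter_at w j L_Here" and kl: "Suc i = k" "Suc j = l"
      and S: "S k l" and T: "T i x y"
    from i obtain \<psi> v where \<psi>: "drop i w = encode \<psi> @ v" "no_bit v"
      "L_Here # drop (Suc i) w = encode \<psi> @ v"
      by (rule subformula) auto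
    then obtain m where m: "\<psi> = Here m" "drop (Suc i) w = map L_Bit (binary m) @ v"
        by (cases \<psi>) auto
    from j obtain \<psi>' v' where \<psi>': "drop j w = encode \<psi>' @ v'" "no_bit v'"
      "L_Here # drop (Suc j) w = encode \<psi>' @ v'"
      by (rule subformula) auto
    then obtain m' where m': "\<psi>' = Here m'" "drop (Suc j) w = map L_Bit (binary m') @ v'"
        by (cases \<psi>') auto
    have "map L_Bit (binary m) = map L_Bit (binary m')"
      using S \<psi>(2) \<psi>'(2) unfolding S_def kl[symmetric] m(2) m'(2) by (simp add: takeWhile_bits)
    then have "binary m = binary m'" by (rule map_injective) (simp add: inj_def)
    then have "m = m'" by (rule binary_inject)
    then show "T j x y" using T T_iff[OF \<psi>(1,2)] T_iff[OF \<psi>'(1,2)] m m' by simp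
  qed
next
  case 9
  show ?case
  proof (intro allI impI, elim conjE)
    fix i k x y assume i: "letter_at w i L_Neg" and k: "Suc i = k"
    from i obtain \<psi> v where \<psi>: "drop i w = encode \<psi> @ v" "no_bit v"
      "L_Neg # drop (Suc i) w = encode \<psi> @ v"
      by (rule subformula) auto
    then obtain \<chi> where \<chi>: "\<psi> = Neg \<chi>" "drop k w = encode \<chi> @ v" using k by (cases \<psi>) auto
    show "T i x y \<longleftrightarrow> \<not> T k x y"
      unfolding T_iff[OF \<psi>(1,2)] T_iff[OF \<chi>(2) \<psi>(2)] \<chi>(1) by simp
  qed
next
  case 10
  show ?case
  proof (intro allI impI, elim conjE)
    fix i k l x y assume i: "letter_at w i L_Conj" and k: "Suc i = k" and l: "E k l"
    from i obtain \<psi> v where \<psi>: "drop i w = encode \<psi> @ v" "no_bit v"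
      "L_Conj # drop (Suc i) w = encode \<psi> @ v"
      by (rule subformula) auto
    then obtain \<chi> \<theta> where \<chi>: "\<psi> = Conj \<chi> \<theta>" "drop k w = encode \<chi> @ encode \<theta> @ v"
      using k by (cases \<psi>) auto
    from l obtain \<chi>' where "drop k w = encode \<chi>' @ drop l w" "no_bit (drop l w)"
      by (auto simp: E_def)
    \<comment> \<open>By unique readability the first conjunct ends where \<open>E\<close> says it
      does.\<close>
    then have "drop l w = encode \<theta> @ v"
      using \<chi>(2) encode_append_inject no_bit_encode by metis
    then show "T i x y \<longleftrightarrow> T k x y \<and> T l x y"
      unfolding T_iff[OF \<psi>(1,2)] T_iff[OF \<chi>(2) no_bit_encode] \<chi>(1) using T_iff \<psi>(2) by simp
  qed
next
  case 11
  show ?case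
  proof (intro allI impI ballI, elim conjE)
    fix d i k x y x' y' assume i: "letter_at w i (L_Box (Step d))" and k: "Suc i = k"
      and adj: "adjacent M d x y x' y'"
    from i obtain \<psi> v where \<psi>: "drop i w = encode \<psi> @ v" "no_bit v"
      "L_Box (Step d) # drop (Suc i) w = encode \<psi> @ v" "depth \<psi> < D" "agents \<psi> \<subseteq> agents \<phi>"
      by (rule subformula) auto
    then obtain \<chi> where \<chi>: "\<psi> = Box (Step d) \<chi>" "drop k w = encode \<chi> @ v" using k by (cases \<psi>) auto
    have "agents \<chi> \<subseteq> agents \<phi>" "depth \<chi> < D" using \<psi>(4,5) \<chi>(1) by auto
    from truth_adjacent[OF this adj] show "T i x y \<longleftrightarrow> T k x' y'"
      unfolding T_iff[OF \<psi>(1,2)] T_iff[OF \<chi>(2) \<psi>(2)] \<chi>(1) by (simp only: truth_Box)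
  qed
next
  case 12
  show ?case
  proof (intro allI impI ballI, elim conjE)
    fix d i k x y x' y' assume i: "letter_at w i (L_Box (Star d))" and k: "Suc i = k"
    from i obtain \<psi> v where \<psi>: "drop i w = encode \<psi> @ v" "no_bit v"
      "L_Box (Star d) # drop (Suc i) w = encode \<psi> @ v" "depth \<psi> < D" "agents \<psi> \<subseteq> agents \<phi>"
      by (rule subformula) auto
    then obtain \<chi> where \<chi>: "\<psi> = Box (Star d) \<chi>" "drop k w = encode \<chi> @ v" using k by (cases \<psi>) auto
    have \<chi>': "agents \<chi> \<subseteq> agents \<phi>" "depth \<chi> < D" using \<psi>(4,5) \<chi>(1) by auto
    have "T i x y \<longleftrightarrow> T k x y \<and> T i x' y'" if "adjacent M d x y x' y'"
      unfolding T_iff[OF \<psi>(1,2)] T_iff[OF \<chi>(2) \<psi>(2)]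
      using truth_adjacent[OF \<psi>(5,4) that] truth_Star_unfold[of P _ d \<chi>] unfolding \<chi>(1) by blast
    moreover have "T i x y \<longleftrightarrow> T k x y" if "extreme M d x y"
      unfolding T_iff[OF \<psi>(1,2)] T_iff[OF \<chi>(2) \<psi>(2)] \<chi>(1) truth_Box
      using truth_extreme[OF \<chi>' that] by simp
    ultimately show "(adjacent M d x y x' y' \<longrightarrow> (T i x y \<longleftrightarrow> T k x y \<and> T i x' y')) \<and>
        (extreme M d x y \<longrightarrow> (T i x y \<longleftrightarrow> T k x y))" by blast
  qed
qed

lemma names:
  assumes "agents \<phi> \<subseteq> A"
  shows "\<forall>i\<le>M. letter_at w i L_Here \<longrightarrow> (\<exists>m\<in>A. name_at w i m)"
proof (intro allI impI)
  fix i assume "letter_at w i L_Here"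
  then obtain \<psi> v where \<psi>: "drop i w = encode \<psi> @ v" "no_bit v" "agents \<psi> \<subseteq> agents \<phi>"
    "L_Here # drop (Suc i) w = encode \<psi> @ v"
    by (rule subformula) auto
  then obtain m where "\<psi> = Here m" "drop (Suc i) w = map L_Bit (binary m) @ v" by (cases \<psi>) auto
  with \<psi> assms show "\<exists>m\<in>A. name_at w i m" by (auto simp: name_at_iff)
qed

end

lemma complete:
  assumes "truth P p \<phi>" "agents \<phi> \<subseteq> A"
  shows "\<exists>M\<le>(length (encode \<phi>) + 2) ^ Suc 3. \<exists>E B S T. tables (encode \<phi>) M E B S T \<and>
    (\<forall>i\<le>M. letter_at (encode \<phi>) i L_Here \<longrightarrow> (\<exists>m\<in>A. name_at (encode \<phi>) i m))"
proof -
  define n where "n = length (encode \<phi>)"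
  \<comment> \<open>This is the bound of \<open>small_model\<close> with threshold n, which exceeds
    the depth, and at most n agents besides the point of evaluation. The exponent 4 below arises
    from M \<le> 4 * (n + 2)^2 and 4 \<le> (n + 2)^2.\<close>
  define M where "M = (n + 1) * (4 * n + 5)"
  have "(card (agents \<phi>) + 1) * (4 * n + 5) \<le> M"
    unfolding M_def n_def using length_encode(2)[of \<phi>] by (intro mult_right_mono) auto
  moreover have "depth \<phi> < n" using length_encode(1)[of \<phi>] by (simp add: n_def)
  ultimately obtain Q q where "truth Q q \<phi>"
    "\<And>i. i \<in> agents \<phi> \<Longrightarrow> int n < fst (Q i) \<and> fst (Q i) + int n < int M \<and>
      int n < snd (Q i) \<and> snd (Q i) + int n < int M"
    "0 \<le> fst q \<and> fst q \<le> int M \<and> 0 \<le> snd q \<and> snd q \<le> int M"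
    using small_model[OF assms(1), of n M] by auto
  then interpret witness \<phi> Q q n M
    using \<open>depth \<phi> < n\<close> by unfold_locales (auto simp: M_def n_def)
  have "M \<le> (n + 2) * (4 * (n + 2))" unfolding M_def by (intro mult_mono) auto
  also have "\<dots> \<le> (n + 2) ^ 2 * (n + 2) ^ 2"
    by (simp add: power2_eq_square algebra_simps)
  also have "\<dots> = (n + 2) ^ Suc 3" by (simp add: power_add[symmetric])
  finally have "M \<le> (length (encode \<phi>) + 2) ^ Suc 3" unfolding n_def .
  then show ?thesis using names[OF assms(2)] tables_axioms by blast
qed

text \<open>One argument for both languages of the theorem: \<open>Some ms\<close> restricts the
  agents to a fixed finite set, \<open>None\<close> admits all of them and replaces the restriction
  by a trivially true equation.\<close>

lemma in_NP:
  fixes ms :: "nat list option"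
  defines "A \<equiv> case ms of None \<Rightarrow> UNIV | Some ms \<Rightarrow> set ms"
  shows "{encode \<phi> | \<phi>. agents \<phi> \<subseteq> A \<and> (\<exists>P p. truth P p \<phi>)} \<in> NP" (is "?L \<in> NP")
proof -
  let ?names = "case ms of None \<Rightarrow> FEq 0 0 0 | Some ms \<Rightarrow> names_fo ms"
  let ?\<phi> = "FAnd (every sentences id) ?names"
  have eval: "eval w M R ((\<lambda>_. 0)(0 := M)) ?\<phi> \<longleftrightarrow>
      tables w M (\<lambda>i j. R 0 i j 0) (\<lambda>i j. R 1 i j 0) (\<lambda>i j. R 2 i j 0) (R 3) \<and>
      (\<forall>i\<le>M. letter_at w i L_Here \<longrightarrow> A = UNIV \<or> (\<exists>m\<in>A. name_at w i m))" for w M R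
  proof (cases ms)
    case None
    then show ?thesis unfolding eval.simps(6) eval_sentences by (simp add: A_def)
  next
    case (Some l)
    moreover have "finite A" using Some by (simp add: A_def)
    then have "A \<noteq> UNIV" using infinite_UNIV_nat by auto
    ultimately show ?thesis
      unfolding eval.simps(6) eval_sentences by (simp add: eval_names A_def)
  qed
  show ?thesis
  proof (rule fo_in_NP)
    show "wf_fo ?\<phi>" using wf_sentences by (auto split: option.splits)
    fix w
    show "w \<in> ?L \<longleftrightarrow> (\<exists>M\<le>(length w + 2) ^ Suc 3. \<exists>R. eval w M R ((\<lambda>_. 0)(0 := M)) ?\<phi>)"
      (is "_ \<longleftrightarrow> ?R")
    proof
      assume "w \<in> ?L"
      then obtain \<phi> P p where \<phi>: "w = encode \<phi>" "agents \<phi> \<subseteq> A" "truth P p \<phi>" by blast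
      from complete[OF \<phi>(3,2)] obtain M E B S T where M: "M \<le> (length w + 2) ^ Suc 3"
        and t: "tables w M E B S T"
        and n: "\<forall>i\<le>M. letter_at w i L_Here \<longrightarrow> (\<exists>m\<in>A. name_at w i m)" unfolding \<phi>(1) by blast
      define R :: "nat \<Rightarrow> nat \<Rightarrow> nat \<Rightarrow> nat \<Rightarrow> bool" where
        "R r x y z = (if r = 0 then E x y else if r = 1 then B x y else if r =
            2 then S x y else T x y z)"
        for r x y z
      have R: "(\<lambda>i j. R 0 i j 0) = E" "(\<lambda>i j. R 1 i j 0) = B" "(\<lambda>i j. R 2 i j 0) = S" "R 3 = T"
        by (auto simp: R_def fun_eq_iff)
      show ?R unfolding eval
        using M t n by (intro exI[of _ M] conjI exI[of _ R]) (simp_all only: R, blast)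
    next
      assume ?R
      then obtain M and R :: "nat \<Rightarrow> nat \<Rightarrow> nat \<Rightarrow> nat \<Rightarrow> bool"
          where t: "tables w M (\<lambda>i j. R 0 i j 0) (\<lambda>i j. R 1 i j 0) (\<lambda>i j. R 2 i j 0) (R 3)"
        and n: "\<forall>i\<le>M. letter_at w i L_Here \<longrightarrow> A = UNIV \<or> (\<exists>m\<in>A. name_at w i m)"
        unfolding eval by blast
      interpret tables w M "\<lambda>i j. R 0 i j 0" "\<lambda>i j. R 1 i j 0" "\<lambda>i j. R 2 i j 0" "R 3" by (rule t)
      obtain \<phi> P p where \<phi>: "w = encode \<phi>" "truth P p \<phi>" using sound by blast
      have "agents \<phi> \<subseteq> A"
      proof (cases "A = UNIV")
        case False
        then show ?thesis using agents_names[of M \<phi> A] n length_le \<phi>(1) by auto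
      qed simp
      then show "w \<in> ?L" using \<phi> by blast
    qed
  qed
qed

theorem theorem7:
  "(\<forall>Agt. finite Agt \<longrightarrow> SAT Agt \<in> NP) \<and> (\<Union>Agt \<in> {Agt. finite Agt}. SAT Agt) \<in> NP"
proof (intro conjI allI impI)
  have SAT: "SAT Agt = {encode \<phi> | \<phi>. agents \<phi> \<subseteq> Agt \<and> (\<exists>P p. truth P p \<phi>)}" for Agt
    unfolding SAT_def formulas_def mem_Collect_eq
    by (intro Collect_cong ex_cong1 conj_cong refl satisfiable_iff)
  show "SAT Agt \<in> NP" if "finite Agt" for Agt
  proof -
    from that obtain ms where "set ms = Agt" using finite_list by blast
    then show ?thesis using in_NP[of "Some ms"] by (simp add: SAT)
  qed
  have fin: "finite (agents \<phi>)" for \<phi> :: "nat fm" by (induction \<phi>) auto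
  \<comment> \<open>Every formula mentions finitely many agents, so the union consists of the codes
    of all satisfiable formulas; this is the case \<open>None\<close>.\<close>
  have "(\<Union>Agt \<in> {Agt. finite Agt}. SAT Agt) = {encode \<phi> | \<phi>. agents \<phi> \<subseteq> UNIV \<and> (\<exists>P p. truth P p \<phi>)}"
  proof (intro equalityI subsetI)
    fix u assume "u \<in> {encode \<phi> | \<phi>. agents \<phi> \<subseteq> UNIV \<and> (\<exists>P p. truth P p \<phi>)}"
    then obtain \<phi> where "u = encode \<phi>" "\<exists>P p. truth P p \<phi>" by blast
    then have "u \<in> SAT (agents \<phi>)" unfolding SAT by blast
    then show "u \<in> (\<Union>Agt \<in> {Agt. finite Agt}. SAT Agt)" using fin by blast
  next
    fix u assume "u \<in> (\<Union>Agt \<in> {Agt. finite Agt}. SAT Agt)"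
    then obtain Agt where "u \<in> SAT Agt" by blast
    then show "u \<in> {encode \<phi> | \<phi>. agents \<phi> \<subseteq> UNIV \<and> (\<exists>P p. truth P p \<phi>)}"
      unfolding SAT by blast
  qed
  then show "(\<Union>Agt \<in> {Agt. finite Agt}. SAT Agt) \<in> NP" using in_NP[of None] by simp
qed

end
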